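(* Let $p\ge 1$ be an integer and let $V=S^p\mathbb{R}^3$ be equipped with the Bombieri inner product. Let $X\subset V$ be the manifold of all non-zero elements of the form $\pm u^p$ with $u\in\mathbb{R}^3$. When $v\in V$ is drawn from the standard Gaussian distribution relative to the Bombieri norm, the expected number of critical points on $X$ of $d_v(x)=\|v-x\|^2$ equals $$1+4\cdot\frac{p-1}{3p-2}\sqrt{(3p-2)(p-1)}.$$
   Context: $S^p\mathbb{R}^3$ is the space of homogeneous polynomials of degree $p$ in the standard basis $e_1,e_2,e_3$ of $\mathbb{R}^3$. The Bombieri inner product is the one in which the monomials $e_1^{\alpha_1}e_2^{\alpha_2}e_3^{\alpha_3}$ ($\alpha_1+\alpha_2+\alpha_3=p$) form an orthogonal basis with squared norms $\frac{\alpha_1!\,\alpha_2!\,\alpha_3!}{p!}$. The standard Gaussian distribution relative to this norm is the one for which the coordinates of $v$ in an orthonormal basis are independent standard normal variables. For $u=\sum_i t_ie_i$, $u^p$ denotes the polynomial $(\sum_i t_ie_i)^p$. A point $x\in X$ is a critical point of $d_v$ on $X$ if $v-x\perp T_xX$. *)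

theory Defs
  imports "HOL-Probability.Probability" "HOL-Library.Poly_Mapping"
begin

instantiation poly_mapping :: (type, real_vector) real_vector
begin

lift_definition scaleR_poly_mapping :: "real \<Rightarrow> ('a \<Rightarrow>\<^sub>0 'b) \<Rightarrow> ('a \<Rightarrow>\<^sub>0 'b)"
  is "\<lambda>c f k. c *\<^sub>R f k"
  by (rule finite_subset[rotated]) auto

instance
  by standard (transfer; simp add: fun_eq_iff scaleR_add_right scaleR_add_left)+

end

lemma lookup_scaleR: "Poly_Mapping.lookup (c *\<^sub>R f) k = c *\<^sub>R Poly_Mapping.lookup f k"
  by transfer simp

text \<open>
  An element of \<open>real_poly3\<close> is a polynomial with real coefficients in the three
  variables \<open>basis_vec i\<close>, \<open>i :: 3\<close>: it maps each exponent vector to its coefficient, so that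
  \<open>Poly_Mapping.single \<alpha> 1\<close> is the monomial with exponents \<open>\<alpha>\<close>, and \<open>*\<close>, \<open>^\<close> are the
  multiplication and power of polynomials.
\<close>

type_synonym real_poly3 = "(3 \<Rightarrow>\<^sub>0 nat) \<Rightarrow>\<^sub>0 real"

definition exponents :: "nat \<Rightarrow> (3 \<Rightarrow>\<^sub>0 nat) set" where
  "exponents p = {\<alpha>. (\<Sum>i\<in>UNIV. Poly_Mapping.lookup \<alpha> i) = p}"

definition sym_power :: "nat \<Rightarrow> real_poly3 set" where
  "sym_power p = {f. Poly_Mapping.keys f \<subseteq> exponents p}"

definition bombieri :: "nat \<Rightarrow> real_poly3 \<Rightarrow> real_poly3 \<Rightarrow> real" where
  "bombieri p f g =
    (\<Sum>\<alpha>\<in>exponents p. (\<Prod>i\<in>UNIV. fact (Poly_Mapping.lookup \<alpha> i)) / fact p *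
      Poly_Mapping.lookup f \<alpha> * Poly_Mapping.lookup g \<alpha>)"

definition basis_vec :: "3 \<Rightarrow> real_poly3" where
  "basis_vec i = Poly_Mapping.single (Poly_Mapping.single i 1) 1"

definition linear_form :: "real ^ 3 \<Rightarrow> real_poly3" where
  "linear_form t = (\<Sum>i\<in>UNIV. (t $ i) *\<^sub>R basis_vec i)"

definition pure_powers :: "nat \<Rightarrow> real_poly3 set" where
  "pure_powers p = {x. x \<noteq> 0 \<and> (\<exists>t. x = linear_form t ^ p \<or> x = - (linear_form t ^ p))}"

text \<open>
  Tangent vectors are the velocities at time 0 of continuously differentiable curves in \<open>X\<close>
  through \<open>x\<close>.  In the finite-dimensional space of homogeneous polynomials, differentiability
  of a curve is differentiability of all its coefficients.
\<close>

definition tangent_space :: "real_poly3 set \<Rightarrow> real_poly3 \<Rightarrow> real_poly3 set" where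
  "tangent_space X x =
    {w. \<exists>\<gamma> \<epsilon>. \<epsilon> > 0 \<and> (\<forall>t\<in>{-\<epsilon><..<\<epsilon>}. \<gamma> t \<in> X) \<and> \<gamma> 0 = x \<and>
          (\<forall>\<alpha>. (\<lambda>t. Poly_Mapping.lookup (\<gamma> t) \<alpha>) C1_differentiable_on {-\<epsilon><..<\<epsilon>} \<and>
               ((\<lambda>t. Poly_Mapping.lookup (\<gamma> t) \<alpha>) has_real_derivative Poly_Mapping.lookup w \<alpha>) (at 0))}"

definition critical_points :: "nat \<Rightarrow> real_poly3 set \<Rightarrow> real_poly3 \<Rightarrow> real_poly3 set" where
  "critical_points p X v = {x \<in> X. \<forall>w\<in>tangent_space X x. bombieri p (v - x) w = 0}"

text \<open>Counting measure rather than \<^const>\<open>card\<close>, so that an infinite set counts as \<open>\<infinity>\<close>.\<close>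

definition num_critical_points :: "nat \<Rightarrow> real_poly3 set \<Rightarrow> real_poly3 \<Rightarrow> ennreal" where
  "num_critical_points p X v = emeasure (count_space UNIV) (critical_points p X v)"

definition bombieri_orthonormal_basis :: "nat \<Rightarrow> real_poly3 set \<Rightarrow> bool" where
  "bombieri_orthonormal_basis p B \<longleftrightarrow>
    span B = sym_power p \<and> (\<forall>b\<in>B. \<forall>c\<in>B. bombieri p b c = (if b = c then 1 else 0))"

definition standard_gaussian :: "nat \<Rightarrow> 'w measure \<Rightarrow> ('w \<Rightarrow> real_poly3) \<Rightarrow> bool" where
  "standard_gaussian p M v \<longleftrightarrow>
    (\<forall>\<omega>\<in>space M. v \<omega> \<in> sym_power p) \<and>
    (\<exists>B. bombieri_orthonormal_basis p B \<and>
         prob_space.indep_vars M (\<lambda>_. borel) (\<lambda>b \<omega>. bombieri p b (v \<omega>)) B \<and>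
         (\<forall>b\<in>B. distributed M lborel (\<lambda>\<omega>. bombieri p b (v \<omega>))
            (\<lambda>x. ennreal (std_normal_density x))))"

lemma finite_exponents: "finite (exponents p)"
proof -
  have "Poly_Mapping.lookup ` exponents p \<subseteq> PiE UNIV (\<lambda>_. {..p})"
  proof
    fix f assume "f \<in> Poly_Mapping.lookup ` exponents p"
    then obtain \<alpha> where f: "f = Poly_Mapping.lookup \<alpha>" and s: "(\<Sum>i\<in>UNIV. Poly_Mapping.lookup \<alpha> i) = p"
      by (auto simp: exponents_def)
    have "Poly_Mapping.lookup \<alpha> i \<le> p" for i
      unfolding s[symmetric] by (rule member_le_sum) auto
    then show "f \<in> PiE UNIV (\<lambda>_. {..p})" using f by auto
  qed
  then have "finite (Poly_Mapping.lookup ` exponents p)"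
    by (rule finite_subset) (simp add: finite_PiE)
  then show ?thesis
    by (rule finite_imageD) (auto simp: inj_on_def)
qed

lemma bombieri_monomials:
  assumes "\<alpha> \<in> exponents p" "\<beta> \<in> exponents p"
  shows "bombieri p (Poly_Mapping.single \<alpha> 1) (Poly_Mapping.single \<beta> 1) =
    (if \<alpha> = \<beta> then (\<Prod>i\<in>UNIV. fact (Poly_Mapping.lookup \<alpha> i)) / fact p else 0)"
proof -
  have "bombieri p (Poly_Mapping.single \<alpha> 1) (Poly_Mapping.single \<beta> 1) =
      (\<Sum>\<gamma>\<in>exponents p. if \<gamma> = \<alpha> then
        (if \<alpha> = \<beta> then (\<Prod>i\<in>UNIV. fact (Poly_Mapping.lookup \<alpha> i)) / fact p else 0) else 0)"
    unfolding bombieri_def by (intro sum.cong) (auto simp: lookup_single when_def)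
  then show ?thesis using assms finite_exponents by simp
qed

end

theory Submission
  imports Defs
begin

text \<open>
  A point of \<open>X\<close> is \<open>c u\<^sup>p\<close> with \<open>u\<close> determined up to scaling, and it is critical for \<open>d\<^sub>v\<close> iff
  \<open>c |u|\<^sup>2\<^sup>p = \<langle>v, u\<^sup>p\<rangle> \<noteq> 0\<close> and the gradient of \<open>v\<close> at \<open>u\<close> is parallel to \<open>u\<close>.  In an affine chart
  \<open>u = n + z\<^sub>1 e + z\<^sub>2 f\<close> these are two equations in \<open>z\<close> that are linear in \<open>v\<close>.  Solving them for the two
  coordinates of \<open>v\<close> along \<open>n\<^sup>p\<^sup>-\<^sup>1 e\<close> and \<open>n\<^sup>p\<^sup>-\<^sup>1 f\<close> turns the number of solutions, with all other coordinates
  fixed, into the multiplicity function of a map of the plane, and the area formula gives the Kac-Rice density.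
  At a fixed \<open>z\<close> the density is computed in a frame adapted to \<open>u\<close>, where the 2-jet of \<open>v\<close> has independent
  coordinates: it is \<open>p E |D| / (2 \<pi> |u|\<^sup>3)\<close>, with \<open>D\<close> the determinant of a random symmetric 2 by 2 matrix shifted
  by an independent multiple of the identity.  Since the area of the half sphere is \<open>2 \<pi>\<close>, the answer is \<open>p E |D|\<close>.

  The linear system degenerates on a circle of the chart, and the chart misses a line at infinity; these have
  measure zero in the charts of countably many other frames that cover them, so almost surely they contain no
  critical direction.
\<close>

section \<open>Gaussian integrals\<close>

text \<open>The law of the determinant D depends on the degree only through
  \<open>k = (p - 1) / p\<close>: in an adapted frame the rescaled Hessian of v has independent
  entries, of variance 2 k on the diagonal and k off it, and the shift is the value of v, of
  variance 1. Two plane rotations reduce E |D| to E |(1 + k) z^2 - k (b^2 + c^2)|, where b^2 + c^2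
  is exponentially distributed; this gives 1 - k + 4 k sqrt (k / (1 + 2 k)). Two difficulties shape
  the rest. The coordinates solved for, those along \<open>q1\<close> and \<open>q2\<close>, are the
  same in the whole chart, whereas the jet that is natural at z moves with z;
  \<open>gaussian_law_oblique\<close> passes from the one to the other. And the count must be
  measurable in v for every v, not only outside the exceptional null set, so it is also expressed
  through zeros on the unit sphere. Degree one has no second-order jet and is treated directly:
  there X consists of all nonzero linear forms.\<close>

abbreviation gauss :: "real measure" where "gauss \<equiv> std_normal_distribution"

lemma prob_space_gauss: "prob_space gauss"
  by (rule prob_space_normal_density) simp

lemma nn_integral_gauss:
  assumes [measurable]: "f \<in> borel_measurable borel"
  shows "(\<integral>\<^sup>+x. f x \<partial>gauss) = (\<integral>\<^sup>+x. ennreal (std_normal_density x) * f x \<partial>lborel)"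
  by (subst nn_integral_density) auto

text \<open>A plane rotation is a composition of one scaled shear in each coordinate.\<close>

lemma nn_integral_lborel_rotate:
  fixes c s :: real
  assumes g[measurable]: "(\<lambda>(x, y). g x y) \<in> borel_measurable (borel \<Otimes>\<^sub>M borel)" and cs: "c\<^sup>2 + s\<^sup>2 = 1"
  shows "(\<integral>\<^sup>+x. \<integral>\<^sup>+y. g (c * x - s * y) (s * x + c * y) \<partial>lborel \<partial>lborel) = (\<integral>\<^sup>+x. \<integral>\<^sup>+y. g x y \<partial>lborel \<partial>(lborel :: real measure))"
proof (cases "c = 0")
  case True
  \<comment> \<open>The substitutions of the other case divide by \<open>c\<close>; here the
    rotation only swaps the coordinates up to signs.\<close>
  then have s: "s * s = 1" "s \<noteq> 0" "\<bar>s\<bar> = 1" using cs by (auto simp: power2_eq_square square_eq_1_iff)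
  have "(\<integral>\<^sup>+x. \<integral>\<^sup>+y. g x y \<partial>lborel \<partial>(lborel :: real measure)) = (\<integral>\<^sup>+x. \<integral>\<^sup>+y. g x (0 + s * y) \<partial>lborel \<partial>(lborel :: real measure))"
  proof (rule nn_integral_cong)
    fix x :: real
    show "(\<integral>\<^sup>+y. g x y \<partial>lborel) = (\<integral>\<^sup>+y. g x (0 + s * y) \<partial>lborel)"
      using s nn_integral_real_affine[where c=s and t=0 and f="g x"] by simp
  qed
  also have "\<dots> = (\<integral>\<^sup>+x. \<integral>\<^sup>+y. g (0 + (-s) * x) (0 + s * y) \<partial>lborel \<partial>(lborel :: real measure))"
    using s by (subst nn_integral_real_affine[where c="-s" and t=0]) auto
  also have "\<dots> = (\<integral>\<^sup>+y. \<integral>\<^sup>+x. g (0 + (-s) * x) (0 + s * y) \<partial>lborel \<partial>(lborel :: real measure))"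
    by (rule lborel_pair.Fubini') measurable
  finally show ?thesis using True by simp
next
  case False
  have "(\<integral>\<^sup>+x. \<integral>\<^sup>+y. g (c * x - s * y) (s * x + c * y) \<partial>lborel \<partial>(lborel :: real measure)) =
    (\<integral>\<^sup>+y. \<integral>\<^sup>+x. g (c * x - s * y) (s * x + c * y) \<partial>lborel \<partial>(lborel :: real measure))"
    by (rule lborel_pair.Fubini'[symmetric]) measurable
  also have "\<dots> = (\<integral>\<^sup>+y. ennreal \<bar>1/c\<bar> * (\<integral>\<^sup>+x. g x (s / c * x + 1 / c * y) \<partial>lborel) \<partial>(lborel :: real measure))"
  proof (rule nn_integral_cong)
    fix y :: real
    \<comment> \<open>Replacing x by (s / c) y + x / c straightens the first argument and costs a
      factor 1 / |c|; after exchanging the integrals, the substitution in y absorbs that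
      factor.\<close>
    have 1: "c * (s / c * y + 1 / c * x) - s * y = x" for x using False by (simp add: field_simps)
    have 2: "s * (s / c * y + 1 / c * x) + c * y = s / c * x + 1 / c * y" for x
    proof -
      have "s * (s / c * y + 1 / c * x) + c * y = s / c * x + (c\<^sup>2 + s\<^sup>2) / c * y"
        using False by (simp add: field_simps power2_eq_square)
      then show ?thesis by (simp add: cs)
    qed
    show "(\<integral>\<^sup>+x. g (c * x - s * y) (s * x + c * y) \<partial>lborel) = ennreal \<bar>1/c\<bar> * (\<integral>\<^sup>+x. g x (s / c * x + 1 / c * y) \<partial>lborel)"
      using False nn_integral_real_affine[where c="1/c" and t="s/c * y" and f="\<lambda>x. g (c * x - s * y) (s * x + c * y)", unfolded 1 2] by simp
  qed
  also have "\<dots> = ennreal \<bar>1/c\<bar> * (\<integral>\<^sup>+y. \<integral>\<^sup>+x. g x (s / c * x + 1 / c * y) \<partial>lborel \<partial>(lborel :: real measure))"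
    by (rule nn_integral_cmult) measurable
  also have "\<dots> = ennreal \<bar>1/c\<bar> * (\<integral>\<^sup>+x. \<integral>\<^sup>+y. g x (s / c * x + 1 / c * y) \<partial>lborel \<partial>(lborel :: real measure))"
    by (intro arg_cong[where f="\<lambda>u. _ * u"] lborel_pair.Fubini') measurable
  also have "\<dots> = (\<integral>\<^sup>+x. ennreal \<bar>1/c\<bar> * (\<integral>\<^sup>+y. g x (s / c * x + 1 / c * y) \<partial>lborel) \<partial>(lborel :: real measure))"
    by (rule nn_integral_cmult[symmetric]) measurable
  also have "\<dots> = (\<integral>\<^sup>+x. \<integral>\<^sup>+y. g x y \<partial>lborel \<partial>(lborel :: real measure))"
    using False by (intro nn_integral_cong, subst (2) nn_integral_real_affine[where c="1/c"]) auto
  finally show ?thesis .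
qed

lemma std_normal_density_mult:
  "std_normal_density x * std_normal_density y = exp (- (x\<^sup>2 + y\<^sup>2) / 2) / (2 * pi)"
  by (simp add: std_normal_density_def exp_add[symmetric] add_divide_distrib diff_divide_distrib real_sqrt_mult[symmetric])

lemma nn_integral_gauss_gauss:
  assumes g[measurable]: "(\<lambda>(x, y). g x y) \<in> borel_measurable (borel \<Otimes>\<^sub>M borel)"
  shows "(\<integral>\<^sup>+x. \<integral>\<^sup>+y. g x y \<partial>gauss \<partial>gauss) =
    (\<integral>\<^sup>+x. \<integral>\<^sup>+y. ennreal (exp (- (x\<^sup>2 + y\<^sup>2) / 2) / (2 * pi)) * g x y \<partial>lborel \<partial>lborel)"
proof -
  have "(\<integral>\<^sup>+x. \<integral>\<^sup>+y. g x y \<partial>gauss \<partial>gauss) = (\<integral>\<^sup>+x. ennreal (std_normal_density x) * (\<integral>\<^sup>+y. ennreal (std_normal_density y) * g x y \<partial>lborel) \<partial>lborel)"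
  proof -
    have "(\<integral>\<^sup>+x. \<integral>\<^sup>+y. g x y \<partial>gauss \<partial>gauss) = (\<integral>\<^sup>+x. \<integral>\<^sup>+y. ennreal (std_normal_density y) * g x y \<partial>lborel \<partial>gauss)"
      by (intro nn_integral_cong nn_integral_gauss) measurable
    also have "\<dots> = (\<integral>\<^sup>+x. ennreal (std_normal_density x) * (\<integral>\<^sup>+y. ennreal (std_normal_density y) * g x y \<partial>lborel) \<partial>lborel)"
      by (rule nn_integral_gauss) measurable
    finally show ?thesis .
  qed
  also have "\<dots> = (\<integral>\<^sup>+x. \<integral>\<^sup>+y. ennreal (std_normal_density x) * (ennreal (std_normal_density y) * g x y) \<partial>lborel \<partial>lborel)"
    by (intro nn_integral_cong nn_integral_cmult[symmetric]) measurable
  also have "\<dots> = (\<integral>\<^sup>+x. \<integral>\<^sup>+y. ennreal (exp (- (x\<^sup>2 + y\<^sup>2) / 2) / (2 * pi)) * g x y \<partial>lborel \<partial>lborel)"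
    by (intro nn_integral_cong) (simp add: mult.assoc[symmetric] ennreal_mult'[symmetric] std_normal_density_mult)
  finally show ?thesis .
qed

text \<open>The joint density depends on x^2 + y^2 only, so it can be moved inside the rotated
  function, and invariance of Lebesgue measure applies.\<close>

lemma nn_integral_gauss_rotate:
  fixes c s :: real
  assumes g[measurable]: "(\<lambda>(x, y). g x y) \<in> borel_measurable (borel \<Otimes>\<^sub>M borel)" and cs: "c\<^sup>2 + s\<^sup>2 = 1"
  shows "(\<integral>\<^sup>+x. \<integral>\<^sup>+y. g (c * x - s * y) (s * x + c * y) \<partial>gauss \<partial>gauss) = (\<integral>\<^sup>+x. \<integral>\<^sup>+y. g x y \<partial>gauss \<partial>gauss)"
proof -
  have sq: "(c * x - s * y)\<^sup>2 + (s * x + c * y)\<^sup>2 = x\<^sup>2 + y\<^sup>2" for x y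
  proof -
    have "(c * x - s * y)\<^sup>2 + (s * x + c * y)\<^sup>2 = (c\<^sup>2 + s\<^sup>2) * (x\<^sup>2 + y\<^sup>2)" by (simp add: power2_eq_square algebra_simps)
    then show ?thesis by (simp add: cs)
  qed
  let ?g = "\<lambda>x y. ennreal (exp (- (x\<^sup>2 + y\<^sup>2) / 2) / (2 * pi)) * g x y"
  have "(\<integral>\<^sup>+x. \<integral>\<^sup>+y. g (c * x - s * y) (s * x + c * y) \<partial>gauss \<partial>gauss) = (\<integral>\<^sup>+x. \<integral>\<^sup>+y. ?g (c * x - s * y) (s * x + c * y) \<partial>lborel \<partial>lborel)"
    by (subst nn_integral_gauss_gauss) (measurable, simp only: sq)
  also have "\<dots> = (\<integral>\<^sup>+x. \<integral>\<^sup>+y. ?g x y \<partial>lborel \<partial>lborel)"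
    by (rule nn_integral_lborel_rotate[OF _ cs]) measurable
  also have "\<dots> = (\<integral>\<^sup>+x. \<integral>\<^sup>+y. g x y \<partial>gauss \<partial>gauss)"
    by (rule nn_integral_gauss_gauss[symmetric]) measurable
  finally show ?thesis .
qed

text \<open>A disc of squared radius a has area pi a, so the squared norm pushes plane Lebesgue
  measure forward to pi times Lebesgue measure on the half line. Agreement on the sets
  \<open>{..a}\<close>, where both measures are finite, suffices. This takes the place of polar
  coordinates.\<close>

lemma nn_integral_norm_squared:
  fixes g :: "real \<Rightarrow> ennreal"
  assumes dim: "DIM('a::euclidean_space) = 2" and g[measurable]: "g \<in> borel_measurable borel"
  shows "(\<integral>\<^sup>+z. g ((norm z)\<^sup>2) \<partial>(lborel :: 'a measure)) = ennreal pi * (\<integral>\<^sup>+\<tau>. indicator {0..} \<tau> * g \<tau> \<partial>lborel)"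
proof -
  let ?M = "distr (lborel :: 'a measure) borel (\<lambda>z. (norm z)\<^sup>2)"
  let ?N = "density lborel (\<lambda>\<tau>. ennreal pi * indicator {0..} \<tau>) :: real measure"
  have eqM: "emeasure ?M {..a} = ennreal (if 0 \<le> a then pi * a else 0)" for a :: real
  proof (cases "0 \<le> a")
    case True
    have sq: "norm x \<le> sqrt a \<longleftrightarrow> (norm x)\<^sup>2 \<le> a" for x :: 'a
      by (metis abs_norm_cancel real_sqrt_abs real_sqrt_le_iff)
    have "emeasure ?M {..a} = emeasure (lborel :: 'a measure) (cball 0 (sqrt a))"
      by (subst emeasure_distr) (auto intro!: arg_cong[where f="emeasure _"] simp: True sq)
    also have "\<dots> = ennreal (pi * a)" using emeasure_cball[of "sqrt a" "0::'a"] True dim by (simp add: unit_ball_vol_2)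
    finally show ?thesis using True by simp
  next
    case False
    then have "(\<lambda>z::'a. (norm z)\<^sup>2) -` {..a} = {}" by (auto simp: not_le) (smt (verit) zero_le_power2)
    then show ?thesis using False by (subst emeasure_distr) auto
  qed
  have eqN: "emeasure ?N {..a} = ennreal (if 0 \<le> a then pi * a else 0)" for a :: real
  proof -
    have "emeasure ?N {..a} = (\<integral>\<^sup>+\<tau>. ennreal pi * indicator {0..a} \<tau> \<partial>lborel)"
      by (subst emeasure_density) (auto intro!: nn_integral_cong simp: indicator_def)
    also have "\<dots> = ennreal (if 0 \<le> a then pi * a else 0)"
      by (subst nn_integral_cmult) (auto simp: ennreal_mult')
    finally show ?thesis .
  qed
  have "?M = ?N"
  proof (rule measure_eqI_generator_eq[where E="range atMost" and \<Omega>=UNIV and A="\<lambda>n. {..real n}"])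
    show "Int_stable (range (atMost :: real \<Rightarrow> _))" by (auto simp: Int_stable_def)
    show "sets ?M = sigma_sets UNIV (range atMost)" "sets ?N = sigma_sets UNIV (range atMost)"
      by (simp_all add: borel_eq_atMost)
    show "(\<Union>i. {..real i}) = UNIV" by (auto simp: real_arch_simple)
  qed (auto simp: eqM eqN)
  have "(\<integral>\<^sup>+z. g ((norm z)\<^sup>2) \<partial>(lborel :: 'a measure)) = (\<integral>\<^sup>+\<tau>. g \<tau> \<partial>?M)" by (subst nn_integral_distr) auto
  also have "\<dots> = (\<integral>\<^sup>+\<tau>. ennreal pi * (indicator {0..} \<tau> * g \<tau>) \<partial>lborel)" unfolding \<open>?M = ?N\<close>
    by (subst nn_integral_density) (auto simp: mult.assoc)
  also have "\<dots> = ennreal pi * (\<integral>\<^sup>+\<tau>. indicator {0..} \<tau> * g \<tau> \<partial>lborel)"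
    by (rule nn_integral_cmult) measurable
  finally show ?thesis .
qed

text \<open>The sum of squares of two independent standard normals is exponential with mean
  2.\<close>

lemma nn_integral_gauss_sum_squares:
  fixes G :: "real \<Rightarrow> ennreal"
  assumes g[measurable]: "G \<in> borel_measurable borel"
  shows "(\<integral>\<^sup>+x. \<integral>\<^sup>+y. G (x\<^sup>2 + y\<^sup>2) \<partial>gauss \<partial>gauss) = (\<integral>\<^sup>+\<tau>. indicator {0..} \<tau> * (ennreal (exp (- \<tau> / 2) / 2) * G \<tau>) \<partial>lborel)"
proof -
  let ?g = "\<lambda>\<tau>. ennreal (exp (- \<tau> / 2) / (2 * pi)) * G \<tau>"
  have "(\<integral>\<^sup>+x. \<integral>\<^sup>+y. G (x\<^sup>2 + y\<^sup>2) \<partial>gauss \<partial>gauss) = (\<integral>\<^sup>+x. \<integral>\<^sup>+y. ?g (x\<^sup>2 + y\<^sup>2) \<partial>lborel \<partial>lborel)"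
    by (subst nn_integral_gauss_gauss) auto
  also have "\<dots> = (\<integral>\<^sup>+z. ?g ((norm z)\<^sup>2) \<partial>(lborel :: (real \<times> real) measure))"
    by (subst lborel_prod[symmetric], subst lborel.nn_integral_fst[symmetric]) (auto simp: norm_Pair lborel_prod)
  also have "\<dots> = ennreal pi * (\<integral>\<^sup>+\<tau>. indicator {0..} \<tau> * ?g \<tau> \<partial>lborel)"
    by (rule nn_integral_norm_squared) auto
  also have "\<dots> = (\<integral>\<^sup>+\<tau>. ennreal pi * (indicator {0..} \<tau> * ?g \<tau>) \<partial>lborel)"
    by (rule nn_integral_cmult[symmetric]) measurable
  also have "\<dots> = (\<integral>\<^sup>+\<tau>. indicator {0..} \<tau> * (ennreal (exp (- \<tau> / 2) / 2) * G \<tau>) \<partial>lborel)"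
  proof (rule nn_integral_cong)
    fix \<tau> :: real
    have "ennreal pi * ennreal (exp (- \<tau> / 2) / (2 * pi)) = ennreal (exp (- \<tau> / 2) / 2)"
      by (subst ennreal_mult[symmetric]) auto
    moreover have "ennreal pi * (indicator {0..} \<tau> * ?g \<tau>) = indicator {0..} \<tau> * ((ennreal pi * ennreal (exp (- \<tau> / 2) / (2 * pi))) * G \<tau>)"
      by (simp only: ac_simps)
    ultimately show "ennreal pi * (indicator {0..} \<tau> * ?g \<tau>) = indicator {0..} \<tau> * (ennreal (exp (- \<tau> / 2) / 2) * G \<tau>)"
      by simp
  qed
  finally show ?thesis .
qed

lemma nn_integral_abs_minus_exponential:
  fixes x k :: real
  assumes x: "x \<ge> 0" and k: "k > 0"
  shows "(\<integral>\<^sup>+\<tau>. indicator {0..} \<tau> * (ennreal (exp (- \<tau> / 2) / 2) * ennreal \<bar>x - k * \<tau>\<bar>) \<partial>lborel) =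
    ennreal (x - 2 * k + 4 * k * exp (- x / (2 * k)))"
proof -
  \<comment> \<open>An antiderivative of the integrand without the absolute value. The sign changes
    at x / k, so the integral is F (x / k) - F 0 plus F (x / k); each F (x / k) contributes 2 k
    times the exponential.\<close>
  define F where "F \<tau> = (- x + k * \<tau> + 2 * k) * exp (- \<tau> / 2)" for \<tau>
  define f where "f \<tau> = (x - k * \<tau>) * (exp (- \<tau> / 2) / 2)" for \<tau>
  have der: "DERIV F \<tau> :> f \<tau>" for \<tau>
    unfolding F_def f_def by (auto intro!: derivative_eq_intros simp: field_simps)
  have fm: "f \<in> borel_measurable borel" unfolding f_def[abs_def] by measurable
  have lim: "((\<lambda>\<tau>. - F \<tau>) \<longlongrightarrow> 0) at_top"
    unfolding F_def using k by real_asymp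
  have 1: "(\<integral>\<^sup>+\<tau>. ennreal (f \<tau>) * indicator {0..x / k} \<tau> \<partial>lborel) = ennreal (F (x / k) - F 0)"
  proof (rule nn_integral_FTC_Icc[where F=F and f=f])
    show "0 \<le> f \<tau>" if "\<tau> \<in> {0..x / k}" for \<tau>
      using that k unfolding f_def by (intro mult_nonneg_nonneg) (auto simp: field_simps)
  qed (use x k der fm in auto)
  have 2: "(\<integral>\<^sup>+\<tau>. ennreal (- f \<tau>) * indicator {x / k ..} \<tau> \<partial>lborel) = ennreal (0 - (- F (x / k)))"
  proof (rule nn_integral_FTC_atLeast[where F="\<lambda>\<tau>. - F \<tau>" and f="\<lambda>\<tau>. - f \<tau>"])
    show "0 \<le> - f \<tau>" if "x / k \<le> \<tau>" for \<tau>
      using that k unfolding f_def by (simp add: field_simps)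
  qed (use lim der fm in \<open>auto intro!: DERIV_minus\<close>)
  have Fx: "F (x / k) = 2 * k * exp (- x / (2 * k))" using k by (simp add: F_def mult.commute)
  have "(\<integral>\<^sup>+\<tau>. indicator {0..} \<tau> * (ennreal (exp (- \<tau> / 2) / 2) * ennreal \<bar>x - k * \<tau>\<bar>) \<partial>lborel) =
     (\<integral>\<^sup>+\<tau>. ennreal (f \<tau>) * indicator {0..x / k} \<tau> + ennreal (- f \<tau>) * indicator {x / k ..} \<tau> \<partial>lborel)"
  proof (intro nn_integral_cong)
    fix \<tau> :: real
    have xk: "0 \<le> x / k" using x k by simp
    have *: "ennreal (exp (- \<tau> / 2) / 2) * ennreal \<bar>x - k * \<tau>\<bar> = ennreal \<bar>f \<tau>\<bar>"
      by (subst ennreal_mult[symmetric]) (auto simp: f_def abs_mult)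
    have s1: "f \<tau> \<ge> 0" if "\<tau> \<le> x / k" using that k unfolding f_def by (intro mult_nonneg_nonneg) (auto simp: field_simps)
    have s2: "f \<tau> \<le> 0" if "x / k \<le> \<tau>" using that k unfolding f_def by (intro mult_nonpos_nonneg) (auto simp: field_simps)
    show "indicator {0..} \<tau> * (ennreal (exp (- \<tau> / 2) / 2) * ennreal \<bar>x - k * \<tau>\<bar>) =
        ennreal (f \<tau>) * indicator {0..x / k} \<tau> + ennreal (- f \<tau>) * indicator {x / k ..} \<tau>"
      unfolding * using s1 s2 xk by (cases "\<tau> < 0"; cases "\<tau> \<le> x / k"; cases "\<tau> = x / k") (auto simp: indicator_def abs_if)
  qed
  also have "\<dots> = ennreal (F (x / k) - F 0) + ennreal (F (x / k))"
    by (subst nn_integral_add) (use fm in \<open>auto simp: 1 2\<close>)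
  also have "\<dots> = ennreal (F (x / k) - F 0 + F (x / k))"
  proof (rule ennreal_plus[symmetric])
    have "F 0 \<le> F (x / k)"
    proof (rule DERIV_nonneg_imp_nondecreasing[where f=F and a=0 and b="x / k"])
      show "\<exists>y. DERIV F \<tau> :> y \<and> 0 \<le> y" if "0 \<le> \<tau>" "\<tau> \<le> x / k" for \<tau>
        using that k der unfolding f_def by (intro exI[of _ "f \<tau>"] conjI) (auto simp: f_def field_simps intro!: mult_nonneg_nonneg)
    qed (use x k in simp)
    then show "0 \<le> F (x / k) - F 0" by simp
    show "0 \<le> F (x / k)" using k unfolding Fx by simp
  qed
  also have "F (x / k) - F 0 + F (x / k) = x - 2 * k + 4 * k * exp (- x / (2 * k))"
    unfolding Fx by (simp add: F_def)
  finally show ?thesis .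
qed

lemma gauss_exp_square:
  assumes "\<mu> \<ge> 0"
  shows "integrable gauss (\<lambda>z. exp (- (\<mu> * z\<^sup>2)))" "(\<integral>z. exp (- (\<mu> * z\<^sup>2)) \<partial>gauss) = 1 / sqrt (1 + 2 * \<mu>)"
proof -
  \<comment> \<open>The product of the normal density with the exponential is \<sigma> times the
    centred normal density of standard deviation \<sigma>.\<close>
  define \<sigma> where "\<sigma> = 1 / sqrt (1 + 2 * \<mu>)"
  have \<sigma>: "\<sigma> > 0" using assms by (simp add: \<sigma>_def)
  have s2: "\<sigma>\<^sup>2 = 1 / (1 + 2 * \<mu>)" using assms by (simp add: \<sigma>_def power_divide)
  have eq: "std_normal_density z * exp (- (\<mu> * z\<^sup>2)) = \<sigma> * normal_density 0 \<sigma> z" for z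
  proof -
    have "sqrt (2 * pi * \<sigma>\<^sup>2) = \<sigma> * sqrt (2 * pi)" using \<sigma> by (simp add: real_sqrt_mult)
    moreover have "- z\<^sup>2 / 2 + - (\<mu> * z\<^sup>2) = - (z - 0)\<^sup>2 / (2 * \<sigma>\<^sup>2)" using assms by (simp add: s2 field_simps)
    ultimately show ?thesis using \<sigma>
      by (simp add: std_normal_density_def normal_density_def exp_add[symmetric] del: real_sqrt_mult)
  qed
  have "integrable lborel (\<lambda>z. \<sigma> * normal_density 0 \<sigma> z)" using \<sigma> by simp
  then show "integrable gauss (\<lambda>z. exp (- (\<mu> * z\<^sup>2)))"
    by (subst integrable_density) (auto simp: eq)
  have "(\<integral>z. exp (- (\<mu> * z\<^sup>2)) \<partial>gauss) = (\<integral>z. \<sigma> * normal_density 0 \<sigma> z \<partial>lborel)"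
    by (subst integral_density) (auto simp: eq)
  also have "\<dots> = \<sigma>" using \<sigma> by (simp add: integral_normal_density)
  finally show "(\<integral>z. exp (- (\<mu> * z\<^sup>2)) \<partial>gauss) = 1 / sqrt (1 + 2 * \<mu>)" by (simp add: \<sigma>_def)
qed

text \<open>For fixed z the integral over b and c is the explicit function \<open>H z\<close>. Its
  polynomial part has mean (1 + k) - 2 k, and its exponential part is a moment of
  \<open>gauss_exp_square\<close> with \<mu> = (1 + k) / (2 k).\<close>

lemma expectation_abs_gauss_quadratic:
  fixes k :: real
  assumes k: "k > 0"
  shows "(\<integral>\<^sup>+z. \<integral>\<^sup>+b. \<integral>\<^sup>+c. ennreal \<bar>(1 + k) * z\<^sup>2 - k * (b\<^sup>2 + c\<^sup>2)\<bar> \<partial>gauss \<partial>gauss \<partial>gauss) =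
    ennreal (1 - k + 4 * k * sqrt (k / (1 + 2 * k)))"
proof -
  define H where "H z = (1 + k) * z\<^sup>2 - 2 * k + 4 * k * exp (- ((1 + k) * z\<^sup>2) / (2 * k))" for z :: real
  define \<mu> where "\<mu> = (1 + k) / (2 * k)"
  have \<mu>: "\<mu> \<ge> 0" using k by (simp add: \<mu>_def)
  have Heq: "H z = (1 + k) * z\<^sup>2 - 2 * k + 4 * k * exp (- (\<mu> * z\<^sup>2))" for z unfolding H_def \<mu>_def by simp
  have inner: "(\<integral>\<^sup>+b. \<integral>\<^sup>+c. ennreal \<bar>(1 + k) * z\<^sup>2 - k * (b\<^sup>2 + c\<^sup>2)\<bar> \<partial>gauss \<partial>gauss) = ennreal (H z)" for z
    using k nn_integral_gauss_sum_squares[where G="\<lambda>\<tau>. ennreal \<bar>(1 + k) * z\<^sup>2 - k * \<tau>\<bar>"]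
      nn_integral_abs_minus_exponential[of "(1 + k) * z\<^sup>2" k] by (simp add: H_def)
  \<comment> \<open>Nonnegativity permits the passage to the ordinary integral, in which the terms
    of \<open>H\<close> of both signs are integrated separately. In terms of w, \<open>H z\<close>
    is 2 k (w - 1 + 2 exp (- w)).\<close>
  have Hnn: "H z \<ge> 0" for z
  proof -
    define w where "w = (1 + k) * z\<^sup>2 / (2 * k)"
    have "1 - w \<le> exp (- w)" using exp_ge_add_one_self[of "-w"] by simp
    then have "4 * k * (1 - w) \<le> 4 * k * exp (-w)" using k by simp
    have "0 \<le> w" using k by (simp add: w_def)
    have "w - 1 + 2 * exp (-w) \<ge> 0"
    proof -
      have "exp (-w) > 0" by simp
      then show ?thesis using \<open>1 - w \<le> exp (- w)\<close> by linarith
    qed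
    then have "2 * k * (w - 1 + 2 * exp (-w)) \<ge> 0" using k by simp
    moreover have "2 * k * w = (1 + k) * z\<^sup>2" using k by (simp add: w_def)
    moreover have "- ((1 + k) * z\<^sup>2) / (2 * k) = - w" by (simp add: w_def)
    ultimately show ?thesis unfolding H_def by (simp add: algebra_simps)
  qed
  have i2: "integrable gauss (\<lambda>z::real. z\<^sup>2)" and e2: "(\<integral>z. z\<^sup>2 \<partial>gauss) = 1"
    using std_normal_distribution_even_moments[of 1] by auto
  interpret prob_space gauss by (rule prob_space_gauss)
  have iH: "integrable gauss H" unfolding Heq[abs_def] using i2 gauss_exp_square(1)[OF \<mu>] by auto
  have "(\<integral>z. H z \<partial>gauss) = (1 + k) - 2 * k + 4 * k * (1 / sqrt (1 + 2 * \<mu>))"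
    unfolding Heq using i2 gauss_exp_square[OF \<mu>] using prob_space by (simp add: e2)
  also have "1 / sqrt (1 + 2 * \<mu>) = sqrt (k / (1 + 2 * k))"
  proof -
    have "1 + 2 * \<mu> = (1 + 2 * k) / k" using k by (simp add: \<mu>_def field_simps)
    then show ?thesis by (simp add: real_sqrt_divide)
  qed
  finally have "(\<integral>z. H z \<partial>gauss) = 1 - k + 4 * k * sqrt (k / (1 + 2 * k))" by simp
  then show ?thesis unfolding inner using iH Hnn by (subst nn_integral_eq_integral) auto
qed

text \<open>Rotating (y1, y2) by 45 degrees turns the product into a difference of squares, in which
  b gets the coefficient \<kappa>^2 / 2 = k, the same as c. The remaining combination of a and x is
  normal with variance 1 + k, so a second rotation, of (x, a), makes it a multiple of a single
  coordinate.\<close>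

lemma expectation_abs_hessian_det:
  fixes k \<kappa> :: real
  assumes k: "k > 0" and \<kappa>: "\<kappa>\<^sup>2 = 2 * k"
  shows "(\<integral>\<^sup>+x. \<integral>\<^sup>+y\<^sub>1. \<integral>\<^sup>+y\<^sub>2. \<integral>\<^sup>+c. ennreal \<bar>(\<kappa> * y\<^sub>1 - x) * (\<kappa> * y\<^sub>2 - x) - k * c\<^sup>2\<bar> \<partial>gauss \<partial>gauss \<partial>gauss \<partial>gauss) =
    ennreal (1 - k + 4 * k * sqrt (k / (1 + 2 * k)))"
proof -
  interpret g: prob_space gauss by (rule prob_space_gauss)
  interpret gg: pair_sigma_finite gauss gauss
    by (intro pair_sigma_finite.intro g.sigma_finite_measure)
  define q where "q = 1 / sqrt (2::real)"
  have q2: "q\<^sup>2 = 1/2" by (simp add: q_def power_divide)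
  have ord: "(\<kappa> * (q * a - q * b) - x) * (\<kappa> * (q * a + q * b) - x) - k * c\<^sup>2 = (\<kappa> * q * a - x)\<^sup>2 - k * (b\<^sup>2 + c\<^sup>2)" for a b c x
  proof -
    have "(\<kappa> * (q * a - q * b) - x) * (\<kappa> * (q * a + q * b) - x) - k * c\<^sup>2 = (\<kappa> * q * a - x)\<^sup>2 - \<kappa>\<^sup>2 * q\<^sup>2 * b\<^sup>2 - k * c\<^sup>2"
      by (simp add: power2_eq_square algebra_simps)
    also have "\<dots> = (\<kappa> * q * a - x)\<^sup>2 - k * (b\<^sup>2 + c\<^sup>2)" by (simp add: \<kappa> q2 algebra_simps)
    finally show ?thesis .
  qed
  define m where "m = sqrt (1 + k)"
  have m: "m > 0" "m\<^sup>2 = 1 + k" using k by (auto simp: m_def)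
  have cs: "(-1 / m)\<^sup>2 + (- \<kappa> * q / m)\<^sup>2 = 1"
    using m(1) k by (simp add: power_divide power_mult_distrib \<kappa> q2 m(2) add_divide_distrib[symmetric])
  have mz: "\<kappa> * q * a - x = m * ((-1 / m) * x - (- \<kappa> * q / m) * a)" for a x using m(1) by (simp add: field_simps)
  have "(\<integral>\<^sup>+x. \<integral>\<^sup>+y\<^sub>1. \<integral>\<^sup>+y\<^sub>2. \<integral>\<^sup>+c. ennreal \<bar>(\<kappa> * y\<^sub>1 - x) * (\<kappa> * y\<^sub>2 - x) - k * c\<^sup>2\<bar> \<partial>gauss \<partial>gauss \<partial>gauss \<partial>gauss) =
    (\<integral>\<^sup>+x. \<integral>\<^sup>+a. \<integral>\<^sup>+b. \<integral>\<^sup>+c. ennreal \<bar>(\<kappa> * (q * a - q * b) - x) * (\<kappa> * (q * a + q * b) - x) - k * c\<^sup>2\<bar> \<partial>gauss \<partial>gauss \<partial>gauss \<partial>gauss)"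
    by (intro nn_integral_cong nn_integral_gauss_rotate[symmetric, where g="\<lambda>y\<^sub>1 y\<^sub>2. \<integral>\<^sup>+c. ennreal \<bar>(\<kappa> * y\<^sub>1 - _) * (\<kappa> * y\<^sub>2 - _) - k * c\<^sup>2\<bar> \<partial>gauss"])
      (measurable, simp add: q2)
  also have "\<dots> = (\<integral>\<^sup>+x. \<integral>\<^sup>+a. \<integral>\<^sup>+b. \<integral>\<^sup>+c. ennreal \<bar>(m * ((-1 / m) * x - (- \<kappa> * q / m) * a))\<^sup>2 - k * (b\<^sup>2 + c\<^sup>2)\<bar> \<partial>gauss \<partial>gauss \<partial>gauss \<partial>gauss)"
    unfolding ord mz ..
  also have "\<dots> = (\<integral>\<^sup>+x. \<integral>\<^sup>+a. \<integral>\<^sup>+b. \<integral>\<^sup>+c. ennreal \<bar>(m * x)\<^sup>2 - k * (b\<^sup>2 + c\<^sup>2)\<bar> \<partial>gauss \<partial>gauss \<partial>gauss \<partial>gauss)"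
    by (rule nn_integral_gauss_rotate[OF _ cs, where g="\<lambda>x _. \<integral>\<^sup>+b. \<integral>\<^sup>+c. ennreal \<bar>(m * x)\<^sup>2 - k * (b\<^sup>2 + c\<^sup>2)\<bar> \<partial>gauss \<partial>gauss"]) measurable
  also have "\<dots> = (\<integral>\<^sup>+x. \<integral>\<^sup>+b. \<integral>\<^sup>+c. ennreal \<bar>(m * x)\<^sup>2 - k * (b\<^sup>2 + c\<^sup>2)\<bar> \<partial>gauss \<partial>gauss \<partial>gauss)"
    using g.emeasure_space_1 by simp
  also have "\<dots> = ennreal (1 - k + 4 * k * sqrt (k / (1 + 2 * k)))"
    unfolding power_mult_distrib m(2) by (rule expectation_abs_gauss_quadratic[OF k])
  finally show ?thesis .
qed

text \<open>The integrand is the Jacobian of the central projection of the plane to the unit half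
  sphere, so the value is the area of that half sphere.\<close>

lemma nn_integral_gnomonic:
  "(\<integral>\<^sup>+z. ennreal (1 / sqrt (1 + (norm z)\<^sup>2) ^ 3) \<partial>(lborel :: (real^2) measure)) = ennreal (2 * pi)"
proof -
  have "(\<integral>\<^sup>+z. ennreal (1 / sqrt (1 + (norm z)\<^sup>2) ^ 3) \<partial>(lborel :: (real^2) measure)) =
    ennreal pi * (\<integral>\<^sup>+\<tau>. indicator {0..} \<tau> * ennreal (1 / sqrt (1 + \<tau>) ^ 3) \<partial>lborel)"
    by (rule nn_integral_norm_squared) auto
  also have "(\<integral>\<^sup>+\<tau>. indicator {0..} \<tau> * ennreal (1 / sqrt (1 + \<tau>) ^ 3) \<partial>lborel) =
     (\<integral>\<^sup>+\<tau>. ennreal (1 / sqrt (1 + \<tau>) ^ 3) * indicator {0..} \<tau> \<partial>lborel)" by (simp add: mult.commute)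
  also have "\<dots> = ennreal (0 - (- 2 / sqrt (1 + 0)))"
  proof (rule nn_integral_FTC_atLeast[where F="\<lambda>\<tau>. - 2 / sqrt (1 + \<tau>)"])
    show "((\<lambda>\<tau>::real. - 2 / sqrt (1 + \<tau>)) \<longlongrightarrow> 0) at_top" by real_asymp
    fix \<tau> :: real assume t: "0 \<le> \<tau>"
    have "sqrt (1 + \<tau>) ^ 3 = (1 + \<tau>) * sqrt (1 + \<tau>)" using t by (simp add: power3_eq_cube)
    then show "DERIV (\<lambda>\<tau>. - 2 / sqrt (1 + \<tau>)) \<tau> :> 1 / sqrt (1 + \<tau>) ^ 3"
      using t by (auto intro!: derivative_eq_intros simp: field_simps)
  qed auto
  also have "ennreal pi * ennreal (0 - (- 2 / sqrt (1 + 0))) = ennreal (2 * pi)"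
    by (subst ennreal_mult[symmetric]) auto
  finally show ?thesis .
qed

section \<open>An area formula with multiplicities\<close>

text \<open>The case in which all multiplicities are 0 or 1. Functions are wrapped by
  \<open>vec\<close> into \<open>real^1\<close> to match the vector-valued change of variables
  theorem.\<close>

lemma nn_integral_image_inj:
  fixes h :: "real^'n::{finite,wellorder} \<Rightarrow> real^'n::_" and \<psi> :: "real^'n::_ \<Rightarrow> real"
  assumes S: "S \<in> sets lebesgue"
    and der: "\<And>x. x \<in> S \<Longrightarrow> (h has_derivative h' x) (at x within S)"
    and inj: "inj_on h S"
    and int: "integrable lborel \<psi>" and nonneg: "\<And>x. \<psi> x \<ge> 0"
  shows "(\<integral>\<^sup>+\<xi>. indicator (h ` S) \<xi> * ennreal (\<psi> \<xi>) \<partial>lebesgue) =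
    (\<integral>\<^sup>+x. indicator S x * ennreal (\<bar>det (matrix (h' x))\<bar> * \<psi> (h x)) \<partial>lebesgue)"
proof -
  have hS: "h ` S \<in> sets lebesgue"
    by (rule differentiable_image_in_sets_lebesgue[OF S])
      (auto simp: differentiable_on_def differentiable_def intro!: exI der)
  have "integrable lebesgue \<psi>" using int by (simp add: integrable_completion borel_measurable_integrable)
  then have "set_integrable lebesgue (h ` S) \<psi>"
    unfolding set_integrable_def using integrable_mult_indicator[OF hS] by blast
  then have 1: "(\<lambda>x. vec (\<psi> x) :: real^1) absolutely_integrable_on (h ` S)"
    by (simp add: absolutely_integrable_on_1_iff)
  note cv = has_absolute_integral_change_of_variables[OF S der inj, of "\<lambda>x. vec (\<psi> x) :: real^1" "integral (h ` S) (\<lambda>x. vec (\<psi> x) :: real^1)"]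
  have 2: "(\<lambda>x. \<bar>det (matrix (h' x))\<bar> *\<^sub>R (vec (\<psi> (h x)) :: real^1)) absolutely_integrable_on S"
    and 3: "integral S (\<lambda>x. \<bar>det (matrix (h' x))\<bar> *\<^sub>R (vec (\<psi> (h x)) :: real^1)) = integral (h ` S) (\<lambda>x. vec (\<psi> x) :: real^1)"
    using cv 1 by auto
  have 4: "set_integrable lebesgue S (\<lambda>x. \<bar>det (matrix (h' x))\<bar> * \<psi> (h x))"
    using 2 by (simp add: absolutely_integrable_on_1_iff)
  have i1: "set_integrable lebesgue (h ` S) \<psi>" by fact
  have 5: "integral S (\<lambda>x. \<bar>det (matrix (h' x))\<bar> * \<psi> (h x)) = integral (h ` S) \<psi>"
    using 3 i1 4 by (simp add: integral_on_1_eq set_lebesgue_integral_eq_integral vec_eq_iff)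
  have "(\<integral>\<^sup>+\<xi>. indicator (h ` S) \<xi> * ennreal (\<psi> \<xi>) \<partial>lebesgue) = ennreal (integral (h ` S) \<psi>)"
    using i1 nonneg unfolding set_lebesgue_integral_eq_integral(2)[OF i1, symmetric] set_lebesgue_integral_def set_integrable_def
    by (subst nn_integral_eq_integral[symmetric]) (auto intro!: nn_integral_cong simp: indicator_def)
  moreover have "(\<integral>\<^sup>+x. indicator S x * ennreal (\<bar>det (matrix (h' x))\<bar> * \<psi> (h x)) \<partial>lebesgue) = ennreal (integral S (\<lambda>x. \<bar>det (matrix (h' x))\<bar> * \<psi> (h x)))"
    using 4 nonneg unfolding set_lebesgue_integral_eq_integral(2)[OF 4, symmetric] set_lebesgue_integral_def set_integrable_def
    by (subst nn_integral_eq_integral[symmetric]) (auto intro!: nn_integral_cong simp: indicator_def)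
  ultimately show ?thesis using 5 by simp
qed

text \<open>Where the Jacobian does not vanish, \<open>h\<close> is locally injective, so countably
  many balls of injectivity cover that region; cut into disjoint pieces, they reduce the claim to
  the injective case. The rest of \<open>D\<close> contributes nothing: its image is null by Sard,
  and the Jacobian on the right vanishes there.\<close>

lemma area_formula:
  fixes h :: "real^'n::{finite,wellorder} \<Rightarrow> real^'n::_" and \<psi> :: "real^'n::_ \<Rightarrow> real"
  assumes U: "open U" and DU: "D \<subseteq> U" and D: "D \<in> sets borel"
    and der: "\<And>z. z \<in> U \<Longrightarrow> (h has_derivative h' z) (at z)"
    and cont: "continuous_on U (\<lambda>z. matrix (h' z))"
    and int: "integrable lborel \<psi>" and nonneg: "\<And>x. \<psi> x \<ge> 0"
  shows "(\<integral>\<^sup>+\<xi>. emeasure (count_space UNIV) {z\<in>D. h z = \<xi>} * ennreal (\<psi> \<xi>) \<partial>lebesgue) =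
    (\<integral>\<^sup>+z. indicator D z * ennreal (\<bar>det (matrix (h' z))\<bar> * \<psi> (h z)) \<partial>lebesgue)"
proof -
  define R where "R = {z\<in>U. det (matrix (h' z)) \<noteq> 0}"
  have contdet: "continuous_on U (\<lambda>z. det (matrix (h' z)))"
    unfolding det_def by (intro continuous_intros cont)
  have oR: "open R"
  proof -
    have "open (U \<inter> (\<lambda>z. det (matrix (h' z))) -` (- {0}))"
      by (rule continuous_open_preimage[OF contdet U]) auto
    moreover have "U \<inter> (\<lambda>z. det (matrix (h' z))) -` (- {0}) = R" by (auto simp: R_def)
    ultimately show ?thesis by simp
  qed
  have \<psi>m: "\<psi> \<in> borel_measurable borel" using borel_measurable_integrable[OF int] by simp
  have bl: "bounded_linear (h' z)" if "z \<in> U" for z using der[OF that] by (rule has_derivative_bounded_linear)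
  define FF where "FF = {B. \<exists>a r. a \<in> R \<and> r > 0 \<and> B = ball a r \<and> B \<subseteq> R \<and> inj_on h B}"
  have "\<exists>r>0. ball a r \<subseteq> R \<and> inj_on h (ball a r)" if a: "a \<in> R" for a
  proof -
    have aU: "a \<in> U" "det (matrix (h' a)) \<noteq> 0" using a by (auto simp: R_def)
    then have "invertible (matrix (h' a))" by (simp add: invertible_det_nz)
    then obtain B where B: "B ** matrix (h' a) = mat 1" by (auto simp: invertible_def)
    have lin: "linear (h' a)" using bl[OF aU(1)] by (rule bounded_linear.linear)
    have comp: "((*v) B) \<circ> h' a = id"
    proof
      fix x
      have "h' a x = matrix (h' a) *v x" using matrix_works[of "h' a"] lin by (simp add: linear_matrix_vector_mul_eq)
      then show "((*v) B \<circ> h' a) x = id x" by (simp add: matrix_vector_mul_assoc B)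
    qed
    obtain r where "r > 0" "ball a r \<subseteq> R" "inj_on h (ball a r)"
    proof (rule has_derivative_locally_injective[where f=h and f'=h' and a=a and S=R and g'="(*v) B"])
      show "a \<in> R" "open R" "(*v) B \<circ> h' a = id" by (fact a oR comp)+
      show "bounded_linear ((*v) B)" by (simp add: matrix_vector_mul_bounded_linear)
      show "(h has_derivative h' x) (at x)" if "x \<in> R" for x using that der by (auto simp: R_def)
      fix e :: real assume e: "e > 0"
      \<comment> \<open>The operator norm is at most the number of entries times the largest entry,
        so continuity of the matrix yields the continuity in operator norm that local injectivity
        requires.\<close>
      let ?N = "real CARD('n) * real CARD('n)"
      have N: "?N > 0" by simp
      have "continuous (at a) (\<lambda>z. matrix (h' z))" using cont U aU(1) by (simp add: continuous_on_eq_continuous_at)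
      then obtain d where d: "d > 0" "\<And>x. dist x a < d \<Longrightarrow> dist (matrix (h' x)) (matrix (h' a)) < e / (2 * ?N)"
        unfolding continuous_at_eps_delta using e N by (metis divide_pos_pos mult_pos_pos zero_less_numeral dist_commute)
      obtain d' where d': "d' > 0" "ball a d' \<subseteq> U" using U aU(1) by (auto simp: open_contains_ball)
      have "onorm (\<lambda>v. h' x v - h' a v) < e" if x: "dist a x < min d d'" for x
      proof -
        have xU: "x \<in> U" using x d' by auto
        have 1: "(\<lambda>v. h' x v - h' a v) = (*v) (matrix (h' x) - matrix (h' a))"
          by (simp add: fun_eq_iff matrix_vector_mult_diff_rdistrib matrix_works lin bl[OF xU, THEN bounded_linear.linear] linear_matrix_vector_mul_eq)
        have "\<bar>(matrix (h' x) - matrix (h' a)) $ i $ j\<bar> \<le> e / (2 * ?N)" for i j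
        proof -
          have "\<bar>(matrix (h' x) - matrix (h' a)) $ i $ j\<bar> \<le> norm (matrix (h' x) - matrix (h' a))"
            by (rule order_trans[OF _ Finite_Cartesian_Product.norm_nth_le[of _ i]]) (use Finite_Cartesian_Product.norm_nth_le[of "(matrix (h' x) - matrix (h' a)) $ i" j] in simp)
          also have "\<dots> \<le> e / (2 * ?N)" using d(2)[of x] x by (simp add: dist_norm norm_minus_commute)
          finally show ?thesis .
        qed
        then have "onorm ((*v) (matrix (h' x) - matrix (h' a))) \<le> ?N * (e / (2 * ?N))"
          by (intro onorm_le_matrix_component) auto
        also have "\<dots> < e" using e by simp
        finally show ?thesis unfolding 1 .
      qed
      then show "\<exists>d>0. \<forall>x. dist a x < d \<longrightarrow> onorm (\<lambda>v. h' x v - h' a v) < e"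
        using d(1) d'(1) by (intro exI[of _ "min d d'"]) auto
    qed
    then show ?thesis by auto
  qed
  then have UF: "\<Union>FF = R" unfolding FF_def by (auto, metis centre_in_ball)
  have "\<And>S. S \<in> FF \<Longrightarrow> open S" by (auto simp: FF_def)
  then obtain FF' where F': "FF' \<subseteq> FF" "countable FF'" "\<Union>FF' = R" using Lindelof UF by metis
  \<comment> \<open>The empty set is inserted so that an enumeration exists even if the subcover is
    empty.\<close>
  define B where "B = from_nat_into (insert {} FF')"
  have rB: "range B = insert {} FF'" unfolding B_def using F'(2) by (intro range_from_nat_into) auto
  have B_cases: "B n = {} \<or> B n \<in> FF" for n using rB F'(1) by (metis Set.insertE rangeI subsetD)
  have Bopen: "open (B n)" for n using B_cases[of n] by (auto simp: FF_def)
  have Binj: "inj_on h (B n)" for n using B_cases[of n] by (auto simp: FF_def)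
  have BR: "B n \<subseteq> R" for n using B_cases[of n] by (auto simp: FF_def)
  have UB: "\<Union>(range B) = R" using rB F'(3) by auto
  \<comment> \<open>A fibre of \<open>h\<close> meets each of these disjoint pieces at most once, so
    its cardinality is the sum of the indicators of their images.\<close>
  define E where "E n = D \<inter> disjointed B n" for n
  have Eborel: "E n \<in> sets borel" for n
  proof -
    have "range B \<subseteq> sets borel" using Bopen by auto
    then have "range (disjointed B) \<subseteq> sets borel" by (rule sets.range_disjointed_sets)
    then have "disjointed B n \<in> sets borel" by (simp add: image_subset_iff)
    then show ?thesis using D unfolding E_def by (rule sets.Int[rotated])
  qed
  have EB: "E n \<subseteq> B n" for n unfolding E_def using disjointed_subset[of B n] by auto
  have Edisj: "disjoint_family E" unfolding E_def using disjoint_family_disjointed[of B]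
    by (auto simp: disjoint_family_on_def)
  have UE: "(\<Union>n. E n) = D \<inter> R" unfolding E_def using UN_disjointed_eq[of B] UB by auto
  have Einj: "inj_on h (E n)" for n using Binj EB inj_on_subset by blast
  have EU: "E n \<subseteq> U" for n using EB BR by (auto simp: R_def)
  have cnt: "emeasure (count_space UNIV) {z\<in>D \<inter> R. h z = \<xi>} = suminf (\<lambda>n. indicator (h ` E n) \<xi>)" for \<xi>
  proof -
    have "emeasure (count_space UNIV) {z\<in>D \<inter> R. h z = \<xi>} = emeasure (count_space UNIV) (\<Union>n. {z\<in>E n. h z = \<xi>})"
      by (rule arg_cong[where f="emeasure _"]) (use UE in auto)
    also have "\<dots> = suminf (\<lambda>n. emeasure (count_space UNIV) {z\<in>E n. h z = \<xi>})"
      by (rule suminf_emeasure[symmetric]) (use Edisj in \<open>auto simp: disjoint_family_on_def\<close>)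
    also have "\<dots> = suminf (\<lambda>n. indicator (h ` E n) \<xi>)"
    proof (rule suminf_cong)
     fix n
     show "emeasure (count_space UNIV) {z\<in>E n. h z = \<xi>} = indicator (h ` E n) \<xi>"
     proof (cases "\<xi> \<in> h ` E n")
      case True
      then obtain z where "z \<in> E n" "h z = \<xi>" by auto
      then have "{z\<in>E n. h z = \<xi>} = {z}" using Einj[of n] by (auto simp: inj_on_def)
      then show ?thesis using True by simp
    next
      case False
      then have "{z\<in>E n. h z = \<xi>} = {}" by auto
      then show ?thesis using False by (simp only:) simp
     qed
    qed
    finally show ?thesis .
  qed
  have neg: "negligible (h ` (D - R))"
  proof (rule baby_Sard)
    show "(h has_derivative h' x) (at x within D - R)" if "x \<in> D - R" for x
      using that DU der by (auto intro: has_derivative_at_withinI)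
    show "rank (matrix (h' x)) < CARD('n)" if "x \<in> D - R" for x
      using that DU by (auto simp: R_def det_eq_0_rank)
  qed simp
  then have "AE \<xi> in lebesgue. \<xi> \<notin> h ` (D - R)"
    by (simp add: negligible_iff_null_sets AE_not_in)
  then have "(\<integral>\<^sup>+\<xi>. emeasure (count_space UNIV) {z\<in>D. h z = \<xi>} * ennreal (\<psi> \<xi>) \<partial>lebesgue)
      = (\<integral>\<^sup>+\<xi>. suminf (\<lambda>n. indicator (h ` E n) \<xi>) * ennreal (\<psi> \<xi>) \<partial>lebesgue)"
  proof (intro nn_integral_cong_AE, eventually_elim)
    case (elim \<xi>)
    then have "{z\<in>D. h z = \<xi>} = {z\<in>D \<inter> R. h z = \<xi>}" by auto
    then show ?case by (simp only: cnt)
  qed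
  also have "\<dots> = (\<integral>\<^sup>+\<xi>. suminf (\<lambda>n. indicator (h ` E n) \<xi> * ennreal (\<psi> \<xi>)) \<partial>lebesgue)" by simp
  also have "\<dots> = suminf (\<lambda>n. \<integral>\<^sup>+\<xi>. indicator (h ` E n) \<xi> * ennreal (\<psi> \<xi>) \<partial>lebesgue)"
  proof (rule nn_integral_suminf)
    fix n
    have "h ` E n \<in> sets lebesgue"
      using Eborel[of n] EU[of n] by (intro differentiable_image_in_sets_lebesgue)
        (auto simp: differentiable_on_def differentiable_def intro!: exI has_derivative_at_withinI[OF der])
    moreover have "\<psi> \<in> borel_measurable lebesgue" using int by (intro measurable_completion) auto
    ultimately show "(\<lambda>\<xi>. indicator (h ` E n) \<xi> * ennreal (\<psi> \<xi>)) \<in> borel_measurable lebesgue"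
      by measurable
  qed
  also have "\<dots> = suminf (\<lambda>n. \<integral>\<^sup>+x. indicator (E n) x * ennreal (\<bar>det (matrix (h' x))\<bar> * \<psi> (h x)) \<partial>lebesgue)"
    by (intro suminf_cong nn_integral_image_inj int nonneg Einj)
      (use EU Eborel in \<open>auto intro!: has_derivative_at_withinI[OF der]\<close>)
  also have "\<dots> = (\<integral>\<^sup>+x. suminf (\<lambda>n. indicator (E n) x * ennreal (\<bar>det (matrix (h' x))\<bar> * \<psi> (h x))) \<partial>lebesgue)"
  proof (rule nn_integral_suminf[symmetric])
    fix n
    have "h \<in> borel_measurable (restrict_space borel U)"
      using der by (intro borel_measurable_continuous_on_restrict) (auto intro!: continuous_at_imp_continuous_on has_derivative_continuous)
    then have "(\<lambda>z. \<psi> (h z)) \<in> borel_measurable (restrict_space borel U)"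
      using \<psi>m by (rule measurable_compose)
    moreover have "(\<lambda>z. det (matrix (h' z))) \<in> borel_measurable (restrict_space borel U)"
      using contdet by (rule borel_measurable_continuous_on_restrict)
    ultimately have "(\<lambda>z. ennreal (\<bar>det (matrix (h' z))\<bar> * \<psi> (h z))) \<in> borel_measurable (restrict_space borel U)"
      by measurable
    then have "(\<lambda>z. ennreal (\<bar>det (matrix (h' z))\<bar> * \<psi> (h z)) * indicator U z) \<in> borel_measurable borel"
      using U by (subst (asm) borel_measurable_restrict_space_iff_ennreal) auto
    then have "(\<lambda>z. indicator (E n) z * (ennreal (\<bar>det (matrix (h' z))\<bar> * \<psi> (h z)) * indicator U z)) \<in> borel_measurable lborel"
      using Eborel by measurable
    also have "(\<lambda>z. indicator (E n) z * (ennreal (\<bar>det (matrix (h' z))\<bar> * \<psi> (h z)) * indicator U z)) =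
      (\<lambda>x. indicator (E n) x * ennreal (\<bar>det (matrix (h' x))\<bar> * \<psi> (h x)))"
      using EU[of n] by (auto simp: indicator_def fun_eq_iff)
    finally show "(\<lambda>x. indicator (E n) x * ennreal (\<bar>det (matrix (h' x))\<bar> * \<psi> (h x))) \<in> borel_measurable lebesgue"
      by (rule measurable_completion)
  qed
  also have "\<dots> = (\<integral>\<^sup>+z. indicator D z * ennreal (\<bar>det (matrix (h' z))\<bar> * \<psi> (h z)) \<partial>lebesgue)"
  proof (rule nn_integral_cong)
    fix x
    have "suminf (\<lambda>n. indicator (E n) x) = (indicator (D \<inter> R) x :: ennreal)"
      using suminf_indicator[OF Edisj, of x] UE by simp
    then have "suminf (\<lambda>n. indicator (E n) x * ennreal (\<bar>det (matrix (h' x))\<bar> * \<psi> (h x))) = indicator (D \<inter> R) x * ennreal (\<bar>det (matrix (h' x))\<bar> * \<psi> (h x))"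
      by simp
    also have "\<dots> = indicator D x * ennreal (\<bar>det (matrix (h' x))\<bar> * \<psi> (h x))"
      using DU by (auto simp: indicator_def R_def)
    finally show "suminf (\<lambda>n. indicator (E n) x * ennreal (\<bar>det (matrix (h' x))\<bar> * \<psi> (h x))) = \<dots>" .
  qed
  finally show ?thesis .
qed

section \<open>The Bombieri inner product\<close>

lemma lookup_single_mult:
  "Poly_Mapping.lookup (Poly_Mapping.single s c * f) k = c * Sum_any (\<lambda>q. Poly_Mapping.lookup f q when k = s + q)"
  by (simp add: lookup_mult lookup_single when_mult)

lemma scaleR_eq_single_mult: "c *\<^sub>R f = Poly_Mapping.single 0 c * (f :: real_poly3)"
  by (rule poly_mapping_eqI) (simp add: lookup_single_mult lookup_scaleR)

lemma poly_scaleR_mult_left: "(c *\<^sub>R f) * g = c *\<^sub>R (f * g :: real_poly3)"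
  by (simp add: scaleR_eq_single_mult mult.assoc)

lemma poly_scaleR_mult_right: "f * (c *\<^sub>R g) = c *\<^sub>R (f * g :: real_poly3)"
  by (simp add: scaleR_eq_single_mult mult.left_commute)

lemma poly_scaleR_power: "(c *\<^sub>R f) ^ k = c ^ k *\<^sub>R (f ^ k :: real_poly3)"
  by (induction k) (simp_all add: poly_scaleR_mult_left poly_scaleR_mult_right mult.commute)

abbreviation unit_exp :: "3 \<Rightarrow> (3 \<Rightarrow>\<^sub>0 nat)" where
  "unit_exp i \<equiv> Poly_Mapping.single i 1"

lemma lookup_basis_vec_mult:
  "Poly_Mapping.lookup (basis_vec j * f) \<alpha> =
    (if Poly_Mapping.lookup \<alpha> j > 0 then Poly_Mapping.lookup f (\<alpha> - unit_exp j) else 0)"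
proof -
  have eq: "\<alpha> = unit_exp j + q \<longleftrightarrow> Poly_Mapping.lookup \<alpha> j > 0 \<and> q = \<alpha> - unit_exp j" for q
  proof
    assume "Poly_Mapping.lookup \<alpha> j > 0 \<and> q = \<alpha> - unit_exp j"
    then show "\<alpha> = unit_exp j + q"
      by (intro poly_mapping_eqI) (auto simp: lookup_add lookup_minus lookup_single when_def)
  qed (auto simp: lookup_add)
  show ?thesis unfolding basis_vec_def lookup_single_mult eq
    by (cases "Poly_Mapping.lookup \<alpha> j > 0") simp_all
qed

section \<open>Formal differentiation of polynomials\<close>

lift_definition poly_deriv :: "3 \<Rightarrow> real_poly3 \<Rightarrow> real_poly3" is
  "\<lambda>i f \<alpha>. real (Poly_Mapping.lookup \<alpha> i + 1) * f (\<alpha> + Poly_Mapping.single i 1)"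
proof -
  fix i and f :: "(3 \<Rightarrow>\<^sub>0 nat) \<Rightarrow> real"
  assume fin: "finite {k. f k \<noteq> 0}"
  have "finite ((\<lambda>\<alpha>. \<alpha> + unit_exp i) -` {k. f k \<noteq> 0})"
    using fin by (rule finite_vimageI) (auto simp: inj_on_def)
  then show "finite {\<alpha>. real (Poly_Mapping.lookup \<alpha> i + 1) * f (\<alpha> + unit_exp i) \<noteq> 0}"
    by (rule finite_subset[rotated]) auto
qed

lemma lookup_poly_deriv:
  "Poly_Mapping.lookup (poly_deriv i f) \<alpha> =
    real (Poly_Mapping.lookup \<alpha> i + 1) * Poly_Mapping.lookup f (\<alpha> + unit_exp i)"
  by (simp add: poly_deriv.rep_eq)

lemma poly_deriv_basis_vec_mult:
  "poly_deriv i (basis_vec j * f) = (if i = j then f else 0) + basis_vec j * poly_deriv i f"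
proof (rule poly_mapping_eqI)
  fix \<alpha>
  show "Poly_Mapping.lookup (poly_deriv i (basis_vec j * f)) \<alpha> =
    Poly_Mapping.lookup ((if i = j then f else 0) + basis_vec j * poly_deriv i f) \<alpha>"
  proof (cases "i = j")
    case True
    show ?thesis
    proof (cases "Poly_Mapping.lookup \<alpha> j > 0")
      case gt: True
      then have "\<alpha> - unit_exp j + unit_exp j = \<alpha>"
        by (intro poly_mapping_eqI) (auto simp: lookup_add lookup_minus lookup_single when_def)
      then show ?thesis using True gt
        by (simp add: lookup_poly_deriv lookup_basis_vec_mult lookup_add lookup_minus distrib_right)
    next
      case False
      then show ?thesis using True
        by (simp add: lookup_poly_deriv lookup_basis_vec_mult lookup_add)
    qed
  next
    case False
    show ?thesis
    proof (cases "Poly_Mapping.lookup \<alpha> j > 0")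
      case gt: True
      then have "\<alpha> + unit_exp i - unit_exp j = \<alpha> - unit_exp j + unit_exp i"
        by (intro poly_mapping_eqI) (auto simp: lookup_add lookup_minus lookup_single when_def)
      then show ?thesis using False gt
        by (simp add: lookup_poly_deriv lookup_basis_vec_mult lookup_add lookup_minus lookup_single)
    next
      case nz: False
      then show ?thesis using False
        by (simp add: lookup_poly_deriv lookup_basis_vec_mult lookup_add lookup_single)
    qed
  qed
qed

lemma poly_deriv_add: "poly_deriv i (f + g) = poly_deriv i f + poly_deriv i g"
  by (rule poly_mapping_eqI) (simp add: lookup_poly_deriv lookup_add algebra_simps)

lemma poly_deriv_scaleR: "poly_deriv i (c *\<^sub>R f) = c *\<^sub>R poly_deriv i f"
  by (rule poly_mapping_eqI) (simp add: lookup_poly_deriv lookup_scaleR)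

lemma poly_deriv_one: "poly_deriv i 1 = 0"
  by (rule poly_mapping_eqI) (auto simp: lookup_poly_deriv lookup_one when_def poly_mapping_eq_iff lookup_add fun_eq_iff intro!: exI[of _ i])

definition dir_deriv :: "real ^ 3 \<Rightarrow> real_poly3 \<Rightarrow> real_poly3" where
  "dir_deriv a f = (\<Sum>i\<in>UNIV. a $ i *\<^sub>R poly_deriv i f)"

lemma dir_deriv_linear_form_mult:
  "dir_deriv a (linear_form b * f) = (a \<bullet> b) *\<^sub>R f + linear_form b * dir_deriv a f"
proof -
  have comm: "poly_deriv i (f * basis_vec j) = (if i = j then f else 0) + basis_vec j * poly_deriv i f" for i j f
    using poly_deriv_basis_vec_mult by (simp add: mult.commute)
  show ?thesis
    by (simp add: dir_deriv_def linear_form_def sum_3 inner_vec_def poly_deriv_add poly_deriv_scaleR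
      poly_scaleR_mult_left poly_scaleR_mult_right poly_deriv_basis_vec_mult comm algebra_simps)
qed

text \<open>The cofactor \<open>f\<close> is kept general so that \<open>f = 1\<close> and a linear
  form \<open>f\<close> give the two derivatives used below.\<close>

lemma dir_deriv_linear_form_power_mult:
  "dir_deriv a (linear_form b ^ Suc k * f) =
    (real (Suc k) * (a \<bullet> b)) *\<^sub>R (linear_form b ^ k * f) + linear_form b ^ Suc k * dir_deriv a f"
proof (induction k)
  case 0
  then show ?case by (simp add: dir_deriv_linear_form_mult)
next
  case (Suc k)
  have "linear_form b ^ Suc (Suc k) * f = linear_form b * (linear_form b ^ Suc k * f)" by (simp add: ac_simps)
  moreover have "linear_form b * (linear_form b ^ k * f) = linear_form b ^ Suc k * f"
    "linear_form b * (linear_form b ^ Suc k * dir_deriv a f) = linear_form b ^ Suc (Suc k) * dir_deriv a f"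
    by (simp_all add: mult.assoc)
  moreover have "c *\<^sub>R X + ((real (Suc k) * c) *\<^sub>R X + Y) = (real (Suc (Suc k)) * c) *\<^sub>R X + Y" for c and X Y :: real_poly3
  proof -
    have "real (Suc (Suc k)) * c = c + real (Suc k) * c" by (simp add: distrib_right)
    then show ?thesis by (simp only: scaleR_left_distrib add.assoc)
  qed
  ultimately show ?case
    by (simp only: dir_deriv_linear_form_mult Suc.IH distrib_left poly_scaleR_mult_right)
qed

lemma dir_deriv_one: "dir_deriv a 1 = 0"
  by (simp add: dir_deriv_def poly_deriv_one)

lemma linear_form_add: "linear_form (a + b) = linear_form a + linear_form b"
  by (simp add: linear_form_def scaleR_add_left sum.distrib)

lemma linear_form_scaleR: "linear_form (c *\<^sub>R a) = c *\<^sub>R linear_form a"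
  by (simp add: linear_form_def scaleR_sum_right)

section \<open>Bilinearity and definiteness of the inner product\<close>

lemma bombieri_commute: "bombieri p f g = bombieri p g f"
  unfolding bombieri_def by (intro sum.cong) auto

lemma bombieri_add_left: "bombieri p (f + g) h = bombieri p f h + bombieri p g h"
  unfolding bombieri_def by (simp add: lookup_add algebra_simps sum.distrib add_divide_distrib)

lemma bombieri_add_right: "bombieri p h (f + g) = bombieri p h f + bombieri p h g"
  by (metis bombieri_add_left bombieri_commute)

lemma bombieri_scaleR_left: "bombieri p (c *\<^sub>R f) h = c * bombieri p f h"
  unfolding bombieri_def by (simp add: lookup_scaleR sum_distrib_left algebra_simps)

lemma bombieri_scaleR_right: "bombieri p h (c *\<^sub>R f) = c * bombieri p h f"
  by (metis bombieri_scaleR_left bombieri_commute)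

lemma bombieri_zero_left [simp]: "bombieri p 0 h = 0"
  unfolding bombieri_def by simp

lemma bombieri_zero_right [simp]: "bombieri p h 0 = 0"
  unfolding bombieri_def by simp

lemma bombieri_minus_left: "bombieri p (- f) h = - bombieri p f h"
  using bombieri_scaleR_left[of p "-1" f h] by simp

lemma bombieri_minus_right: "bombieri p h (- f) = - bombieri p h f"
  using bombieri_scaleR_right[of p h "-1" f] by simp

lemma bombieri_diff_left: "bombieri p (f - g) h = bombieri p f h - bombieri p g h"
  using bombieri_add_left[of p f "- g" h] by (simp add: bombieri_minus_left)

lemma bombieri_diff_right: "bombieri p h (f - g) = bombieri p h f - bombieri p h g"
  using bombieri_add_right[of p h f "- g"] by (simp add: bombieri_minus_right)

lemma bombieri_sum_left: "bombieri p (sum f I) h = (\<Sum>i\<in>I. bombieri p (f i) h)"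
  by (induction I rule: infinite_finite_induct) (auto simp: bombieri_add_left)

lemma bombieri_sum_right: "bombieri p h (sum f I) = (\<Sum>i\<in>I. bombieri p h (f i))"
  by (induction I rule: infinite_finite_induct) (auto simp: bombieri_add_right)

lemmas bombieri_linear = bombieri_add_left bombieri_add_right bombieri_scaleR_left bombieri_scaleR_right
  bombieri_diff_left bombieri_diff_right bombieri_minus_left bombieri_minus_right

lemma bombieri_weight_pos: "(\<Prod>i\<in>UNIV. fact (Poly_Mapping.lookup \<alpha> (i::3))) / fact p > (0::real)"
  by (intro divide_pos_pos prod_pos) auto

lemma bombieri_nonneg: "bombieri p f f \<ge> 0"
  unfolding bombieri_def using bombieri_weight_pos
  by (intro sum_nonneg) (metis mult.assoc mult_nonneg_nonneg less_imp_le zero_le_square)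

lemma bombieri_eq_0_imp:
  assumes "f \<in> sym_power p" "bombieri p f f = 0"
  shows "f = 0"
proof (rule poly_mapping_eqI)
  fix \<alpha>
  have nn: "(\<Prod>i\<in>UNIV. fact (Poly_Mapping.lookup \<beta> i)) / fact p * Poly_Mapping.lookup f \<beta> * Poly_Mapping.lookup f \<beta> \<ge> 0" for \<beta>
    using bombieri_weight_pos by (metis mult.assoc mult_nonneg_nonneg less_imp_le zero_le_square)
  show "Poly_Mapping.lookup f \<alpha> = Poly_Mapping.lookup 0 \<alpha>"
  proof (cases "\<alpha> \<in> exponents p")
    case True
    then have "(\<Prod>i\<in>UNIV. fact (Poly_Mapping.lookup \<alpha> i)) / fact p * Poly_Mapping.lookup f \<alpha> * Poly_Mapping.lookup f \<alpha> = 0"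
      using assms(2) nn sum_nonneg_eq_0_iff[OF finite_exponents, of p "\<lambda>\<beta>. (\<Prod>i\<in>UNIV. fact (Poly_Mapping.lookup \<beta> i)) / fact p * Poly_Mapping.lookup f \<beta> * Poly_Mapping.lookup f \<beta>"]
      unfolding bombieri_def by blast
    then show ?thesis using bombieri_weight_pos[of \<alpha> p] by auto
  next
    case False
    then show ?thesis using assms(1) by (auto simp: sym_power_def in_keys_iff)
  qed
qed

text \<open>Raising the i-th exponent by one multiplies the weight \<alpha>! by the very factor that
  differentiation brings down, and the change from m! to (m + 1)! leaves the denominator. Exponents
  with i-th entry 0 do not occur in the product, so the sum can be reindexed.\<close>

lemma bombieri_basis_vec_mult:
  "bombieri (Suc m) (basis_vec i * f) g = bombieri m f (poly_deriv i g) / real (Suc m)"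
proof -
  let ?w = "\<lambda>\<alpha>. (\<Prod>i\<in>UNIV. fact (Poly_Mapping.lookup \<alpha> (i::3))) :: real"
  have w: "?w (\<beta> + unit_exp i) = real (Poly_Mapping.lookup \<beta> i + 1) * ?w \<beta>" for \<beta>
  proof -
    have "?w (\<beta> + unit_exp i) = fact (Poly_Mapping.lookup \<beta> i + 1) * (\<Prod>j\<in>UNIV - {i}. fact (Poly_Mapping.lookup \<beta> j))"
      by (subst prod.remove[of _ i]) (auto simp: lookup_add lookup_single when_def intro!: prod.cong)
    also have "\<dots> = real (Poly_Mapping.lookup \<beta> i + 1) * ?w \<beta>"
      by (subst prod.remove[of UNIV i]) (auto simp: algebra_simps)
    finally show ?thesis .
  qed
  let ?E = "{\<alpha> \<in> exponents (Suc m). Poly_Mapping.lookup \<alpha> i > 0}"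
  have bij: "bij_betw (\<lambda>\<beta>. \<beta> + unit_exp i) (exponents m) ?E"
  proof (rule bij_betw_imageI)
    show "inj_on (\<lambda>\<beta>. \<beta> + unit_exp i) (exponents m)" by (auto simp: inj_on_def)
    show "(\<lambda>\<beta>. \<beta> + unit_exp i) ` exponents m = ?E"
    proof (intro equalityI subsetI)
      fix \<alpha> assume "\<alpha> \<in> (\<lambda>\<beta>. \<beta> + unit_exp i) ` exponents m"
      then show "\<alpha> \<in> ?E" by (auto simp: exponents_def lookup_add lookup_single sum.distrib when_def)
    next
      fix \<alpha> assume a: "\<alpha> \<in> ?E"
      then have eq: "\<alpha> = (\<alpha> - unit_exp i) + unit_exp i"
        by (intro poly_mapping_eqI) (auto simp: lookup_add lookup_minus lookup_single when_def)
      have "(\<Sum>j\<in>UNIV. Poly_Mapping.lookup ((\<alpha> - unit_exp i) + unit_exp i) j) = Suc m"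
        using a unfolding eq[symmetric] by (simp add: exponents_def)
      then have "\<alpha> - unit_exp i \<in> exponents m"
        by (simp add: exponents_def lookup_add lookup_single sum.distrib when_def del: add_diff_cancel_right')
      then show "\<alpha> \<in> (\<lambda>\<beta>. \<beta> + unit_exp i) ` exponents m" using eq by blast
    qed
  qed
  have "bombieri (Suc m) (basis_vec i * f) g =
    (\<Sum>\<alpha>\<in>?E. ?w \<alpha> / fact (Suc m) * Poly_Mapping.lookup f (\<alpha> - unit_exp i) * Poly_Mapping.lookup g \<alpha>)"
    unfolding bombieri_def
    by (rule sum.mono_neutral_cong_right) (auto simp: finite_exponents lookup_basis_vec_mult)
  also have "\<dots> = (\<Sum>\<beta>\<in>exponents m. ?w (\<beta> + unit_exp i) / fact (Suc m) * Poly_Mapping.lookup f \<beta> * Poly_Mapping.lookup g (\<beta> + unit_exp i))"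
    by (subst sum.reindex_bij_betw[OF bij, symmetric]) simp
  also have "\<dots> = bombieri m f (poly_deriv i g) / real (Suc m)"
    unfolding bombieri_def sum_divide_distrib w lookup_poly_deriv
    by (intro sum.cong refl) (simp add: field_simps)
  finally show ?thesis .
qed

text \<open>Up to the factor \<open>1 / p\<close>, multiplication by a linear form is adjoint to differentiation;
  this evaluates all inner products of products of linear forms.\<close>

lemma bombieri_linear_form_mult:
  "bombieri (Suc m) (linear_form a * f) g = bombieri m f (dir_deriv a g) / real (Suc m)"
  by (simp add: linear_form_def dir_deriv_def sum_distrib_right bombieri_sum_left bombieri_sum_right
      poly_scaleR_mult_left bombieri_scaleR_left bombieri_scaleR_right bombieri_basis_vec_mult sum_divide_distrib)

section \<open>Inner products of products of linear forms\<close>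

lemma exponents_0: "exponents 0 = {0}"
  by (auto simp: exponents_def intro!: poly_mapping_eqI)

lemma bombieri_0_one: "bombieri 0 1 1 = 1"
  by (simp add: bombieri_def exponents_0)

text \<open>Adjointness strips one factor from each side; the exponent brought down by the
  derivative cancels the denominator, and \<open>a \<bullet> b\<close> remains.\<close>

lemma bombieri_powers: "bombieri p (linear_form a ^ p) (linear_form b ^ p) = (a \<bullet> b) ^ p"
proof (induction p)
  case 0
  then show ?case by (simp add: bombieri_0_one)
next
  case (Suc p)
  have "dir_deriv a (linear_form b ^ Suc p) = (real (Suc p) * (a \<bullet> b)) *\<^sub>R linear_form b ^ p"
    using dir_deriv_linear_form_power_mult[of a b p 1] by (simp add: dir_deriv_one)
  then show ?case using bombieri_linear_form_mult[of p a "linear_form a ^ p" "linear_form b ^ Suc p"]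
    by (simp add: bombieri_scaleR_right Suc.IH)
qed

lemma dir_deriv_power:
  "dir_deriv a (linear_form b ^ Suc k) = (real (Suc k) * (a \<bullet> b)) *\<^sub>R linear_form b ^ k"
  using dir_deriv_linear_form_power_mult[of a b k 1] by (simp add: dir_deriv_one)

lemma dir_deriv_power_mult_linear:
  "dir_deriv a (linear_form b ^ Suc k * linear_form c) =
    (real (Suc k) * (a \<bullet> b)) *\<^sub>R (linear_form b ^ k * linear_form c) + (a \<bullet> c) *\<^sub>R linear_form b ^ Suc k"
proof -
  have "dir_deriv a (linear_form c * 1) = (a \<bullet> c) *\<^sub>R 1"
    unfolding dir_deriv_linear_form_mult by (simp add: dir_deriv_one)
  then show ?thesis unfolding dir_deriv_linear_form_power_mult by (simp add: poly_scaleR_mult_right)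
qed

lemma bombieri_power_mult_power:
  "bombieri (Suc m) (linear_form u ^ m * linear_form a) (linear_form w ^ Suc m) = (u \<bullet> w) ^ m * (a \<bullet> w)"
  using bombieri_linear_form_mult[of m a "linear_form u ^ m" "linear_form w ^ Suc m"]
  unfolding dir_deriv_power bombieri_scaleR_right bombieri_powers by (simp add: mult.commute)

text \<open>The two summands are those of the Leibniz rule: the derivative in direction
  \<open>a\<close> hits one of the factors \<open>w\<close> or the factor \<open>b\<close>.\<close>

lemma bombieri_power_mult_power_mult:
  "real (Suc (Suc m)) * bombieri (Suc (Suc m)) (linear_form u ^ Suc m * linear_form a) (linear_form w ^ Suc m * linear_form b) =
    real (Suc m) * (a \<bullet> w) * ((u \<bullet> w) ^ m * (u \<bullet> b)) + (a \<bullet> b) * (u \<bullet> w) ^ Suc m"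
proof -
  have "bombieri (Suc m) (linear_form u ^ Suc m) (linear_form w ^ m * linear_form b) = (u \<bullet> w) ^ m * (u \<bullet> b)"
    by (subst bombieri_commute, subst bombieri_power_mult_power) (simp add: inner_commute)
  then show ?thesis
    using bombieri_linear_form_mult[of "Suc m" a "linear_form u ^ Suc m" "linear_form w ^ Suc m * linear_form b"]
    unfolding dir_deriv_power_mult_linear bombieri_linear bombieri_powers by (simp add: mult.commute[of "linear_form a"])
qed

lemma bombieri_second_power:
  "bombieri (Suc (Suc m)) (linear_form u ^ m * linear_form a * linear_form b) (linear_form w ^ Suc (Suc m)) =
    (u \<bullet> w) ^ m * (a \<bullet> w) * (b \<bullet> w)"
  using bombieri_linear_form_mult[of "Suc m" b "linear_form u ^ m * linear_form a" "linear_form w ^ Suc (Suc m)"]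
  unfolding dir_deriv_power bombieri_linear bombieri_power_mult_power
  by (simp add: mult.commute[of "linear_form b"])

text \<open>For \<open>u = w\<close> this says that second-order tangential jets are orthogonal to
  first-order ones, which makes the Hessian of a Gaussian form independent of its gradient at the
  same point.\<close>

lemma bombieri_second_first:
  assumes "a \<bullet> w = 0" "b \<bullet> w = 0"
  shows "bombieri (Suc (Suc m)) (linear_form u ^ m * linear_form a * linear_form b) (linear_form w ^ Suc m * linear_form c) = 0"
  using bombieri_linear_form_mult[of "Suc m" b "linear_form u ^ m * linear_form a" "linear_form w ^ Suc m * linear_form c"]
  unfolding dir_deriv_power_mult_linear bombieri_linear bombieri_power_mult_power
  by (simp add: mult.commute[of "linear_form b"] assms)

text \<open>The covariance of the tangential Hessian, in the form of a sum over pairings: diagonal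
  entries have twice the variance of off-diagonal ones, as in the Gaussian orthogonal
  ensemble.\<close>

lemma bombieri_second_second:
  assumes u: "u \<bullet> u = 1" and perp: "a \<bullet> u = 0" "b \<bullet> u = 0" "c \<bullet> u = 0" "d \<bullet> u = 0"
  shows "real (Suc (Suc m)) * real (Suc m) * bombieri (Suc (Suc m)) (linear_form u ^ m * linear_form a * linear_form b)
      (linear_form u ^ m * linear_form c * linear_form d) = (a \<bullet> c) * (b \<bullet> d) + (a \<bullet> d) * (b \<bullet> c)"
proof -
  have 1: "real (Suc m) * bombieri (Suc m) (linear_form u ^ m * linear_form x) (linear_form u ^ m * linear_form y) = x \<bullet> y"
    if "x \<bullet> u = 0" "y \<bullet> u = 0" for x y
  proof (cases m)
    case 0
    then show ?thesis using bombieri_linear_form_mult[of 0 x 1 "linear_form y * 1"]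
      unfolding dir_deriv_linear_form_mult by (simp add: dir_deriv_one bombieri_linear bombieri_0_one)
  next
    case (Suc k)
    then show ?thesis using bombieri_power_mult_power_mult[of k u x u y] that u by simp
  qed
  have d: "dir_deriv b (linear_form u ^ m * linear_form c * linear_form d) =
      (b \<bullet> c) *\<^sub>R (linear_form u ^ m * linear_form d) + (b \<bullet> d) *\<^sub>R (linear_form u ^ m * linear_form c)"
  proof -
    have "dir_deriv b (linear_form u ^ m) = 0" using perp
      by (cases m) (simp_all add: dir_deriv_one dir_deriv_power del: power_Suc)
    then have "dir_deriv b (linear_form c * (linear_form d * linear_form u ^ m)) =
      (b \<bullet> c) *\<^sub>R (linear_form d * linear_form u ^ m) + (b \<bullet> d) *\<^sub>R (linear_form c * linear_form u ^ m)"
      by (simp add: dir_deriv_linear_form_mult poly_scaleR_mult_right distrib_left)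
    then show ?thesis by (simp add: ac_simps)
  qed
  have "real (Suc (Suc m)) * bombieri (Suc (Suc m)) (linear_form u ^ m * linear_form a * linear_form b)
      (linear_form u ^ m * linear_form c * linear_form d) =
      (b \<bullet> c) * bombieri (Suc m) (linear_form u ^ m * linear_form a) (linear_form u ^ m * linear_form d) +
      (b \<bullet> d) * bombieri (Suc m) (linear_form u ^ m * linear_form a) (linear_form u ^ m * linear_form c)"
    using bombieri_linear_form_mult[of "Suc m" b "linear_form u ^ m * linear_form a" "linear_form u ^ m * linear_form c * linear_form d"]
    unfolding d bombieri_linear by (simp add: mult.commute[of "linear_form b"])
  then have "real (Suc (Suc m)) * real (Suc m) * bombieri (Suc (Suc m)) (linear_form u ^ m * linear_form a * linear_form b)
      (linear_form u ^ m * linear_form c * linear_form d) =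
      (b \<bullet> c) * (real (Suc m) * bombieri (Suc m) (linear_form u ^ m * linear_form a) (linear_form u ^ m * linear_form d)) +
      (b \<bullet> d) * (real (Suc m) * bombieri (Suc m) (linear_form u ^ m * linear_form a) (linear_form u ^ m * linear_form c))"
    by (metis (no_types, lifting) distrib_left mult.assoc mult.left_commute)
  then show ?thesis using 1 perp by (simp add: mult.commute add.commute)
qed

lemma linear_form_power_neq_0: "t \<noteq> 0 \<Longrightarrow> linear_form t ^ p \<noteq> 0"
  using bombieri_powers[of p t t] by (metis bombieri_zero_left inner_eq_zero_iff power_not_zero)

section \<open>Closure properties of the spaces of forms\<close>

lemma sym_power_add: "f \<in> sym_power p \<Longrightarrow> g \<in> sym_power p \<Longrightarrow> f + g \<in> sym_power p"
  using Poly_Mapping.keys_add[of f g] by (auto simp: sym_power_def)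

lemma sym_power_scaleR: "f \<in> sym_power p \<Longrightarrow> c *\<^sub>R f \<in> sym_power p"
  by (auto simp: sym_power_def in_keys_iff lookup_scaleR)

lemma subspace_sym_power: "subspace (sym_power p)"
  by (auto simp: subspace_def sym_power_add sym_power_scaleR) (simp add: sym_power_def)

lemma sym_power_mult: "f \<in> sym_power p \<Longrightarrow> g \<in> sym_power q \<Longrightarrow> f * g \<in> sym_power (p + q)"
  using keys_mult[of f g] by (fastforce simp: sym_power_def exponents_def lookup_add sum.distrib)

lemma linear_form_sym_power: "linear_form t \<in> sym_power 1"
proof -
  have *: "basis_vec i \<in> sym_power 1" for i
    by (auto simp: basis_vec_def sym_power_def exponents_def lookup_single when_def)
  show ?thesis unfolding linear_form_def
    by (intro subspace_sum subspace_sym_power subspace_scale *)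
qed

lemma linear_form_power_sym_power: "linear_form t ^ p \<in> sym_power p"
proof (induction p)
  case 0
  then show ?case by (simp add: sym_power_def exponents_0)
next
  case (Suc p)
  then show ?case using sym_power_mult[OF linear_form_sym_power Suc, of t] by simp
qed

text \<open>Induction on \<open>k\<close> for all cofactors at once: one factor of the power is
  expanded in the basis and \<open>basis_vec i\<close> is moved into \<open>c\<close>. For
  \<open>k = 0\<close> the truncated exponent \<open>k - 1\<close> is harmless because its
  coefficient is 0.\<close>

lemma has_derivative_lookup_power_mult:
  "((\<lambda>t. Poly_Mapping.lookup (linear_form t ^ k * c) \<alpha>) has_derivative
    (\<lambda>h. real k * Poly_Mapping.lookup (linear_form t ^ (k - 1) * linear_form h * c) \<alpha>)) (at t)"
proof (induction k arbitrary: c)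
  case 0
  then show ?case by simp
next
  case (Suc k)
  have split: "Poly_Mapping.lookup (linear_form t ^ Suc k * c) \<alpha> =
      (\<Sum>i\<in>UNIV. t $ i * Poly_Mapping.lookup (linear_form t ^ k * (basis_vec i * c)) \<alpha>)" for t
  proof -
    have "linear_form t ^ Suc k * c = linear_form t * (linear_form t ^ k * c)" by (simp add: ac_simps)
    also have "\<dots> = (\<Sum>i\<in>UNIV. t $ i *\<^sub>R (basis_vec i * (linear_form t ^ k * c)))"
      by (subst linear_form_def) (simp add: sum_distrib_right poly_scaleR_mult_left)
    finally show ?thesis by (simp add: lookup_sum lookup_scaleR ac_simps)
  qed
  have lin: "(\<Sum>i\<in>UNIV. h $ i * Poly_Mapping.lookup (f * (basis_vec i * c)) \<alpha>) = Poly_Mapping.lookup (f * linear_form h * c) \<alpha>" for h f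
    by (simp add: linear_form_def sum_distrib_left sum_distrib_right poly_scaleR_mult_left poly_scaleR_mult_right lookup_sum lookup_scaleR ac_simps)
  have "((\<lambda>t. \<Sum>i\<in>UNIV. t $ i * Poly_Mapping.lookup (linear_form t ^ k * (basis_vec i * c)) \<alpha>) has_derivative
    (\<lambda>h. \<Sum>i\<in>UNIV. t $ i * (real k * Poly_Mapping.lookup (linear_form t ^ (k - 1) * linear_form h * (basis_vec i * c)) \<alpha>) +
       h $ i * Poly_Mapping.lookup (linear_form t ^ k * (basis_vec i * c)) \<alpha>)) (at t)"
    by (intro has_derivative_sum has_derivative_mult Suc.IH bounded_linear.has_derivative[OF bounded_linear_vec_nth] has_derivative_ident)
  moreover have "(\<Sum>i\<in>UNIV. t $ i * (real k * Poly_Mapping.lookup (linear_form t ^ (k - 1) * linear_form h * (basis_vec i * c)) \<alpha>) +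
       h $ i * Poly_Mapping.lookup (linear_form t ^ k * (basis_vec i * c)) \<alpha>) =
      real (Suc k) * Poly_Mapping.lookup (linear_form t ^ (Suc k - 1) * linear_form h * c) \<alpha>" for h
  proof -
    have "(\<Sum>i\<in>UNIV. t $ i * (real k * Poly_Mapping.lookup (linear_form t ^ (k - 1) * linear_form h * (basis_vec i * c)) \<alpha>)) =
      real k * (\<Sum>i\<in>UNIV. t $ i * Poly_Mapping.lookup (linear_form t ^ (k - 1) * linear_form h * (basis_vec i * c)) \<alpha>)"
      by (simp add: sum_distrib_left ac_simps)
    also have "\<dots> = real k * Poly_Mapping.lookup (linear_form t ^ k * linear_form h * c) \<alpha>"
      unfolding lin by (cases k) (simp_all add: ac_simps)
    finally show ?thesis by (simp only: sum.distrib lin) (simp add: distrib_right)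
  qed
  ultimately show ?case unfolding split by simp
qed

lemma has_derivative_bombieri_power_mult:
  "((\<lambda>t. bombieri p v (linear_form t ^ k * c)) has_derivative
    (\<lambda>h. real k * bombieri p v (linear_form t ^ (k - 1) * linear_form h * c))) (at t)"
proof -
  have "((\<lambda>t. bombieri p v (linear_form t ^ k * c)) has_derivative
    (\<lambda>h. \<Sum>\<alpha>\<in>exponents p. (\<Prod>i\<in>UNIV. fact (Poly_Mapping.lookup \<alpha> i)) / fact p * Poly_Mapping.lookup v \<alpha> *
      (real k * Poly_Mapping.lookup (linear_form t ^ (k - 1) * linear_form h * c) \<alpha>))) (at t)"
    unfolding bombieri_def
    by (intro has_derivative_sum has_derivative_mult_right has_derivative_lookup_power_mult)
  then show ?thesis unfolding bombieri_def sum_distrib_left by (simp add: ac_simps)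
qed

section \<open>Gaussian measures on forms\<close>

text \<open>Generated by the coefficient functions, so that measurability of a polynomial-valued map
  can be checked coefficientwise.\<close>

definition poly_sigma :: "real_poly3 measure" where
  "poly_sigma = vimage_algebra UNIV Poly_Mapping.lookup (PiM UNIV (\<lambda>_. borel))"

lemma space_poly_sigma [simp]: "space poly_sigma = UNIV"
  by (simp add: poly_sigma_def)

lemma measurable_lookup_poly_sigma [measurable]:
  "(\<lambda>f. Poly_Mapping.lookup f \<alpha>) \<in> borel_measurable poly_sigma"
proof -
  have "Poly_Mapping.lookup \<in> measurable poly_sigma (PiM UNIV (\<lambda>_. borel :: real measure))"
    unfolding poly_sigma_def by (rule measurable_vimage_algebra1) (auto simp: space_PiM)
  then show ?thesis by (rule measurable_compose) measurable
qed

lemma measurable_poly_sigmaI: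
  assumes "\<And>\<alpha>. (\<lambda>x. Poly_Mapping.lookup (X x) \<alpha>) \<in> borel_measurable N"
  shows "X \<in> measurable N poly_sigma"
  unfolding poly_sigma_def
  by (rule measurable_vimage_algebra2) (auto intro!: measurable_PiM_single' assms)

lemma measurable_poly_sigma_lookup:
  assumes "X \<in> measurable N poly_sigma"
  shows "(\<lambda>x. Poly_Mapping.lookup (X x) \<alpha>) \<in> borel_measurable N"
  using assms measurable_lookup_poly_sigma by (rule measurable_compose)

lemma measurable_poly_add [measurable]:
  assumes "X \<in> measurable N poly_sigma" "Y \<in> measurable N poly_sigma"
  shows "(\<lambda>x. X x + Y x) \<in> measurable N poly_sigma"
  using assms[THEN measurable_poly_sigma_lookup]
  by (intro measurable_poly_sigmaI) (auto simp: lookup_add)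

lemma measurable_poly_diff [measurable]:
  assumes "X \<in> measurable N poly_sigma" "Y \<in> measurable N poly_sigma"
  shows "(\<lambda>x. X x - Y x) \<in> measurable N poly_sigma"
  using assms[THEN measurable_poly_sigma_lookup]
  by (intro measurable_poly_sigmaI) (auto simp: lookup_minus)

lemma measurable_poly_scaleR [measurable]:
  assumes "c \<in> borel_measurable N" "Y \<in> measurable N poly_sigma"
  shows "(\<lambda>x. c x *\<^sub>R Y x) \<in> measurable N poly_sigma"
  using assms(1) assms(2)[THEN measurable_poly_sigma_lookup]
  by (intro measurable_poly_sigmaI) (auto simp: lookup_scaleR)

lemma measurable_poly_sum [measurable]:
  assumes "\<And>i. i \<in> I \<Longrightarrow> X i \<in> measurable N poly_sigma"
  shows "(\<lambda>x. \<Sum>i\<in>I. X i x) \<in> measurable N poly_sigma"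
  using assms[THEN measurable_poly_sigma_lookup]
  by (intro measurable_poly_sigmaI) (auto simp: lookup_sum)

lemma measurable_bombieri [measurable]:
  assumes "X \<in> measurable N poly_sigma" "Y \<in> measurable N poly_sigma"
  shows "(\<lambda>x. bombieri p (X x) (Y x)) \<in> borel_measurable N"
  using assms[THEN measurable_poly_sigma_lookup] unfolding bombieri_def by auto

text \<open>Orthonormality of \<open>b\<close> is left to \<open>onb\<close>; rotating two members
  of the family is thus a statement about the measure alone.\<close>

definition gauss_rep :: "'i set \<Rightarrow> ('i \<Rightarrow> real_poly3) \<Rightarrow> real_poly3 measure" where
  "gauss_rep I b = distr (PiM I (\<lambda>_. gauss)) poly_sigma (\<lambda>x. \<Sum>i\<in>I. x i *\<^sub>R b i)"

lemma sets_gauss_rep [simp, measurable_cong]: "sets (gauss_rep I b) = sets poly_sigma"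
  by (simp add: gauss_rep_def)

lemma product_sigma_finite_gauss: "product_sigma_finite (\<lambda>_. gauss)"
  using prob_space_gauss by (simp add: product_sigma_finite_def prob_space_imp_sigma_finite)

lemma measurable_gauss_sum [measurable]:
  "(\<lambda>x. \<Sum>i\<in>I. x i *\<^sub>R b i) \<in> measurable (PiM I (\<lambda>_. gauss)) poly_sigma"
  by measurable

lemma prob_space_gauss_rep: "prob_space (gauss_rep I b)"
proof -
  interpret product_prob_space "\<lambda>_. gauss" I
    using prob_space_gauss by (simp add: product_prob_space_def product_prob_space_axioms_def product_sigma_finite_gauss)
  show ?thesis unfolding gauss_rep_def by (rule prob_space_distr) measurable
qed

lemma nn_integral_gauss_const: "(\<integral>\<^sup>+x. c \<partial>gauss) = c"
  using prob_space.emeasure_space_1[OF prob_space_gauss] by simp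

lemma nn_integral_gauss_rep:
  assumes [measurable]: "\<Psi> \<in> borel_measurable poly_sigma"
  shows "(\<integral>\<^sup>+v. \<Psi> v \<partial>gauss_rep I b) = (\<integral>\<^sup>+x. \<Psi> (\<Sum>i\<in>I. x i *\<^sub>R b i) \<partial>PiM I (\<lambda>_. gauss))"
  unfolding gauss_rep_def by (subst nn_integral_distr) measurable

lemma nn_integral_gauss_rep_insert:
  assumes I: "finite I" "i \<notin> I" and [measurable]: "\<Psi> \<in> borel_measurable poly_sigma"
  shows "(\<integral>\<^sup>+v. \<Psi> v \<partial>gauss_rep (insert i I) b) =
    (\<integral>\<^sup>+x. \<integral>\<^sup>+s. \<Psi> (s *\<^sub>R b i + (\<Sum>k\<in>I. x k *\<^sub>R b k)) \<partial>gauss \<partial>PiM I (\<lambda>_. gauss))"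
proof -
  interpret product_sigma_finite "\<lambda>_. gauss" by (rule product_sigma_finite_gauss)
  have eq: "(\<Sum>k\<in>insert i I. (x(i := s)) k *\<^sub>R b k) = s *\<^sub>R b i + (\<Sum>k\<in>I. x k *\<^sub>R b k)" for x s
    using I by (auto intro!: sum.cong)
  have "(\<integral>\<^sup>+v. \<Psi> v \<partial>gauss_rep (insert i I) b) = (\<integral>\<^sup>+x. \<Psi> (\<Sum>k\<in>insert i I. x k *\<^sub>R b k) \<partial>PiM (insert i I) (\<lambda>_. gauss))"
    by (rule nn_integral_gauss_rep) measurable
  also have "\<dots> = (\<integral>\<^sup>+x. \<integral>\<^sup>+s. \<Psi> (\<Sum>k\<in>insert i I. (x(i := s)) k *\<^sub>R b k) \<partial>gauss \<partial>PiM I (\<lambda>_. gauss))"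
    by (rule product_nn_integral_insert[OF I]) measurable
  finally show ?thesis unfolding eq .
qed

lemma nn_integral_gauss_rep_insert2:
  assumes I: "finite I" "i \<notin> I" "j \<notin> I" "i \<noteq> j" and [measurable]: "\<Psi> \<in> borel_measurable poly_sigma"
  shows "(\<integral>\<^sup>+v. \<Psi> v \<partial>gauss_rep (insert j (insert i I)) b) =
    (\<integral>\<^sup>+x. \<integral>\<^sup>+s. \<integral>\<^sup>+t. \<Psi> (s *\<^sub>R b i + t *\<^sub>R b j + (\<Sum>k\<in>I. x k *\<^sub>R b k)) \<partial>gauss \<partial>gauss \<partial>PiM I (\<lambda>_. gauss))"
proof -
  interpret product_sigma_finite "\<lambda>_. gauss" by (rule product_sigma_finite_gauss)
  have eq: "t *\<^sub>R b j + (\<Sum>k\<in>insert i I. (x(i := s)) k *\<^sub>R b k) = s *\<^sub>R b i + t *\<^sub>R b j + (\<Sum>k\<in>I. x k *\<^sub>R b k)" for x s t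
  proof -
    have "(\<Sum>k\<in>insert i I. (x(i := s)) k *\<^sub>R b k) = s *\<^sub>R b i + (\<Sum>k\<in>I. x k *\<^sub>R b k)"
      using I by (auto intro!: sum.cong)
    then show ?thesis by (simp only: ac_simps)
  qed
  have "(\<integral>\<^sup>+v. \<Psi> v \<partial>gauss_rep (insert j (insert i I)) b) =
      (\<integral>\<^sup>+x. \<integral>\<^sup>+t. \<Psi> (t *\<^sub>R b j + (\<Sum>k\<in>insert i I. x k *\<^sub>R b k)) \<partial>gauss \<partial>PiM (insert i I) (\<lambda>_. gauss))"
    by (rule nn_integral_gauss_rep_insert) (use I in auto)
  also have "\<dots> = (\<integral>\<^sup>+x. \<integral>\<^sup>+s. \<integral>\<^sup>+t. \<Psi> (t *\<^sub>R b j + (\<Sum>k\<in>insert i I. (x(i := s)) k *\<^sub>R b k)) \<partial>gauss \<partial>gauss \<partial>PiM I (\<lambda>_. gauss))"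
    by (rule product_nn_integral_insert[OF I(1,2)]) measurable
  finally show ?thesis unfolding eq .
qed

lemma gauss_rep_eqI:
  assumes "\<And>\<Psi>. \<Psi> \<in> borel_measurable poly_sigma \<Longrightarrow> (\<integral>\<^sup>+v. \<Psi> v \<partial>gauss_rep I b) = (\<integral>\<^sup>+v. \<Psi> v \<partial>gauss_rep J c)"
  shows "gauss_rep I b = gauss_rep J c"
proof (rule measure_eqI)
  fix A assume "A \<in> sets (gauss_rep I b)"
  then show "emeasure (gauss_rep I b) A = emeasure (gauss_rep J c) A"
    using assms[of "indicator A"] by simp
qed simp

text \<open>Rotating two members of the family amounts to rotating their two coordinates, and the
  plane Gaussian is invariant under that.\<close>

lemma gauss_rep_rotate:
  assumes "finite I" "i \<in> I" "j \<in> I" "i \<noteq> j" and cs: "c\<^sup>2 + s\<^sup>2 = 1"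
  shows "gauss_rep I (b(i := c *\<^sub>R b i + s *\<^sub>R b j, j := c *\<^sub>R b j - s *\<^sub>R b i)) = gauss_rep I b"
proof (rule gauss_rep_eqI)
  fix \<Psi> :: "real_poly3 \<Rightarrow> ennreal" assume [measurable]: "\<Psi> \<in> borel_measurable poly_sigma"
  define K where "K = I - {i, j}"
  have I: "I = insert j (insert i K)" and K: "finite K" "i \<notin> K" "j \<notin> K"
    using assms by (auto simp: K_def)
  let ?b = "b(i := c *\<^sub>R b i + s *\<^sub>R b j, j := c *\<^sub>R b j - s *\<^sub>R b i)"
  have "(\<integral>\<^sup>+x. \<integral>\<^sup>+y. \<Psi> (x *\<^sub>R ?b i + y *\<^sub>R ?b j + (\<Sum>k\<in>K. w k *\<^sub>R ?b k)) \<partial>gauss \<partial>gauss) =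
    (\<integral>\<^sup>+x. \<integral>\<^sup>+y. \<Psi> (x *\<^sub>R b i + y *\<^sub>R b j + (\<Sum>k\<in>K. w k *\<^sub>R b k)) \<partial>gauss \<partial>gauss)" for w
  proof -
    let ?W = "\<Sum>k\<in>K. w k *\<^sub>R b k"
    have W: "(\<Sum>k\<in>K. w k *\<^sub>R ?b k) = ?W"
      using K by (auto intro!: sum.cong)
    have eq: "x *\<^sub>R ?b i + y *\<^sub>R ?b j + ?W = (c * x - s * y) *\<^sub>R b i + (s * x + c * y) *\<^sub>R b j + ?W" for x y
      using assms(4) by (simp add: algebra_simps)
    show ?thesis unfolding W eq
      by (rule nn_integral_gauss_rotate[OF _ cs, where g="\<lambda>x y. \<Psi> (x *\<^sub>R b i + y *\<^sub>R b j + ?W)"]) measurable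
  qed
  then show "(\<integral>\<^sup>+v. \<Psi> v \<partial>gauss_rep I ?b) = (\<integral>\<^sup>+v. \<Psi> v \<partial>gauss_rep I b)"
    unfolding I using K assms(4) by (simp add: nn_integral_gauss_rep_insert2 del: fun_upd_apply)
qed

lemma nn_integral_gauss_minus:
  assumes [measurable]: "f \<in> borel_measurable borel"
  shows "(\<integral>\<^sup>+x. f (- x) \<partial>gauss) = (\<integral>\<^sup>+x. f x \<partial>gauss)"
proof -
  have "(\<integral>\<^sup>+x. f x \<partial>gauss) = (\<integral>\<^sup>+x. ennreal (std_normal_density (0 + (-1) * x)) * f (0 + (-1) * x) \<partial>lborel)"
    using nn_integral_real_affine[where c="-1" and t=0 and f="\<lambda>x. ennreal (std_normal_density x) * f x"]
    by (simp add: nn_integral_gauss)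
  also have "\<dots> = (\<integral>\<^sup>+x. ennreal (std_normal_density x) * f (- x) \<partial>lborel)"
    by (simp add: std_normal_density_def)
  also have "\<dots> = (\<integral>\<^sup>+x. f (- x) \<partial>gauss)"
    by (rule nn_integral_gauss[symmetric]) measurable
  finally show ?thesis by (rule sym)
qed

lemma gauss_rep_flip:
  assumes "finite I" "i \<in> I"
  shows "gauss_rep I (b(i := - b i)) = gauss_rep I b"
proof (rule gauss_rep_eqI)
  fix \<Psi> :: "real_poly3 \<Rightarrow> ennreal" assume [measurable]: "\<Psi> \<in> borel_measurable poly_sigma"
  define K where "K = I - {i}"
  have I: "I = insert i K" and K: "finite K" "i \<notin> K"
    using assms by (auto simp: K_def)
  let ?b = "b(i := - b i)"
  have "(\<integral>\<^sup>+x. \<Psi> (x *\<^sub>R ?b i + (\<Sum>k\<in>K. w k *\<^sub>R ?b k)) \<partial>gauss) = (\<integral>\<^sup>+x. \<Psi> (x *\<^sub>R b i + (\<Sum>k\<in>K. w k *\<^sub>R b k)) \<partial>gauss)" for w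
  proof -
    have W: "(\<Sum>k\<in>K. w k *\<^sub>R ?b k) = (\<Sum>k\<in>K. w k *\<^sub>R b k)"
      using K by (auto intro!: sum.cong)
    show ?thesis unfolding W
      using nn_integral_gauss_minus[of "\<lambda>x. \<Psi> (x *\<^sub>R b i + (\<Sum>k\<in>K. w k *\<^sub>R b k))"] by simp
  qed
  then show "(\<integral>\<^sup>+v. \<Psi> v \<partial>gauss_rep I ?b) = (\<integral>\<^sup>+v. \<Psi> v \<partial>gauss_rep I b)"
    unfolding I using K by (simp add: nn_integral_gauss_rep_insert del: fun_upd_apply)
qed

text \<open>An indexed family rather than a set: the vectors change under rotations while the index
  set, and with it the product measure of the coordinates, stays. The spanning property is stated as
  the expansion formula.\<close>

definition onb :: "nat \<Rightarrow> 'i set \<Rightarrow> ('i \<Rightarrow> real_poly3) \<Rightarrow> bool" where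
  "onb p I b \<longleftrightarrow> finite I \<and> (\<forall>i\<in>I. b i \<in> sym_power p) \<and>
    (\<forall>i\<in>I. \<forall>j\<in>I. bombieri p (b i) (b j) = (if i = j then 1 else 0)) \<and>
    (\<forall>y\<in>sym_power p. (\<Sum>i\<in>I. bombieri p (b i) y *\<^sub>R b i) = y)"

lemma sym_power_closed:
  "f \<in> sym_power p \<Longrightarrow> g \<in> sym_power p \<Longrightarrow> f - g \<in> sym_power p"
  "f \<in> sym_power p \<Longrightarrow> - f \<in> sym_power p"
  using subspace_sym_power[of p] by (auto simp: subspace_diff subspace_neg)

lemma onb_rotate:
  assumes b: "onb p I b" and ij: "i \<in> I" "j \<in> I" "i \<noteq> j" and cs: "c\<^sup>2 + s\<^sup>2 = 1"
  shows "onb p I (b(i := c *\<^sub>R b i + s *\<^sub>R b j, j := c *\<^sub>R b j - s *\<^sub>R b i))" (is "onb p I ?b")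
  unfolding onb_def
proof (intro conjI ballI)
  show "finite I" using b by (simp add: onb_def)
  show "?b k \<in> sym_power p" if "k \<in> I" for k
    using b ij that by (auto simp: onb_def intro!: sym_power_add sym_power_closed sym_power_scaleR)
  have ortho: "bombieri p (b k) (b l) = (if k = l then 1 else 0)" if "k \<in> I" "l \<in> I" for k l
    using b that by (auto simp: onb_def)
  have cs': "c * c + s * s = 1" "s * s + c * c = 1" using cs by (auto simp: power2_eq_square)
  show "bombieri p (?b k) (?b l) = (if k = l then 1 else 0)" if "k \<in> I" "l \<in> I" for k l
    using that ij cs' by (auto simp: bombieri_linear ortho)
  fix y assume y: "y \<in> sym_power p"
  define K where "K = I - {i, j}"
  have I: "I = insert j (insert i K)" and K: "finite K" "i \<notin> K" "j \<notin> K"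
    using ij b by (auto simp: K_def onb_def)
  let ?A = "bombieri p (b i) y" and ?B = "bombieri p (b j) y"
  have "(c * ?A + s * ?B) *\<^sub>R (c *\<^sub>R b i + s *\<^sub>R b j) + (c * ?B - s * ?A) *\<^sub>R (c *\<^sub>R b j - s *\<^sub>R b i) =
      ((c * c + s * s) * ?A) *\<^sub>R b i + ((c * c + s * s) * ?B) *\<^sub>R b j"
    by (simp add: algebra_simps)
  then have two: "(c * ?A + s * ?B) *\<^sub>R (c *\<^sub>R b i + s *\<^sub>R b j) + (c * ?B - s * ?A) *\<^sub>R (c *\<^sub>R b j - s *\<^sub>R b i) =
      ?A *\<^sub>R b i + ?B *\<^sub>R b j" unfolding cs' by simp
  define f where "f k = bombieri p (?b k) y *\<^sub>R ?b k" for k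
  define g where "g k = bombieri p (b k) y *\<^sub>R b k" for k
  have "sum f K = sum g K" using K by (intro sum.cong) (auto simp: f_def g_def)
  moreover have "f i + f j = g i + g j"
    using ij(3) two by (simp add: f_def g_def bombieri_linear)
  moreover have "sum h I = h i + h j + sum h K" for h :: "_ \<Rightarrow> real_poly3"
    unfolding I using K ij(3) by (simp add: ac_simps)
  ultimately have "sum f I = sum g I" by (simp only:)
  then have "(\<Sum>k\<in>I. bombieri p (?b k) y *\<^sub>R ?b k) = (\<Sum>k\<in>I. bombieri p (b k) y *\<^sub>R b k)"
    unfolding f_def[abs_def] g_def[abs_def] .
  then show "(\<Sum>k\<in>I. bombieri p (?b k) y *\<^sub>R ?b k) = y" using b y by (simp add: onb_def)
qed

lemma onb_flip:
  assumes b: "onb p I b" and i: "i \<in> I"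
  shows "onb p I (b(i := - b i))"
  using assms unfolding onb_def
  by (auto simp: bombieri_linear sym_power_closed fun_upd_def if_distrib cong: if_cong intro!: sum.cong elim!: ballE)
     (smt (verit, best) scaleR_minus_left scaleR_minus_right sum.cong minus_minus)

text \<open>Rotation invariance by plane rotations only. As long as two coordinates of
  \<open>c\<close> are nonzero, rotating the corresponding pair kills one of them; in the end
  \<open>c\<close> is a basis vector up to sign, and a flip removes the sign. Members indexed by
  \<open>K\<close> have coordinate 0 and are never touched.\<close>

lemma onb_extend:
  assumes "onb p I b" and c: "c \<in> sym_power p" "bombieri p c c = 1" and "K \<subseteq> I" "\<And>k. k \<in> K \<Longrightarrow> bombieri p (b k) c = 0"
  shows "\<exists>b' i. i \<in> I - K \<and> onb p I b' \<and> gauss_rep I b' = gauss_rep I b \<and> b' i = c \<and> (\<forall>k\<in>K. b' k = b k)"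
  using assms(1,4,5)
proof (induction "card {i\<in>I. bombieri p (b i) c \<noteq> 0}" arbitrary: b rule: less_induct)
  case (less b)
  let ?S = "{i\<in>I. bombieri p (b i) c \<noteq> 0}"
  have fin: "finite I" "finite ?S" using less.prems by (auto simp: onb_def)
  have expand: "(\<Sum>i\<in>I. bombieri p (b i) c *\<^sub>R b i) = c" using less.prems(1) c by (auto simp: onb_def)
  obtain i where i: "i \<in> ?S"
  proof -
    have "c \<noteq> 0" using c by auto
    have "?S \<noteq> {}"
    proof
      assume "?S = {}"
      then have "(\<Sum>i\<in>I. bombieri p (b i) c *\<^sub>R b i) = 0" by (intro sum.neutral) auto
      then show False using expand \<open>c \<noteq> 0\<close> by simp
    qed
    then show ?thesis using that by blast
  qed
  show ?case
  proof (cases "?S = {i}")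
    case True
    then have "(\<Sum>k\<in>I. bombieri p (b k) c *\<^sub>R b k) = (\<Sum>k\<in>{i}. bombieri p (b k) c *\<^sub>R b k)"
      using fin by (intro sum.mono_neutral_right) auto
    then have ci: "c = bombieri p (b i) c *\<^sub>R b i" using expand by simp
    then have "bombieri p c c = bombieri p (b i) c * bombieri p (b i) c"
      by (metis bombieri_scaleR_left)
    then have "bombieri p (b i) c = 1 \<or> bombieri p (b i) c = -1"
      using c by (simp add: square_eq_1_iff)
    then have "c = b i \<or> c = - b i" using ci by (metis scaleR_minus1_left scaleR_one)
    moreover have iK: "i \<in> I - K" using i less.prems(3) by auto
    ultimately show ?thesis
    proof (elim disjE)
      assume "c = b i"
      then show ?thesis using iK less.prems by blast
    next
      assume "c = - b i"
      then show ?thesis using iK less.prems fin gauss_rep_flip[of I i b] onb_flip[of p I b i]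
        by (intro exI[of _ "b(i := - b i)"] exI[of _ i]) auto
    qed
  next
    case False
    then obtain j where j: "j \<in> ?S" "i \<noteq> j" using i by blast
    define A B where "A = bombieri p (b i) c" and "B = bombieri p (b j) c"
    define R where "R = sqrt (A\<^sup>2 + B\<^sup>2)"
    have "A \<noteq> 0" using i by (simp add: A_def)
    then have R: "R > 0" "R\<^sup>2 = A\<^sup>2 + B\<^sup>2" by (auto simp: R_def add_pos_nonneg)
    have cs: "(A / R)\<^sup>2 + (B / R)\<^sup>2 = 1" using R(1) by (simp add: power_divide add_divide_distrib[symmetric] R(2)[symmetric])
    \<comment> \<open>The rotation turns the i-th vector towards the projection of \<open>c\<close>
      to the plane of the pair, which makes the j-th vector orthogonal to \<open>c\<close>.\<close>
    let ?b = "b(i := (A / R) *\<^sub>R b i + (B / R) *\<^sub>R b j, j := (A / R) *\<^sub>R b j - (B / R) *\<^sub>R b i)"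
    have ijK: "i \<notin> K" "j \<notin> K" using i j less.prems(3) by auto
    have j0: "bombieri p (?b j) c = 0" by (simp add: bombieri_linear A_def[symmetric] B_def[symmetric])
    have "{k\<in>I. bombieri p (?b k) c \<noteq> 0} \<subset> ?S"
      using i j j0 by (auto split: if_splits)
    then have "card {k\<in>I. bombieri p (?b k) c \<noteq> 0} < card ?S" using fin by (intro psubset_card_mono)
    then have "\<exists>b' i. i \<in> I - K \<and> onb p I b' \<and> gauss_rep I b' = gauss_rep I ?b \<and> b' i = c \<and> (\<forall>k\<in>K. b' k = ?b k)"
    proof (rule less.hyps)
      show "onb p I ?b" using i j less.prems(1) cs by (intro onb_rotate) auto
      show "K \<subseteq> I" by fact
      show "bombieri p (?b k) c = 0" if "k \<in> K" for k using that ijK less.prems(3) by auto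
    qed
    moreover have "gauss_rep I ?b = gauss_rep I b" using i j fin cs by (intro gauss_rep_rotate) auto
    moreover have "\<forall>k\<in>K. ?b k = b k" using ijK by auto
    ultimately show ?thesis by metis
  qed
qed

text \<open>Indices are polynomials because the basis that comes with
  \<open>standard_gaussian\<close> is a set, indexed by itself.\<close>

definition gaussian_law :: "nat \<Rightarrow> real_poly3 measure \<Rightarrow> bool" where
  "gaussian_law p G \<longleftrightarrow> (\<exists>(I :: real_poly3 set) b. onb p I b \<and> G = gauss_rep I b)"

text \<open>The form in which rotation invariance is used: any finite orthonormal system may be
  assumed to belong to the basis. The vectors are inserted one at a time, with those already placed
  as \<open>K\<close> in \<open>onb_extend\<close>.\<close>

lemma gaussian_law_extend:
  fixes n :: nat
  assumes G: "gaussian_law p G" and c: "\<And>k. k < n \<Longrightarrow> c k \<in> sym_power p"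
    and orth: "\<And>k l. k < n \<Longrightarrow> l < n \<Longrightarrow> bombieri p (c k) (c l) = (if k = l then 1 else 0)"
  shows "\<exists>(I :: real_poly3 set) b f. onb p I b \<and> G = gauss_rep I b \<and> inj_on f {..<n} \<and> f ` {..<n} \<subseteq> I \<and> (\<forall>k<n. b (f k) = c k)"
  using c orth
proof (induction n)
  case 0
  then show ?case using G by (auto simp: gaussian_law_def)
next
  case (Suc n)
  then obtain I :: "real_poly3 set" and b f where *: "onb p I b" "G = gauss_rep I b" "inj_on f {..<n}" "f ` {..<n} \<subseteq> I" "\<forall>k<n. b (f k) = c k"
    by (metis less_Suc_eq)
  have "bombieri p (b k) (c n) = 0" if "k \<in> f ` {..<n}" for k
    using that *(5) Suc.prems(2) by auto
  then obtain b' i where b': "i \<in> I - f ` {..<n}" "onb p I b'" "gauss_rep I b' = gauss_rep I b" "b' i = c n" "\<forall>k\<in>f ` {..<n}. b' k = b k"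
    using onb_extend[OF *(1) _ _ *(4), of "c n"] Suc.prems by (metis lessI)
  have "inj_on (f(n := i)) {..<Suc n}"
    using *(3) b'(1) by (auto simp: inj_on_def less_Suc_eq)
  moreover have "(f(n := i)) ` {..<Suc n} \<subseteq> I" using *(4) b'(1) by (auto simp: less_Suc_eq)
  moreover have "\<forall>k<Suc n. b' ((f(n := i)) k) = c k" using b'(4,5) *(5) by (auto simp: less_Suc_eq)
  ultimately show ?case using b'(2,3) *(2) by metis
qed

lemma gaussian_law_prob_space: "gaussian_law p G \<Longrightarrow> prob_space G"
  by (auto simp: gaussian_law_def prob_space_gauss_rep)

lemma sets_gaussian_law: "gaussian_law p G \<Longrightarrow> sets G = sets poly_sigma"
  by (auto simp: gaussian_law_def)

lemma onb_coord:
  assumes "onb p I b" "i \<in> I"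
  shows "bombieri p (b i) (\<Sum>k\<in>I. x k *\<^sub>R b k) = x i"
proof -
  have "bombieri p (b i) (\<Sum>k\<in>I. x k *\<^sub>R b k) = (\<Sum>k\<in>I. if k = i then x k else 0)"
    using assms unfolding bombieri_sum_right by (intro sum.cong) (auto simp: bombieri_linear onb_def)
  then show ?thesis using assms by (simp add: onb_def)
qed

text \<open>Once the four vectors are members of the basis, the integrand depends on four
  coordinates only and the others integrate to 1. It serves for the value and the three Hessian
  entries.\<close>

lemma gaussian_law_four:
  assumes G: "gaussian_law p G"
    and c: "c1 \<in> sym_power p" "c2 \<in> sym_power p" "c3 \<in> sym_power p" "c4 \<in> sym_power p"
    and unit: "bombieri p c1 c1 = 1" "bombieri p c2 c2 = 1" "bombieri p c3 c3 = 1" "bombieri p c4 c4 = 1"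
    and orth: "bombieri p c1 c2 = 0" "bombieri p c1 c3 = 0" "bombieri p c1 c4 = 0" "bombieri p c2 c3 = 0" "bombieri p c2 c4 = 0" "bombieri p c3 c4 = 0"
    and F: "(\<lambda>(x, y, z, w). F x y z w) \<in> borel_measurable (borel \<Otimes>\<^sub>M borel \<Otimes>\<^sub>M borel \<Otimes>\<^sub>M borel)"
  shows "(\<integral>\<^sup>+v. F (bombieri p c1 v) (bombieri p c2 v) (bombieri p c3 v) (bombieri p c4 v) \<partial>G) =
    (\<integral>\<^sup>+x. \<integral>\<^sup>+y. \<integral>\<^sup>+z. \<integral>\<^sup>+w. F x y z w \<partial>gauss \<partial>gauss \<partial>gauss \<partial>gauss)"
proof -
  have Fm: "(\<lambda>u. F (f1 u) (f2 u) (f3 u) (f4 u)) \<in> borel_measurable N"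
    if [measurable]: "f1 \<in> borel_measurable N" "f2 \<in> borel_measurable N" "f3 \<in> borel_measurable N" "f4 \<in> borel_measurable N" for N f1 f2 f3 f4
  proof -
    have "(\<lambda>u. (f1 u, f2 u, f3 u, f4 u)) \<in> measurable N (borel \<Otimes>\<^sub>M borel \<Otimes>\<^sub>M borel \<Otimes>\<^sub>M borel)" by measurable
    from measurable_compose[OF this F] show ?thesis by simp
  qed
  define c where "c k = [c1, c2, c3, c4] ! k" for k
  have orth': "bombieri p c2 c1 = 0" "bombieri p c3 c1 = 0" "bombieri p c4 c1 = 0" "bombieri p c3 c2 = 0" "bombieri p c4 c2 = 0" "bombieri p c4 c3 = 0"
    using orth by (auto simp: bombieri_commute)
  have less4: "k < 4 \<longleftrightarrow> k = 0 \<or> k = 1 \<or> k = 2 \<or> k = (3::nat)" for k by auto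
  have cs: "c k \<in> sym_power p" if "k < 4" for k using that c by (auto simp: less4 c_def)
  have co: "bombieri p (c k) (c l) = (if k = l then 1 else 0)" if "k < 4" "l < 4" for k l
    using that unit orth orth' by (auto simp: less4 c_def)
  obtain I :: "real_poly3 set" and b f where *: "onb p I b" "G = gauss_rep I b" "inj_on f {..<4}" "f ` {..<4::nat} \<subseteq> I" "\<forall>k<4. b (f k) = c k"
    using gaussian_law_extend[where n=4, OF G cs co] by metis
  have fI: "f 0 \<in> I" "f 1 \<in> I" "f 2 \<in> I" "f 3 \<in> I" using *(4) by auto
  have bf: "b (f 0) = c1" "b (f 1) = c2" "b (f 2) = c3" "b (f 3) = c4"
    using *(5) by (auto simp: c_def)
  have ne: "f 0 \<noteq> f 1" "f 0 \<noteq> f 2" "f 0 \<noteq> f 3" "f 1 \<noteq> f 2" "f 1 \<noteq> f 3" "f 2 \<noteq> f 3"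
    using inj_on_eq_iff[OF *(3)] by simp_all
  define K where "K = I - {f 0, f 1, f 2, f 3}"
  have I: "I = insert (f 0) (insert (f 1) (insert (f 2) (insert (f 3) K)))" using fI by (auto simp: K_def)
  have finK: "finite K" using *(1) by (auto simp: K_def onb_def)
  have nK: "f 0 \<notin> K" "f 1 \<notin> K" "f 2 \<notin> K" "f 3 \<notin> K" by (auto simp: K_def)
  interpret product_sigma_finite "\<lambda>_. gauss" by (rule product_sigma_finite_gauss)
  interpret P: prob_space "PiM K (\<lambda>_. gauss)"
    by (rule prob_space_PiM) (rule prob_space_gauss)
  have "(\<integral>\<^sup>+v. F (bombieri p c1 v) (bombieri p c2 v) (bombieri p c3 v) (bombieri p c4 v) \<partial>G) =
     (\<integral>\<^sup>+x. F (x (f 0)) (x (f 1)) (x (f 2)) (x (f 3)) \<partial>PiM I (\<lambda>_. gauss))"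
    unfolding *(2) bf[symmetric] using fI by (subst nn_integral_gauss_rep) (auto intro!: Fm simp: onb_coord[OF *(1)])
  also have "\<dots> = (\<integral>\<^sup>+x. \<integral>\<^sup>+y. \<integral>\<^sup>+z. \<integral>\<^sup>+w. \<integral>\<^sup>+u. F x y z w \<partial>PiM K (\<lambda>_. gauss) \<partial>gauss \<partial>gauss \<partial>gauss \<partial>gauss)"
    unfolding I using finK nK ne
    by (simp add: product_nn_integral_insert_rev Fm measurable_component_singleton)
  also have "\<dots> = (\<integral>\<^sup>+x. \<integral>\<^sup>+y. \<integral>\<^sup>+z. \<integral>\<^sup>+w. F x y z w \<partial>gauss \<partial>gauss \<partial>gauss \<partial>gauss)"
    by (simp add: P.emeasure_space_1)
  finally show ?thesis .
qed

text \<open>The projection to \<open>x\<close>-orthogonal polynomials along \<open>q\<close>, weighted by the density of the \<open>q\<close>-coordinate,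
  is distributed like the orthogonal projection: only the plane spanned by \<open>q\<close> and \<open>x\<close> matters, and there both
  projections are onto the same line.\<close>

lemma gaussian_law_oblique:
  assumes G: "gaussian_law p G" and q: "q \<in> sym_power p" "bombieri p q q = 1"
    and x: "x \<in> sym_power p" "bombieri p x x = 1" and a: "a = bombieri p q x" "a \<noteq> 0"
    and \<Psi>[measurable]: "\<Psi> \<in> borel_measurable poly_sigma"
  shows "(\<integral>\<^sup>+v. ennreal (std_normal_density (bombieri p q (v - (bombieri p x v / a) *\<^sub>R q))) * \<Psi> (v - (bombieri p x v / a) *\<^sub>R q) \<partial>G) =
    ennreal (\<bar>a\<bar> * std_normal_density 0) * (\<integral>\<^sup>+v. \<Psi> (v - bombieri p x v *\<^sub>R x) \<partial>G)"
proof (cases "a\<^sup>2 = 1")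
  case True
  \<comment> \<open>In this case \<open>x\<close> and \<open>q\<close> are unit vectors on one line,
    so both projections agree and the weight is the constant density at 0.\<close>
  have "bombieri p (x - a *\<^sub>R q) (x - a *\<^sub>R q) = 0"
    using True a by (simp add: bombieri_linear q x bombieri_commute[of p x q] power2_eq_square)
  then have "x - a *\<^sub>R q = 0" using x q by (intro bombieri_eq_0_imp) (auto intro: sym_power_closed sym_power_scaleR)
  then have xq: "x = a *\<^sub>R q" by simp
  have aa: "a * a = 1" "\<bar>a\<bar> = 1" using True by (auto simp: power2_eq_square square_eq_1_iff)
  have 1: "v - (bombieri p x v / a) *\<^sub>R q = v - bombieri p x v *\<^sub>R x" for v
    unfolding xq using aa a(2) by (simp add: bombieri_linear mult.left_commute[of a] mult.assoc[symmetric])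
  have 2: "bombieri p q (v - bombieri p x v *\<^sub>R x) = 0" for v
    unfolding xq using aa q by (simp add: bombieri_linear mult.left_commute[of a] mult.assoc[symmetric])
  show ?thesis unfolding 1 2 using sets_gaussian_law[OF G] aa
    by (subst nn_integral_cmult) (auto cong: measurable_cong_sets)
next
  case False
  interpret g: prob_space gauss by (rule prob_space_gauss)
  have qx: "bombieri p x q = a" using a by (simp add: bombieri_commute)
  have "0 \<le> bombieri p (x - a *\<^sub>R q) (x - a *\<^sub>R q)" by (rule bombieri_nonneg)
  also have "\<dots> = 1 - a\<^sup>2"
    by (simp add: bombieri_linear q x qx a(1)[symmetric] power2_eq_square)
  finally have "a\<^sup>2 < 1" using False by simp
  define \<beta> where "\<beta> = sqrt (1 - a\<^sup>2)"
  have \<beta>: "\<beta> > 0" "\<beta>\<^sup>2 = 1 - a\<^sup>2" using \<open>a\<^sup>2 < 1\<close> by (auto simp: \<beta>_def)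
  \<comment> \<open>Completes \<open>q\<close> to an orthonormal basis of the plane spanned by
    \<open>q\<close> and \<open>x\<close>.\<close>
  define x' where "x' = (1 / \<beta>) *\<^sub>R (x - a *\<^sub>R q)"
  have x's: "x' \<in> sym_power p" unfolding x'_def using x q by (intro sym_power_scaleR sym_power_closed) auto
  have x'x': "bombieri p x' x' = 1"
    using \<beta> by (simp add: x'_def bombieri_linear q x qx a(1)[symmetric] power2_eq_square field_simps)
  have x'q: "bombieri p q x' = 0" by (simp add: x'_def bombieri_linear q x a(1)[symmetric])
  have xdec: "x = a *\<^sub>R q + \<beta> *\<^sub>R x'" using \<beta> by (simp add: x'_def)
  define c where "c k = (if k = 0 then q else x')" for k :: nat
  have less2: "k < 2 \<longleftrightarrow> k = 0 \<or> k = (1::nat)" for k by auto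
  obtain I :: "real_poly3 set" and b f where *: "onb p I b" "G = gauss_rep I b" "inj_on f {..<2}" "f ` {..<2::nat} \<subseteq> I" "\<forall>k<2. b (f k) = c k"
  proof -
    have "\<exists>(I :: real_poly3 set) b f. onb p I b \<and> G = gauss_rep I b \<and> inj_on f {..<2::nat} \<and> f ` {..<2} \<subseteq> I \<and> (\<forall>k<2. b (f k) = c k)"
      by (rule gaussian_law_extend[OF G]) (use q x's x'x' x'q in \<open>auto simp: less2 c_def bombieri_commute[of p x' q]\<close>)
    then show thesis using that by metis
  qed
  define i j where "i = f 0" and "j = f 1"
  have ij: "i \<in> I" "j \<in> I" "i \<noteq> j" "b i = q" "b j = x'"
    using *(4,5) inj_on_eq_iff[OF *(3), of 0 1] by (auto simp: i_def j_def c_def)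
  define K where "K = I - {i, j}"
  have I: "I = insert j (insert i K)" and K: "finite K" "i \<notin> K" "j \<notin> K"
    using ij *(1) by (auto simp: K_def onb_def)
  \<comment> \<open>The unit vector perpendicular to \<open>x\<close> in that plane; both
    projections map the plane onto the line through \<open>m\<close>.\<close>
  define m where "m = a *\<^sub>R x' - \<beta> *\<^sub>R q"
  define W where "W w = (\<Sum>k\<in>K. w k *\<^sub>R b k)" for w
  have KI: "K \<subseteq> I" by (auto simp: K_def)
  have ortho: "bombieri p (b k) (b l) = (if k = l then 1 else 0)" if "k \<in> I" "l \<in> I" for k l
    using *(1) that by (auto simp: onb_def)
  have qK: "bombieri p q (b k) = 0" and x'K: "bombieri p x' (b k) = 0" if "k \<in> K" for k
    using ortho[of i k] ortho[of j k] that K KI ij by auto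
  have qW: "bombieri p q (W w) = 0" for w
    unfolding W_def bombieri_sum_right by (simp add: bombieri_linear qK)
  have x'W: "bombieri p x' (W w) = 0" for w
    unfolding W_def bombieri_sum_right by (simp add: bombieri_linear x'K)
  have xW: "bombieri p x (W w) = 0" for w by (simp add: xdec bombieri_linear qW x'W)
  have xx': "bombieri p x x' = \<beta>" by (simp add: xdec bombieri_linear x'x' x'q)
  have Wm[measurable]: "W \<in> measurable (PiM K (\<lambda>_. gauss)) poly_sigma" "W \<in> measurable (PiM K (\<lambda>_. borel)) poly_sigma"
    unfolding W_def by measurable
  have proj1: "v - (bombieri p x v / a) *\<^sub>R q = (t / a) *\<^sub>R m + W w"
    and proj2: "bombieri p q (v - (bombieri p x v / a) *\<^sub>R q) = - (\<beta> * (t / a))" if "v = s *\<^sub>R q + t *\<^sub>R x' + W w" for v s t w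
  proof -
    have "bombieri p x v = s * a + t * \<beta>" unfolding that by (simp add: bombieri_linear xW xx' qx)
    then show "v - (bombieri p x v / a) *\<^sub>R q = (t / a) *\<^sub>R m + W w" unfolding that m_def using a(2)
      by (simp add: add_divide_distrib algebra_simps)
    then show "bombieri p q (v - (bombieri p x v / a) *\<^sub>R q) = - (\<beta> * (t / a))"
      by (simp only:) (simp add: bombieri_linear qW m_def x'q q)
  qed
  have proj3: "bombieri p q ((t / a) *\<^sub>R m + W w) = - (\<beta> * (t / a))" for t w
    using proj2[OF refl, of 0 t w] unfolding proj1[OF refl] .
  have "(\<integral>\<^sup>+v. ennreal (std_normal_density (bombieri p q (v - (bombieri p x v / a) *\<^sub>R q))) * \<Psi> (v - (bombieri p x v / a) *\<^sub>R q) \<partial>G) =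
    (\<integral>\<^sup>+w. \<integral>\<^sup>+s. \<integral>\<^sup>+t. ennreal (std_normal_density (- (\<beta> * (t / a)))) * \<Psi> ((t / a) *\<^sub>R m + W w) \<partial>gauss \<partial>gauss \<partial>PiM K (\<lambda>_. gauss))"
  proof -
    let ?\<Phi> = "\<lambda>v. ennreal (std_normal_density (bombieri p q (v - (bombieri p x v / a) *\<^sub>R q))) * \<Psi> (v - (bombieri p x v / a) *\<^sub>R q)"
    have "(\<integral>\<^sup>+v. ?\<Phi> v \<partial>G) = (\<integral>\<^sup>+w. \<integral>\<^sup>+s. \<integral>\<^sup>+t. ?\<Phi> (s *\<^sub>R b i + t *\<^sub>R b j + (\<Sum>k\<in>K. w k *\<^sub>R b k)) \<partial>gauss \<partial>gauss \<partial>PiM K (\<lambda>_. gauss))"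
      unfolding *(2) I by (rule nn_integral_gauss_rep_insert2[OF K ij(3)]) measurable
    then show ?thesis
      unfolding ij(4,5) W_def[symmetric] proj1[OF refl] proj3 .
  qed
  also have "\<dots> = (\<integral>\<^sup>+w. \<integral>\<^sup>+t. ennreal (std_normal_density (- (\<beta> * (t / a)))) * \<Psi> ((t / a) *\<^sub>R m + W w) \<partial>gauss \<partial>PiM K (\<lambda>_. gauss))"
    by (simp only: nn_integral_gauss_const)
  also have "\<dots> = (\<integral>\<^sup>+w. ennreal (\<bar>a\<bar> * std_normal_density 0) * (\<integral>\<^sup>+t. \<Psi> (t *\<^sub>R m + W w) \<partial>gauss) \<partial>PiM K (\<lambda>_. gauss))"
  proof (rule nn_integral_cong)
    fix w
    \<comment> \<open>After scaling t by a, the density of the t-coordinate and the weight have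
      exponents that add up to t^2 / 2, because a^2 + \<beta>^2 = 1: the product is a standard
      normal density along \<open>m\<close> times the constant density at 0.\<close>
    have dens: "std_normal_density (a * t) * std_normal_density (- (\<beta> * t)) = std_normal_density 0 * std_normal_density t" for t
    proof -
      have "(a * t)\<^sup>2 + (- (\<beta> * t))\<^sup>2 = (a\<^sup>2 + \<beta>\<^sup>2) * t\<^sup>2" by (simp add: power_mult_distrib distrib_right)
      then show ?thesis unfolding std_normal_density_mult by (simp add: \<beta>(2))
    qed
    have "(\<integral>\<^sup>+t. ennreal (std_normal_density (- (\<beta> * (t / a)))) * \<Psi> ((t / a) *\<^sub>R m + W w) \<partial>gauss) =
      (\<integral>\<^sup>+t. ennreal (std_normal_density t) * (ennreal (std_normal_density (- (\<beta> * (t / a)))) * \<Psi> ((t / a) *\<^sub>R m + W w)) \<partial>lborel)"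
      by (rule nn_integral_gauss) measurable
    also have "\<dots> = ennreal \<bar>a\<bar> * (\<integral>\<^sup>+t. ennreal (std_normal_density (a * t)) * (ennreal (std_normal_density (- (\<beta> * t))) * \<Psi> (t *\<^sub>R m + W w)) \<partial>lborel)"
      using a(2) by (subst nn_integral_real_affine[where c=a and t=0]) (simp_all, measurable)
    also have "\<dots> = ennreal \<bar>a\<bar> * (\<integral>\<^sup>+t. ennreal (std_normal_density 0) * (ennreal (std_normal_density t) * \<Psi> (t *\<^sub>R m + W w)) \<partial>lborel)"
    proof -
      have "ennreal (std_normal_density (a * t)) * (ennreal (std_normal_density (- (\<beta> * t))) * z) = ennreal (std_normal_density 0) * (ennreal (std_normal_density t) * z)" for t z
        by (simp only: mult.assoc[symmetric] ennreal_mult[symmetric, OF normal_density_nonneg normal_density_nonneg] dens)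
      then show ?thesis by simp
    qed
    also have "\<dots> = ennreal \<bar>a\<bar> * (ennreal (std_normal_density 0) * (\<integral>\<^sup>+t. ennreal (std_normal_density t) * \<Psi> (t *\<^sub>R m + W w) \<partial>lborel))"
      by (intro arg_cong[where f="\<lambda>u. _ * u"] nn_integral_cmult) measurable
    also have "\<dots> = ennreal (\<bar>a\<bar> * std_normal_density 0) * (\<integral>\<^sup>+t. \<Psi> (t *\<^sub>R m + W w) \<partial>gauss)"
      by (subst nn_integral_gauss) (measurable, simp add: ennreal_mult mult.assoc)
    finally show "(\<integral>\<^sup>+t. ennreal (std_normal_density (- (\<beta> * (t / a)))) * \<Psi> ((t / a) *\<^sub>R m + W w) \<partial>gauss) = \<dots>" .
  qed
  also have "\<dots> = ennreal (\<bar>a\<bar> * std_normal_density 0) * (\<integral>\<^sup>+w. \<integral>\<^sup>+t. \<Psi> (t *\<^sub>R m + W w) \<partial>gauss \<partial>PiM K (\<lambda>_. gauss))"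
    by (rule nn_integral_cmult) measurable
  also have "(\<integral>\<^sup>+w. \<integral>\<^sup>+t. \<Psi> (t *\<^sub>R m + W w) \<partial>gauss \<partial>PiM K (\<lambda>_. gauss)) = (\<integral>\<^sup>+v. \<Psi> (v - bombieri p x v *\<^sub>R x) \<partial>G)"
  proof -
    let ?b = "b(i := a *\<^sub>R b i + \<beta> *\<^sub>R b j, j := a *\<^sub>R b j - \<beta> *\<^sub>R b i)"
    have G': "G = gauss_rep I ?b"
      unfolding *(2) using ij *(1) \<beta> by (intro gauss_rep_rotate[symmetric]) (auto simp: onb_def)
    have bij: "?b i = x" "?b j = m" using ij xdec by (auto simp: m_def)
    have WW: "(\<Sum>k\<in>K. w k *\<^sub>R ?b k) = W w" for w unfolding W_def using K by (auto intro!: sum.cong)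
    have xm: "bombieri p x m = 0" by (simp add: m_def bombieri_linear xx' qx)
    have proj: "(s *\<^sub>R x + t *\<^sub>R m + W w) - bombieri p x (s *\<^sub>R x + t *\<^sub>R m + W w) *\<^sub>R x = t *\<^sub>R m + W w" for s t w
      by (simp add: bombieri_linear x xm xW)
    have "(\<integral>\<^sup>+v. \<Psi> (v - bombieri p x v *\<^sub>R x) \<partial>G) =
      (\<integral>\<^sup>+w. \<integral>\<^sup>+s. \<integral>\<^sup>+t. \<Psi> (t *\<^sub>R m + W w) \<partial>gauss \<partial>gauss \<partial>PiM K (\<lambda>_. gauss))"
    proof -
      have "(\<integral>\<^sup>+v. \<Psi> (v - bombieri p x v *\<^sub>R x) \<partial>G) = (\<integral>\<^sup>+w. \<integral>\<^sup>+s. \<integral>\<^sup>+t.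
        \<Psi> ((s *\<^sub>R ?b i + t *\<^sub>R ?b j + (\<Sum>k\<in>K. w k *\<^sub>R ?b k)) - bombieri p x (s *\<^sub>R ?b i + t *\<^sub>R ?b j + (\<Sum>k\<in>K. w k *\<^sub>R ?b k)) *\<^sub>R x) \<partial>gauss \<partial>gauss \<partial>PiM K (\<lambda>_. gauss))"
        unfolding G' unfolding I by (rule nn_integral_gauss_rep_insert2[OF K ij(3), where \<Psi>="\<lambda>v. \<Psi> (v - bombieri p x v *\<^sub>R x)"]) measurable
      then show ?thesis unfolding bij WW proj .
    qed
    then show ?thesis by (simp only: nn_integral_gauss_const)
  qed
  finally show ?thesis .
qed

text \<open>Independence of the coordinates is a product law, and the expansion in the given basis
  transports it to the polynomials. From here on only the law of \<open>v\<close> matters.\<close>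

lemma standard_gaussian_law:
  assumes M: "prob_space M" and v: "standard_gaussian p M v"
  shows "v \<in> measurable M poly_sigma" "gaussian_law p (distr M poly_sigma v)"
proof -
  interpret prob_space M by fact
  obtain B where B: "bombieri_orthonormal_basis p B" "indep_vars (\<lambda>_. borel) (\<lambda>b \<omega>. bombieri p b (v \<omega>)) B"
     "\<And>b. b \<in> B \<Longrightarrow> distributed M lborel (\<lambda>\<omega>. bombieri p b (v \<omega>)) (\<lambda>x. ennreal (std_normal_density x))"
    and vs: "\<And>\<omega>. \<omega> \<in> space M \<Longrightarrow> v \<omega> \<in> sym_power p"
    using v by (auto simp: standard_gaussian_def)
  have ortho: "bombieri p b c = (if b = c then 1 else 0)" if "b \<in> B" "c \<in> B" for b c
    using B(1) that by (auto simp: bombieri_orthonormal_basis_def)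
  have span: "span B = sym_power p" using B(1) by (auto simp: bombieri_orthonormal_basis_def)
  have BS: "B \<subseteq> sym_power p" using span span_superset by blast
  have indep: "independent B"
    unfolding independent_explicit_finite_subsets
  proof (intro allI impI ballI)
    fix A u w assume A: "A \<subseteq> B" "finite A" "(\<Sum>w\<in>A. u w *\<^sub>R w) = 0" "w \<in> A"
    have "0 = bombieri p w (\<Sum>w\<in>A. u w *\<^sub>R w)" using A by simp
    also have "\<dots> = (\<Sum>x\<in>A. if x = w then u x else 0)"
      unfolding bombieri_sum_right using A by (intro sum.cong) (auto simp: bombieri_linear ortho subset_iff)
    also have "\<dots> = u w" using A by simp
    finally show "u w = 0" by simp
  qed
  \<comment> \<open>An independent set inside the span of the finitely many monomials of degree
    \<open>p\<close> is finite.\<close>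
  have finB: "finite B"
  proof -
    have "sym_power p \<subseteq> span ((\<lambda>\<alpha>. Poly_Mapping.single \<alpha> 1) ` exponents p)"
    proof
      fix f assume f: "f \<in> sym_power p"
      have "f = (\<Sum>\<alpha>\<in>exponents p. Poly_Mapping.lookup f \<alpha> *\<^sub>R Poly_Mapping.single \<alpha> 1)"
      proof (rule poly_mapping_eqI)
        fix \<beta>
        show "Poly_Mapping.lookup f \<beta> = Poly_Mapping.lookup (\<Sum>\<alpha>\<in>exponents p. Poly_Mapping.lookup f \<alpha> *\<^sub>R Poly_Mapping.single \<alpha> 1) \<beta>"
          using f finite_exponents by (auto simp: lookup_sum lookup_scaleR lookup_single when_def sym_power_def in_keys_iff if_distrib cong: if_cong)
      qed
      also have "\<dots> \<in> span ((\<lambda>\<alpha>. Poly_Mapping.single \<alpha> 1) ` exponents p)"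
        by (intro span_sum span_scale span_base imageI)
      finally show "f \<in> span ((\<lambda>\<alpha>. Poly_Mapping.single \<alpha> 1) ` exponents p)" .
    qed
    then show ?thesis using indep BS finite_exponents independent_span_bound[of "(\<lambda>\<alpha>. Poly_Mapping.single \<alpha> 1) ` exponents p" B]
      by auto
  qed
  have expand: "(\<Sum>b\<in>B. bombieri p b y *\<^sub>R b) = y" if "y \<in> sym_power p" for y
  proof -
    have "y \<in> span B" using that span by simp
    then obtain u where u: "y = (\<Sum>b\<in>B. u b *\<^sub>R b)" using finB by (auto simp: span_finite)
    have "bombieri p b y = u b" if "b \<in> B" for b
    proof -
      have "bombieri p b y = (\<Sum>c\<in>B. if c = b then u c else 0)"
        unfolding u bombieri_sum_right using that by (intro sum.cong) (auto simp: bombieri_linear ortho)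
      then show ?thesis using that finB by simp
    qed
    then show ?thesis unfolding u by (intro sum.cong) (auto simp: u)
  qed
  have onb: "onb p B (\<lambda>b. b)" unfolding onb_def using finB BS ortho expand by auto
  \<comment> \<open>The characterization of independence by the joint law is applied to a nonempty
    family; \<open>sym_power p\<close> contains a nonzero pure power.\<close>
  have Bne: "B \<noteq> {}"
  proof
    assume "B = {}"
    then have "sym_power p = {0}" using span by simp
    moreover have "linear_form (axis 1 1) ^ p \<noteq> 0" by (rule linear_form_power_neq_0) (simp add: axis_eq_0_iff)
    ultimately show False using linear_form_power_sym_power[of "axis 1 1" p] by (metis singletonD)
  qed
  have coordm: "(\<lambda>\<omega>. bombieri p b (v \<omega>)) \<in> borel_measurable M" if "b \<in> B" for b
    using B(3)[OF that] by (simp add: distributed_def)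
  let ?X = "\<lambda>\<omega>. \<lambda>b\<in>B. bombieri p b (v \<omega>)"
  have Xm: "?X \<in> measurable M (PiM B (\<lambda>_. borel))"
    using coordm by (intro measurable_restrict) auto
  have vX: "v \<omega> = (\<Sum>b\<in>B. ?X \<omega> b *\<^sub>R b)" if "\<omega> \<in> space M" for \<omega>
    using expand[OF vs[OF that]] by (simp cong: sum.cong)
  have sm: "(\<lambda>x. \<Sum>b\<in>B. x b *\<^sub>R b) \<in> measurable (PiM B (\<lambda>_. borel)) poly_sigma" by measurable
  have "(\<lambda>\<omega>. \<Sum>b\<in>B. ?X \<omega> b *\<^sub>R b) \<in> measurable M poly_sigma"
    using measurable_compose[OF Xm sm] .
  then show vm: "v \<in> measurable M poly_sigma" using vX by (simp cong: measurable_cong)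
  have "distr M poly_sigma v = distr M poly_sigma (\<lambda>\<omega>. \<Sum>b\<in>B. ?X \<omega> b *\<^sub>R b)"
    using vX by (intro distr_cong) auto
  also have "\<dots> = distr (distr M (PiM B (\<lambda>_. borel)) ?X) poly_sigma (\<lambda>x. \<Sum>b\<in>B. x b *\<^sub>R b)"
    by (subst distr_distr[OF sm Xm]) (simp add: comp_def)
  also have "distr M (PiM B (\<lambda>_. borel)) ?X = PiM B (\<lambda>b. distr M borel (\<lambda>\<omega>. bombieri p b (v \<omega>)))"
    using coordm B(2) Bne by (subst indep_vars_iff_distr_eq_PiM'[symmetric]) auto
  also have "\<dots> = PiM B (\<lambda>_. gauss)"
  proof (rule PiM_cong[OF refl])
    fix b assume "b \<in> B"
    from B(3)[OF this] have "distr M lborel (\<lambda>\<omega>. bombieri p b (v \<omega>)) = gauss" by (simp add: distributed_def)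
    moreover have "distr M lborel (\<lambda>\<omega>. bombieri p b (v \<omega>)) = distr M borel (\<lambda>\<omega>. bombieri p b (v \<omega>))"
      by (intro distr_cong) auto
    ultimately show "distr M borel (\<lambda>\<omega>. bombieri p b (v \<omega>)) = gauss" by simp
  qed
  finally show "gaussian_law p (distr M poly_sigma v)"
    unfolding gaussian_law_def using onb by (auto simp: gauss_rep_def)
qed

section \<open>Measurability of counting functions\<close>

text \<open>A set has at least n points iff n disjoint balls of a countable family meet it. Counting
  thus becomes a countable supremum of finite sums of hitting indicators, whose measurability can be
  proved ball by ball.\<close>

lemma emeasure_count_space_eq_SUP_cballs:
  fixes S :: "'a::euclidean_space set"
  assumes D: "\<And>X :: 'a set. open X \<Longrightarrow> X \<noteq> {} \<Longrightarrow> \<exists>d\<in>D. d \<in> X"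
  defines "BB \<equiv> (\<lambda>(d, k::nat). cball d (1 / Suc k)) ` (D \<times> UNIV)"
  shows "emeasure (count_space UNIV) S =
    (SUP F\<in>{F. finite F \<and> F \<subseteq> BB \<and> disjoint F}. \<Sum>K\<in>F. if S \<inter> K \<noteq> {} then 1 else 0)" (is "_ = (SUP F\<in>?FF. ?h F)")
proof (rule antisym)
  have fin_le: "of_nat (card P) \<le> (SUP F\<in>?FF. ?h F)" if P: "finite P" "P \<subseteq> S" for P
  proof -
    obtain \<delta> where \<delta>: "\<delta> > 0" "\<And>x y. x \<in> P \<Longrightarrow> y \<in> P \<Longrightarrow> x \<noteq> y \<Longrightarrow> \<delta> \<le> dist x y"
    proof (cases "\<exists>x\<in>P. \<exists>y\<in>P. x \<noteq> y")
      case True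
      let ?E = "(\<lambda>(x, y). dist x y) ` {(x, y). x \<in> P \<and> y \<in> P \<and> x \<noteq> y}"
      have "finite {(x, y). x \<in> P \<and> y \<in> P \<and> x \<noteq> y}"
        by (rule finite_subset[of _ "P \<times> P"]) (use P in auto)
      then have fE: "finite ?E" by (rule finite_imageI)
      have nE: "?E \<noteq> {}" using True by auto
      show ?thesis
      proof (rule that[of "Min ?E"])
        show "Min ?E > 0" using fE nE by (subst Min_gr_iff) auto
        show "Min ?E \<le> dist x y" if "x \<in> P" "y \<in> P" "x \<noteq> y" for x y
          using fE that by (intro Min_le) auto
      qed
    next
      case False
      then show ?thesis by (intro that[of 1]) auto
    qed
    \<comment> \<open>Each ball has its centre within one radius of its point, so two points of
      meeting balls are at distance at most four radii, which is less than \<delta>.\<close>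
    obtain k where k: "1 / real (Suc k) < \<delta> / 4" using \<delta>(1) nat_approx_posE[of "\<delta> / 4"] by auto
    have "\<exists>d\<in>D. dist z d < 1 / real (Suc k)" for z
      using D[of "ball z (1 / real (Suc k))"] by auto
    then obtain c where c: "\<And>z. c z \<in> D" "\<And>z. dist z (c z) < 1 / real (Suc k)" by metis
    define K where "K z = cball (c z) (1 / real (Suc k))" for z
    have zK: "z \<in> K z" for z using c(2)[of z] by (simp add: K_def dist_commute)
    have disj: "K x \<inter> K y = {}" if "x \<in> P" "y \<in> P" "x \<noteq> y" for x y
    proof (rule ccontr)
      assume "K x \<inter> K y \<noteq> {}"
      then obtain w where "w \<in> K x" "w \<in> K y" by blast
      then have w: "dist (c x) w \<le> 1 / real (Suc k)" "dist (c y) w \<le> 1 / real (Suc k)"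
        unfolding K_def mem_cball by auto
      have "dist x y \<le> dist x (c x) + dist (c x) w + (dist y (c y) + dist (c y) w)"
        using dist_triangle[of x w "c x"] dist_triangle[of y w "c y"] dist_triangle2[of x y w] by linarith
      then have "dist x y < \<delta>" using c(2)[of x] c(2)[of y] k w by linarith
      then show False using \<delta>(2)[OF that] by simp
    qed
    have inj: "inj_on K P" using disj zK by (auto simp: inj_on_def) (metis IntI empty_iff)
    have "?h (K ` P) = (\<Sum>z\<in>P. 1)"
      unfolding sum.reindex[OF inj] comp_def using P zK by (intro sum.cong) auto
    then have "of_nat (card P) = ?h (K ` P)" by simp
    also have "\<dots> \<le> (SUP F\<in>?FF. ?h F)"
    proof (rule SUP_upper)
      have "disjoint (K ` P)" using disj by (auto simp: disjoint_def)
      moreover have "K ` P \<subseteq> BB" using c(1) by (auto simp: BB_def K_def)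
      ultimately show "K ` P \<in> ?FF" using P by auto
    qed
    finally show ?thesis .
  qed
  show "emeasure (count_space UNIV) S \<le> (SUP F\<in>?FF. ?h F)"
  proof (cases "finite S")
    case True
    then show ?thesis using fin_le[of S] by simp
  next
    case False
    have "of_nat n \<le> (SUP F\<in>?FF. ?h F)" for n
      using infinite_arbitrarily_large[OF False, of n] fin_le by auto
    then have "(SUP n. of_nat n :: ennreal) \<le> (SUP F\<in>?FF. ?h F)" by (rule SUP_least)
    then show ?thesis unfolding ennreal_SUP_of_nat_eq_top by (rule order_trans[OF top_greatest])
  qed
  show "(SUP F\<in>?FF. ?h F) \<le> emeasure (count_space UNIV) S"
  proof (rule SUP_least)
    fix F assume F: "F \<in> ?FF"
    define H where "H = {K \<in> F. S \<inter> K \<noteq> {}}"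
    have H: "finite H" "disjoint H" using F by (auto simp: H_def disjoint_def)
    have "?h F = of_nat (card H)"
      using F unfolding H_def by (simp add: sum.If_cases Int_def)
    have "\<forall>K\<in>H. \<exists>x. x \<in> S \<inter> K" by (auto simp: H_def)
    then obtain g where g: "\<And>K. K \<in> H \<Longrightarrow> g K \<in> S \<inter> K" using bchoice[of H "\<lambda>K x. x \<in> S \<inter> K"] by blast
    have "inj_on g H"
    proof (rule inj_onI)
      fix K L assume "K \<in> H" "L \<in> H" "g K = g L"
      then have "g K \<in> K \<inter> L" using g by (metis IntD2 IntI)
      then show "K = L" using H(2) \<open>K \<in> H\<close> \<open>L \<in> H\<close> by (auto simp: disjoint_def)
    qed
    then have "of_nat (card H) = emeasure (count_space UNIV) (g ` H)"
      using H(1) by (simp add: card_image)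
    also have "\<dots> \<le> emeasure (count_space UNIV) S"
      using g by (intro emeasure_mono) auto
    finally show "?h F \<le> emeasure (count_space UNIV) S" using \<open>?h F = _\<close> by simp
  qed
qed

text \<open>By compactness a zero exists iff the infimum over the ball is 0, and this infimum may be
  taken over a countable dense set. The dense points are taken from the open ball, since density
  only provides points in open sets; for \<open>r > 0\<close> its closure is the closed
  ball.\<close>

lemma measurable_zero_in_cball:
  fixes \<Phi> :: "'w \<Rightarrow> 'a::euclidean_space \<Rightarrow> real"
  assumes cont: "\<And>\<omega>. continuous_on UNIV (\<Phi> \<omega>)" and nonneg: "\<And>\<omega> z. \<Phi> \<omega> z \<ge> 0"
    and meas[measurable]: "\<And>z. (\<lambda>\<omega>. \<Phi> \<omega> z) \<in> borel_measurable N"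
    and r: "r > 0"
  shows "Measurable.pred N (\<lambda>\<omega>. \<exists>z\<in>cball c r. \<Phi> \<omega> z = 0)"
proof -
  obtain D :: "'a set" where D: "countable D" "\<And>X. open X \<Longrightarrow> X \<noteq> {} \<Longrightarrow> \<exists>d\<in>D. d \<in> X"
    using countable_dense_setE by metis
  have "(\<exists>z\<in>cball c r. \<Phi> \<omega> z = 0) \<longleftrightarrow> (\<forall>k::nat. \<exists>d\<in>D \<inter> ball c r. \<Phi> \<omega> d < 1 / real (Suc k))" for \<omega>
  proof (intro iffI allI)
    fix k :: nat
    assume "\<exists>z\<in>cball c r. \<Phi> \<omega> z = 0"
    then obtain z where z: "z \<in> cball c r" "\<Phi> \<omega> z = 0" by auto
    let ?O = "{w. \<Phi> \<omega> w < 1 / real (Suc k)}"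
    have O: "open ?O" using cont by (intro open_Collect_less) (auto simp: continuous_on_const)
    have "z \<in> ?O" using z by simp
    moreover have "z \<in> closure (ball c r)" using z r by (simp add: closure_ball)
    ultimately have "?O \<inter> ball c r \<noteq> {}" using O by (metis closure_iff_nhds_not_empty inf.commute subset_refl)
    then obtain d where "d \<in> D" "d \<in> ?O \<inter> ball c r" using D(2)[of "?O \<inter> ball c r"] O by blast
    then show "\<exists>d\<in>D \<inter> ball c r. \<Phi> \<omega> d < 1 / real (Suc k)" by auto
  next
    assume *: "\<forall>k::nat. \<exists>d\<in>D \<inter> ball c r. \<Phi> \<omega> d < 1 / real (Suc k)"
    have "continuous_on (cball c r) (\<Phi> \<omega>)" using cont continuous_on_subset by blast
    then obtain z where z: "z \<in> cball c r" "\<And>y. y \<in> cball c r \<Longrightarrow> \<Phi> \<omega> z \<le> \<Phi> \<omega> y"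
      using continuous_attains_inf[of "cball c r" "\<Phi> \<omega>"] r by auto
    have "\<Phi> \<omega> z = 0"
    proof (rule ccontr)
      assume "\<Phi> \<omega> z \<noteq> 0"
      then have "\<Phi> \<omega> z > 0" using nonneg[of \<omega> z] by simp
      then obtain k where "1 / real (Suc k) < \<Phi> \<omega> z" using nat_approx_posE by blast
      moreover obtain d where "d \<in> ball c r" "\<Phi> \<omega> d < 1 / real (Suc k)" using * by blast
      ultimately show False using z(2)[of d] by auto
    qed
    then show "\<exists>z\<in>cball c r. \<Phi> \<omega> z = 0" using z by blast
  qed
  moreover have "countable (D \<inter> ball c r)" using D(1) by auto
  ultimately show ?thesis by simp
qed

text \<open>The union over n leaves room for conditions of the form f \<noteq> 0: they are encoded
  as |f| \<ge> 1 / (n + 1) for some n, each of which is the zero set of a continuous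
  function.\<close>

lemma borel_measurable_card_zeros:
  fixes \<Phi> :: "nat \<Rightarrow> 'w \<Rightarrow> 'a::euclidean_space \<Rightarrow> real"
  assumes cont: "\<And>n \<omega>. continuous_on UNIV (\<Phi> n \<omega>)" and nonneg: "\<And>n \<omega> z. \<Phi> n \<omega> z \<ge> 0"
    and meas: "\<And>n z. (\<lambda>\<omega>. \<Phi> n \<omega> z) \<in> borel_measurable N"
  shows "(\<lambda>\<omega>. emeasure (count_space UNIV) {z. \<exists>n. \<Phi> n \<omega> z = 0}) \<in> borel_measurable N"
proof -
  obtain D :: "'a set" where D: "countable D" "\<And>X. open X \<Longrightarrow> X \<noteq> {} \<Longrightarrow> \<exists>d\<in>D. d \<in> X"
    using countable_dense_setE by metis
  define BB where "BB = (\<lambda>(d, k::nat). cball d (1 / Suc k)) ` (D \<times> UNIV)"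
  let ?FF = "{F. finite F \<and> F \<subseteq> BB \<and> disjoint F}"
  have "countable BB" unfolding BB_def using D(1) by auto
  then have "countable {F. finite F \<and> F \<subseteq> BB}" by (rule countable_Collect_finite_subset)
  then have cFF: "countable ?FF" by (rule countable_subset[rotated]) auto
  have "(\<lambda>\<omega>. SUP F\<in>?FF. \<Sum>K\<in>F. if {z. \<exists>n. \<Phi> n \<omega> z = 0} \<inter> K \<noteq> {} then 1 else 0 :: ennreal) \<in> borel_measurable N"
  proof (rule borel_measurable_SUP[OF cFF], rule borel_measurable_sum)
    fix F K assume "F \<in> ?FF" "K \<in> F"
    then obtain d k where K: "K = cball d (1 / Suc k)" by (auto simp: BB_def)
    have "Measurable.pred N (\<lambda>\<omega>. \<exists>n. \<exists>z\<in>K. \<Phi> n \<omega> z = 0)"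
      unfolding K by (intro pred_intros_countable measurable_zero_in_cball cont nonneg meas) auto
    moreover have "{z. \<exists>n. \<Phi> n \<omega> z = 0} \<inter> K \<noteq> {} \<longleftrightarrow> (\<exists>n. \<exists>z\<in>K. \<Phi> n \<omega> z = 0)" for \<omega> by auto
    ultimately show "(\<lambda>\<omega>. if {z. \<exists>n. \<Phi> n \<omega> z = 0} \<inter> K \<noteq> {} then 1 else 0 :: ennreal) \<in> borel_measurable N"
      by simp
  qed
  moreover have "emeasure (count_space UNIV) {z. \<exists>n. \<Phi> n \<omega> z = 0} =
    (SUP F\<in>?FF. \<Sum>K\<in>F. if {z. \<exists>n. \<Phi> n \<omega> z = 0} \<inter> K \<noteq> {} then 1 else 0)" for \<omega>
    unfolding BB_def by (rule emeasure_count_space_eq_SUP_cballs) (rule D(2))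
  ultimately show ?thesis by (simp only:)
qed

section \<open>Critical points as directions\<close>

lemma tangent_direction:
  assumes u: "u \<noteq> 0" and s: "s = 1 \<or> s = (-1::real)"
  shows "(real (Suc m) * s) *\<^sub>R (linear_form u ^ m * linear_form a) \<in> tangent_space (pure_powers (Suc m)) (s *\<^sub>R linear_form u ^ Suc m)"
  unfolding tangent_space_def mem_Collect_eq
proof (intro exI conjI ballI allI)
  \<comment> \<open>Small enough to keep \<open>u + t *\<^sub>R a\<close> away from 0; the summand 1
    covers the case \<open>a = 0\<close>.\<close>
  define \<epsilon> where "\<epsilon> = norm u / (norm a + 1)"
  define \<gamma> where "\<gamma> t = s *\<^sub>R linear_form (u + t *\<^sub>R a) ^ Suc m" for t :: real
  show "\<epsilon> > 0" using u by (auto simp: \<epsilon>_def intro!: divide_pos_pos add_nonneg_pos)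
  show "\<gamma> 0 = s *\<^sub>R linear_form u ^ Suc m" by (simp add: \<gamma>_def)
  fix t assume t: "t \<in> {-\<epsilon><..<\<epsilon>}"
  have "u + t *\<^sub>R a \<noteq> 0"
  proof
    assume "u + t *\<^sub>R a = 0"
    then have "norm u = \<bar>t\<bar> * norm a" by (metis add_eq_0_iff2 norm_minus_cancel norm_scaleR)
    also have "\<dots> \<le> \<bar>t\<bar> * (norm a + 1)" by (intro mult_left_mono) auto
    also have "\<dots> < \<epsilon> * (norm a + 1)" using t by (intro mult_strict_right_mono) (auto intro: add_nonneg_pos)
    also have "\<dots> = norm u" unfolding \<epsilon>_def using add_nonneg_pos[of "norm a" 1] by simp
    finally show False by simp
  qed
  then have nz: "linear_form (u + t *\<^sub>R a) ^ Suc m \<noteq> 0" by (rule linear_form_power_neq_0)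
  show "\<gamma> t \<in> pure_powers (Suc m)"
    unfolding pure_powers_def \<gamma>_def using s nz by auto
next
  define \<gamma> where "\<gamma> t = s *\<^sub>R linear_form (u + t *\<^sub>R a) ^ Suc m" for t :: real
  fix \<alpha>
  let ?D = "\<lambda>t. s * (real (Suc m) * Poly_Mapping.lookup (linear_form (u + t *\<^sub>R a) ^ m * linear_form a) \<alpha>)"
  have der: "((\<lambda>t. Poly_Mapping.lookup (linear_form (u + t *\<^sub>R a) ^ k * c) \<alpha>) has_real_derivative
      real k * Poly_Mapping.lookup (linear_form (u + t *\<^sub>R a) ^ (k - 1) * linear_form a * c) \<alpha>) (at t)" for k c t
  proof -
    have "((\<lambda>t. u + t *\<^sub>R a) has_derivative (\<lambda>h. h *\<^sub>R a)) (at t)"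
      by (auto intro!: derivative_eq_intros)
    from has_derivative_compose[OF this has_derivative_lookup_power_mult]
    show ?thesis unfolding has_field_derivative_def
      by (rule has_derivative_eq_rhs)
        (simp add: fun_eq_iff linear_form_scaleR poly_scaleR_mult_left poly_scaleR_mult_right lookup_scaleR)
  qed
  have d1: "((\<lambda>t. Poly_Mapping.lookup (\<gamma> t) \<alpha>) has_real_derivative ?D t) (at t)" for t
    using DERIV_cmult[OF der[of "Suc m" 1 t], of s] unfolding \<gamma>_def by (simp add: lookup_scaleR)
  show "((\<lambda>t. Poly_Mapping.lookup (\<gamma> t) \<alpha>) has_real_derivative
     Poly_Mapping.lookup ((real (Suc m) * s) *\<^sub>R (linear_form u ^ m * linear_form a)) \<alpha>) (at 0)"
    using d1[of 0] by (simp add: lookup_scaleR ac_simps)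
  have "continuous_on UNIV ?D"
    by (intro continuous_intros continuous_at_imp_continuous_on ballI DERIV_isCont[OF der])
  then show "(\<lambda>t. Poly_Mapping.lookup (\<gamma> t) \<alpha>) C1_differentiable_on {- (norm u / (norm a + 1))<..<norm u / (norm a + 1)}"
    unfolding C1_differentiable_on_def using d1
    by (intro exI[of _ ?D]) (auto simp: has_real_derivative_iff_has_vector_derivative[symmetric] intro: continuous_on_subset)
qed

text \<open>A curve in X consists of signed powers whose roots and signs need not depend
  continuously on time. Pairing the curve with the powers of a basis vector \<open>e\<close> with
  \<open>u $ i \<noteq> 0\<close>, and with products of these with other basis vectors, recovers a
  differentiable scalar \<open>c\<close> and a differentiable vector \<open>S\<close> with
  \<open>\<gamma> = c S^p\<close> near time 0; the product rule then gives the form of the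
  velocity.\<close>

lemma tangent_space_subset:
  assumes u: "u \<noteq> 0" and w: "w \<in> tangent_space (pure_powers (Suc m)) (s *\<^sub>R linear_form u ^ Suc m)" and s: "s \<noteq> 0"
  shows "\<exists>a. w = linear_form u ^ m * linear_form a"
proof -
  obtain \<gamma> \<epsilon> where \<epsilon>: "\<epsilon> > 0" and \<gamma>X: "\<And>t. t \<in> {-\<epsilon><..<\<epsilon>} \<Longrightarrow> \<gamma> t \<in> pure_powers (Suc m)"
    and \<gamma>0: "\<gamma> 0 = s *\<^sub>R linear_form u ^ Suc m"
    and der: "\<And>\<alpha>. ((\<lambda>t. Poly_Mapping.lookup (\<gamma> t) \<alpha>) has_real_derivative Poly_Mapping.lookup w \<alpha>) (at 0)"
    using w unfolding tangent_space_def by blast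
  obtain i where i: "u $ i \<noteq> 0" using u by (auto simp: vec_eq_iff)
  let ?e = "\<lambda>j. axis j (1::real) :: real^3"
  define c where "c t = bombieri (Suc m) (\<gamma> t) (linear_form (?e i) ^ Suc m)" for t
  define d where "d j t = bombieri (Suc m) (\<gamma> t) (linear_form (?e i) ^ m * linear_form (?e j))" for j t
  have dbomb: "((\<lambda>t. bombieri (Suc m) (\<gamma> t) g) has_real_derivative bombieri (Suc m) w g) (at 0)" for g
    unfolding bombieri_def
    by (intro DERIV_sum DERIV_cmult_right DERIV_cmult der)
  have cval: "bombieri (Suc m) (r *\<^sub>R linear_form y ^ Suc m) (linear_form (?e i) ^ Suc m) = r * (y $ i) ^ Suc m" for r y
    by (simp only: bombieri_scaleR_left bombieri_powers) (simp add: inner_axis)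
  have dval: "bombieri (Suc m) (r *\<^sub>R linear_form y ^ Suc m) (linear_form (?e i) ^ m * linear_form (?e j)) = r * ((y $ i) ^ m * y $ j)" for r y j
    by (simp only: bombieri_scaleR_left bombieri_commute[of _ "linear_form y ^ Suc m"] bombieri_power_mult_power) (simp add: inner_axis inner_commute)
  have c0: "c 0 \<noteq> 0" using i s by (simp only: c_def \<gamma>0 cval) simp
  define S where "S t = (\<chi> j. d j t / c t)" for t
  have rep: "\<gamma> t = c t *\<^sub>R linear_form (S t) ^ Suc m" if t: "t \<in> {-\<epsilon><..<\<epsilon>}" "c t \<noteq> 0" for t
  proof -
    \<comment> \<open>The choice of \<open>y\<close> at each time is arbitrary, but it enters only
      through the ratios \<open>y $ j / y $ i\<close>, which the curve determines.\<close>
    obtain y where "\<gamma> t = linear_form y ^ Suc m \<or> \<gamma> t = - (linear_form y ^ Suc m)"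
      using \<gamma>X[OF t(1)] by (auto simp: pure_powers_def)
    then obtain r :: real where y: "\<gamma> t = r *\<^sub>R linear_form y ^ Suc m" by (metis scaleR_minus1_left scaleR_one)
    have ct: "c t = r * (y $ i) ^ Suc m" and dt: "d j t = r * ((y $ i) ^ m * y $ j)" for j
      unfolding c_def d_def y by (rule cval dval)+
    have nz: "r \<noteq> 0" "y $ i \<noteq> 0" using t(2) ct by auto
    have "S t = (1 / y $ i) *\<^sub>R y" unfolding S_def ct dt using nz by (simp add: vec_eq_iff field_simps)
    then have "c t *\<^sub>R linear_form (S t) ^ Suc m = (r * (y $ i) ^ Suc m * (1 / y $ i) ^ Suc m) *\<^sub>R linear_form y ^ Suc m"
      by (simp only: linear_form_scaleR poly_scaleR_power ct scaleR_scaleR)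
    also have "r * (y $ i) ^ Suc m * (1 / y $ i) ^ Suc m = r"
      using nz by (simp only: mult.assoc power_mult_distrib[symmetric]) simp
    finally show ?thesis using y by simp
  qed
  define c' where "c' = bombieri (Suc m) w (linear_form (?e i) ^ Suc m)"
  have dc: "(c has_real_derivative c') (at 0)" unfolding c_def[abs_def] c'_def by (rule dbomb)
  have dd: "\<exists>D. (d j has_real_derivative D) (at 0)" for j unfolding d_def[abs_def] using dbomb by blast
  have "\<exists>D. ((\<lambda>t. d j t / c t) has_real_derivative D) (at 0)" for j
    using dd[of j] dc c0 DERIV_divide by blast
  then obtain s' where s': "\<And>j. ((\<lambda>t. d j t / c t) has_real_derivative s' j) (at 0)" by metis
  define S' where "S' = (\<chi> j. s' j)"
  have dS: "(S has_derivative (\<lambda>h. h *\<^sub>R S')) (at 0)"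
  proof -
    have "((\<lambda>t. \<Sum>j\<in>UNIV. (d j t / c t) *\<^sub>R ?e j) has_derivative (\<lambda>h. \<Sum>j\<in>UNIV. (s' j * h) *\<^sub>R ?e j)) (at 0)"
      by (intro has_derivative_sum has_derivative_scaleR_left s'[unfolded has_field_derivative_def])
    moreover have "S = (\<lambda>t. \<Sum>j\<in>UNIV. (d j t / c t) *\<^sub>R ?e j)"
      by (simp add: S_def fun_eq_iff vec_eq_iff axis_def if_distrib sum.If_cases cong: if_cong)
    moreover have "(\<lambda>h. \<Sum>j\<in>UNIV. (s' j * h) *\<^sub>R ?e j) = (\<lambda>h. h *\<^sub>R S')"
      by (simp add: S'_def fun_eq_iff vec_eq_iff axis_def if_distrib sum.If_cases cong: if_cong)
    ultimately show ?thesis by simp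
  qed
  have "isCont c 0" using dc by (rule DERIV_isCont)
  then have "(c \<longlongrightarrow> c 0) (nhds 0)" by (simp add: isCont_def tendsto_at_iff_tendsto_nhds)
  then have "\<forall>\<^sub>F t in nhds 0. c t \<noteq> 0" using c0 by (rule tendsto_imp_eventually_ne)
  moreover have "\<forall>\<^sub>F t in nhds 0. t \<in> {-\<epsilon><..<\<epsilon>}" using \<epsilon> by (intro eventually_nhds_in_open) auto
  ultimately have ev: "\<forall>\<^sub>F t in nhds 0. \<gamma> t = c t *\<^sub>R linear_form (S t) ^ Suc m"
    by eventually_elim (use rep in blast)
  have "Poly_Mapping.lookup w \<alpha> = Poly_Mapping.lookup (linear_form (S 0) ^ m * linear_form (c' *\<^sub>R S 0 + (c 0 * real (Suc m)) *\<^sub>R S')) \<alpha>" for \<alpha>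
  proof -
    have dL: "((\<lambda>t. Poly_Mapping.lookup (linear_form (S t) ^ Suc m) \<alpha>) has_real_derivative
       real (Suc m) * Poly_Mapping.lookup (linear_form (S 0) ^ m * linear_form S') \<alpha>) (at 0)"
      using has_derivative_compose[OF dS has_derivative_lookup_power_mult[of "Suc m" 1 \<alpha> "S 0"]]
      unfolding has_field_derivative_def mult_1_right
      by (rule has_derivative_eq_rhs)
        (simp add: fun_eq_iff linear_form_scaleR poly_scaleR_mult_right lookup_scaleR)
    have p1: "((\<lambda>t. c t * Poly_Mapping.lookup (linear_form (S t) ^ Suc m) \<alpha>) has_real_derivative
       c' * Poly_Mapping.lookup (linear_form (S 0) ^ Suc m) \<alpha> + (real (Suc m) * Poly_Mapping.lookup (linear_form (S 0) ^ m * linear_form S') \<alpha>) * c 0) (at 0)"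
      by (rule DERIV_mult[OF dc dL])
    have p2: "\<forall>\<^sub>F t in nhds 0. c t * Poly_Mapping.lookup (linear_form (S t) ^ Suc m) \<alpha> = Poly_Mapping.lookup (\<gamma> t) \<alpha>"
      using ev by eventually_elim (simp add: lookup_scaleR)
    have "((\<lambda>t. Poly_Mapping.lookup (\<gamma> t) \<alpha>) has_real_derivative
       c' * Poly_Mapping.lookup (linear_form (S 0) ^ Suc m) \<alpha> + (real (Suc m) * Poly_Mapping.lookup (linear_form (S 0) ^ m * linear_form S') \<alpha>) * c 0) (at 0)"
      using DERIV_cong_ev[OF refl p2 refl] p1 by (rule iffD1)
    then have "Poly_Mapping.lookup w \<alpha> = c' * Poly_Mapping.lookup (linear_form (S 0) ^ Suc m) \<alpha> + (real (Suc m) * Poly_Mapping.lookup (linear_form (S 0) ^ m * linear_form S') \<alpha>) * c 0"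
      using der DERIV_unique by blast
    moreover have "linear_form (S 0) ^ m * linear_form (c' *\<^sub>R S 0 + (c 0 * real (Suc m)) *\<^sub>R S') =
       c' *\<^sub>R linear_form (S 0) ^ Suc m + (c 0 * real (Suc m)) *\<^sub>R (linear_form (S 0) ^ m * linear_form S')"
      by (simp add: linear_form_add linear_form_scaleR distrib_left poly_scaleR_mult_right mult.commute)
    ultimately show ?thesis by (simp only: lookup_add lookup_scaleR real_scaleR_def) (simp only: ac_simps)
  qed
  then have weq: "w = linear_form (S 0) ^ m * linear_form (c' *\<^sub>R S 0 + (c 0 * real (Suc m)) *\<^sub>R S')"
    by (rule poly_mapping_eqI)
  have S0: "S 0 = (1 / u $ i) *\<^sub>R u"
    unfolding S_def c_def d_def \<gamma>0 cval dval using i s by (simp add: vec_eq_iff field_simps)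
  have "w = linear_form u ^ m * linear_form ((1 / u $ i) ^ m *\<^sub>R (c' *\<^sub>R S 0 + (c 0 * real (Suc m)) *\<^sub>R S'))"
    by (subst weq, subst (1) S0) (simp only: linear_form_scaleR poly_scaleR_power poly_scaleR_mult_left poly_scaleR_mult_right)
  then show ?thesis by blast
qed

text \<open>Here the degree is \<open>Suc m\<close>. All conditions are homogeneous in
  \<open>u\<close>, so they describe the line through \<open>u\<close>: the gradient of
  \<open>v\<close> at \<open>u\<close> is a multiple of \<open>u\<close>, and \<open>v\<close> does
  not vanish at \<open>u\<close>.\<close>

definition critical_direction :: "nat \<Rightarrow> real_poly3 \<Rightarrow> real ^ 3 \<Rightarrow> bool" where
  "critical_direction m v u \<longleftrightarrow> u \<noteq> 0 \<and> bombieri (Suc m) v (linear_form u ^ Suc m) \<noteq> 0 \<and>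
    (\<forall>a. (u \<bullet> u) * bombieri (Suc m) v (linear_form u ^ m * linear_form a) = (u \<bullet> a) * bombieri (Suc m) v (linear_form u ^ Suc m))"

text \<open>The orthogonal projection of \<open>v\<close> to the line spanned by the power of
  \<open>u\<close>, whose squared norm is \<open>(u \<bullet> u) ^ Suc m\<close>.\<close>

definition critical_point_of :: "nat \<Rightarrow> real_poly3 \<Rightarrow> real ^ 3 \<Rightarrow> real_poly3" where
  "critical_point_of m v u = (bombieri (Suc m) v (linear_form u ^ Suc m) / (u \<bullet> u) ^ Suc m) *\<^sub>R linear_form u ^ Suc m"

text \<open>The two tangent lemmas together identify the directions to be tested; the nonzero factor
  \<open>real (Suc m) * s\<close> does not affect orthogonality.\<close>

lemma pure_power_critical_iff:
  assumes u: "u \<noteq> 0" and s: "s = 1 \<or> s = (-1::real)" and x: "x = s *\<^sub>R linear_form u ^ Suc m"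
  shows "x \<in> critical_points (Suc m) (pure_powers (Suc m)) v \<longleftrightarrow>
    (\<forall>a. bombieri (Suc m) (v - x) (linear_form u ^ m * linear_form a) = 0)"
proof
  assume "x \<in> critical_points (Suc m) (pure_powers (Suc m)) v"
  then have *: "bombieri (Suc m) (v - x) w = 0" if "w \<in> tangent_space (pure_powers (Suc m)) x" for w
    using that by (auto simp: critical_points_def)
  show "\<forall>a. bombieri (Suc m) (v - x) (linear_form u ^ m * linear_form a) = 0"
  proof
    fix a
    have "real (Suc m) * s * bombieri (Suc m) (v - x) (linear_form u ^ m * linear_form a) = 0"
      using *[unfolded x, OF tangent_direction[OF u s, of m a]] by (simp only: bombieri_scaleR_right x)
    then show "bombieri (Suc m) (v - x) (linear_form u ^ m * linear_form a) = 0" using s by auto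
  qed
next
  assume *: "\<forall>a. bombieri (Suc m) (v - x) (linear_form u ^ m * linear_form a) = 0"
  have s0: "s \<noteq> 0" using s by auto
  have "x \<in> pure_powers (Suc m)" unfolding pure_powers_def x using s linear_form_power_neq_0[OF u, of "Suc m"] by auto
  moreover have "bombieri (Suc m) (v - x) w = 0" if "w \<in> tangent_space (pure_powers (Suc m)) x" for w
    using tangent_space_subset[OF u that[unfolded x] s0] * by auto
  ultimately show "x \<in> critical_points (Suc m) (pure_powers (Suc m)) v" by (auto simp: critical_points_def)
qed

lemma critical_direction_scaleR:
  assumes k: "k \<noteq> 0"
  shows "critical_direction m v (k *\<^sub>R u) \<longleftrightarrow> critical_direction m v u"
    and "critical_point_of m v (k *\<^sub>R u) = critical_point_of m v u"
proof -
  have 1: "linear_form (k *\<^sub>R u) ^ n = k ^ n *\<^sub>R linear_form u ^ n" for n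
    by (simp only: linear_form_scaleR poly_scaleR_power)
  have "(k * k * (u \<bullet> u)) * (k ^ m * A) = (k * c) * (k ^ Suc m * B) \<longleftrightarrow> (u \<bullet> u) * A = c * B" for A B c
  proof -
    have "(k * k * (u \<bullet> u)) * (k ^ m * A) = (k * k * k ^ m) * ((u \<bullet> u) * A)"
      "(k * c) * (k ^ Suc m * B) = (k * k * k ^ m) * (c * B)" by (simp_all add: ac_simps)
    then show ?thesis using k by simp
  qed
  then show "critical_direction m v (k *\<^sub>R u) \<longleftrightarrow> critical_direction m v u"
    unfolding critical_direction_def 1 poly_scaleR_mult_left bombieri_scaleR_right using k
    by (simp only: inner_scaleR_left inner_scaleR_right scaleR_eq_0_iff mult_eq_0_iff power_eq_0_iff simp_thms mult.assoc)
  show "critical_point_of m v (k *\<^sub>R u) = critical_point_of m v u"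
  proof -
    have "k ^ Suc m * B / (k * (k * U)) ^ Suc m * k ^ Suc m = B / U ^ Suc m" for B U
      using k by (simp only: power_mult_distrib) (simp del: power_Suc)
    then show ?thesis unfolding critical_point_of_def 1 bombieri_scaleR_right by simp
  qed
qed

text \<open>Criticality in the direction \<open>u\<close> itself fixes the multiple of the pure
  power, so a critical point is determined by its line; the other directions give the gradient
  condition.\<close>

lemma critical_points_eq_image:
  "critical_points (Suc m) (pure_powers (Suc m)) v = critical_point_of m v ` {u. critical_direction m v u}"
proof (intro equalityI subsetI)
  fix x assume x: "x \<in> critical_points (Suc m) (pure_powers (Suc m)) v"
  then obtain u where u: "x \<noteq> 0" "x = linear_form u ^ Suc m \<or> x = - (linear_form u ^ Suc m)"
    by (auto simp: critical_points_def pure_powers_def)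
  have unz: "u \<noteq> 0" using u by (auto simp: linear_form_def)
  obtain s :: real where s: "s = 1 \<or> s = -1" "x = s *\<^sub>R linear_form u ^ Suc m"
    using u(2) by (metis scaleR_minus1_left scaleR_one)
  have "\<forall>a. bombieri (Suc m) (v - x) (linear_form u ^ m * linear_form a) = 0"
    using x pure_power_critical_iff[OF unz s] by blast
  then have orth: "bombieri (Suc m) v (linear_form u ^ m * linear_form a) = s * ((u \<bullet> u) ^ m * (u \<bullet> a))" for a
    unfolding s(2) bombieri_diff_left bombieri_scaleR_left
    by (simp only: bombieri_commute[of _ "linear_form u ^ Suc m"] bombieri_power_mult_power) (simp add: inner_commute)
  have f: "bombieri (Suc m) v (linear_form u ^ Suc m) = s * (u \<bullet> u) ^ Suc m"
    using orth[of u] by (simp add: mult.commute)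
  have cd: "critical_direction m v u"
    unfolding critical_direction_def f orth using unz s by (auto simp: ac_simps)
  have "critical_point_of m v u = x" unfolding critical_point_of_def f s(2) using unz by simp
  then show "x \<in> critical_point_of m v ` {u. critical_direction m v u}" using cd by auto
next
  fix x assume "x \<in> critical_point_of m v ` {u. critical_direction m v u}"
  then obtain u where u: "critical_direction m v u" "x = critical_point_of m v u" by auto
  have unz: "u \<noteq> 0" using u by (simp add: critical_direction_def)
  define B where "B = bombieri (Suc m) v (linear_form u ^ Suc m)"
  define C where "C = B / (u \<bullet> u) ^ Suc m"
  have C0: "C \<noteq> 0" using u(1) unz by (auto simp: C_def B_def critical_direction_def)
  have xC: "x = C *\<^sub>R linear_form u ^ Suc m" using u(2) by (simp add: critical_point_of_def C_def B_def)
  \<comment> \<open>The real root of the modulus is absorbed into \<open>u\<close>, while the sign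
    of the coefficient stays in front; for even degree this uses both signs in the definition of
    X.\<close>
  define r where "r = root (Suc m) \<bar>C\<bar>"
  have r: "r > 0" "r ^ Suc m = \<bar>C\<bar>" using C0 by (auto simp: r_def real_root_pow_pos2 simp del: power_Suc)
  have x: "x = sgn C *\<^sub>R linear_form (r *\<^sub>R u) ^ Suc m"
    by (simp only: linear_form_scaleR poly_scaleR_power r(2) scaleR_scaleR xC sgn_mult_abs)
  have s: "sgn C = 1 \<or> sgn C = -1" using C0 by (auto simp: sgn_if)
  have "bombieri (Suc m) (v - x) (linear_form u ^ m * linear_form a) = 0" for a
  proof -
    have "bombieri (Suc m) x (linear_form u ^ m * linear_form a) = C * ((u \<bullet> u) ^ m * (u \<bullet> a))"
      unfolding xC bombieri_scaleR_left
      by (simp only: bombieri_commute[of _ "linear_form u ^ Suc m"] bombieri_power_mult_power) (simp add: inner_commute)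
    also have "\<dots> = (u \<bullet> a) * B / (u \<bullet> u)" using unz by (simp add: C_def)
    also have "\<dots> = bombieri (Suc m) v (linear_form u ^ m * linear_form a)"
      using u(1) unz unfolding critical_direction_def B_def[symmetric] by (simp add: field_simps)
    finally show ?thesis by (simp add: bombieri_diff_left)
  qed
  then have "\<forall>a. bombieri (Suc m) (v - x) (linear_form (r *\<^sub>R u) ^ m * linear_form a) = 0"
    by (simp only: linear_form_scaleR poly_scaleR_power poly_scaleR_mult_left bombieri_scaleR_right) simp
  then show "x \<in> critical_points (Suc m) (pure_powers (Suc m)) v"
    using pure_power_critical_iff[of "r *\<^sub>R u" "sgn C" x m v] x s unz r by simp
qed

text \<open>Pairing the equality of the two multiples with
  \<open>linear_form w ^ m * linear_form b\<close> shows that every \<open>b\<close> perpendicular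
  to \<open>u\<close> is perpendicular to \<open>w\<close>. Applied to the component of
  \<open>w\<close> perpendicular to \<open>u\<close>, this shows that the component is 0.\<close>

lemma critical_point_of_eq_imp_parallel:
  assumes u: "critical_direction m v u" and w: "critical_direction m v w"
    and eq: "critical_point_of m v u = critical_point_of m v w"
  shows "\<exists>k. k \<noteq> 0 \<and> w = k *\<^sub>R u"
proof -
  have nz: "u \<noteq> 0" "w \<noteq> 0" using u w by (auto simp: critical_direction_def)
  obtain C where C: "C \<noteq> 0" "critical_point_of m v u = C *\<^sub>R linear_form u ^ Suc m"
  proof (rule that)
    show "bombieri (Suc m) v (linear_form u ^ Suc m) / (u \<bullet> u) ^ Suc m \<noteq> 0"
      using u nz by (auto simp: critical_direction_def)
  qed (simp add: critical_point_of_def)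
  obtain D where D: "D \<noteq> 0" "critical_point_of m v w = D *\<^sub>R linear_form w ^ Suc m"
  proof (rule that)
    show "bombieri (Suc m) v (linear_form w ^ Suc m) / (w \<bullet> w) ^ Suc m \<noteq> 0"
      using w nz by (auto simp: critical_direction_def)
  qed (simp add: critical_point_of_def)
  have e: "C *\<^sub>R linear_form u ^ Suc m = D *\<^sub>R linear_form w ^ Suc m" using C D eq by simp
  have orth: "b \<bullet> w = 0" if "b \<bullet> u = 0" for b
  proof -
    have "C * ((w \<bullet> u) ^ m * (b \<bullet> u)) = D * ((w \<bullet> w) ^ m * (b \<bullet> w))"
      using arg_cong[OF e, of "bombieri (Suc m) (linear_form w ^ m * linear_form b)"]
      by (simp only: bombieri_scaleR_right bombieri_power_mult_power)
    then show ?thesis using that D(1) nz by simp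
  qed
  define k where "k = (w \<bullet> u) / (u \<bullet> u)"
  have "(w - k *\<^sub>R u) \<bullet> u = 0" using nz by (simp add: k_def inner_diff_left)
  then have "(w - k *\<^sub>R u) \<bullet> w = 0" "(w - k *\<^sub>R u) \<bullet> u = 0" using orth by auto
  then have "(w - k *\<^sub>R u) \<bullet> (w - k *\<^sub>R u) = 0" by (simp add: inner_diff_right)
  then have "w = k *\<^sub>R u" by simp
  then show ?thesis using nz by auto
qed

section \<open>The Kac-Rice formula in an affine chart\<close>

text \<open>Connects the vectors \<open>real^2\<close> of the area formula with the iterated
  integrals in which Gaussian coordinates appear.\<close>

lemma nn_integral_lborel_vec2:
  assumes [measurable]: "g \<in> borel_measurable borel"
  shows "(\<integral>\<^sup>+\<xi>. g \<xi> \<partial>(lborel :: (real^2) measure)) =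
    (\<integral>\<^sup>+x. \<integral>\<^sup>+y. g (x *\<^sub>R axis 1 1 + y *\<^sub>R axis 2 1) \<partial>lborel \<partial>lborel)"
proof -
  let ?T = "\<lambda>(x, y). x *\<^sub>R axis 1 1 + y *\<^sub>R axis 2 1 :: real^2"
  have "lborel = distr (lborel \<Otimes>\<^sub>M lborel) borel ?T"
  proof (rule lborel_eqI)
    fix l u :: "real^2"
    assume lu: "\<And>b. b \<in> Basis \<Longrightarrow> l \<bullet> b \<le> u \<bullet> b"
    have le: "l $ i \<le> u $ i" for i using lu[of "axis i 1"] by (simp add: inner_axis axis_in_Basis_iff)
    have B: "(Basis :: (real^2) set) = {axis 1 1, axis 2 1}"
      by (auto simp: Basis_vec_def UNIV_2)
    have ne: "axis 1 (1::real) \<noteq> (axis 2 1 :: real^2)" by (simp add: axis_eq_axis)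
    have ax: "(axis i x :: real^2) $ j = (if j = i then x else 0)" for i j and x :: real
      by (simp add: axis_def)
    have pre: "?T -` box l u \<inter> space (lborel \<Otimes>\<^sub>M lborel) = {l $ 1<..<u $ 1} \<times> {l $ 2<..<u $ 2}"
      by (auto simp: mem_box B inner_axis space_pair_measure ax)
    have "emeasure (distr (lborel \<Otimes>\<^sub>M lborel) borel ?T) (box l u) = emeasure lborel {l $ 1<..<u $ 1} * emeasure lborel {l $ 2<..<u $ 2}"
      by (subst emeasure_distr) (simp_all only: pre, measurable, simp add: lborel.emeasure_pair_measure_Times)
    also have "\<dots> = ennreal (\<Prod>b\<in>Basis. (u - l) \<bullet> b)"
      using le ne by (simp add: B inner_axis ennreal_mult)
    finally show "emeasure (distr (lborel \<Otimes>\<^sub>M lborel) borel ?T) (box l u) = ennreal (\<Prod>b\<in>Basis. (u - l) \<bullet> b)" .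
  qed simp
  then have "(\<integral>\<^sup>+\<xi>. g \<xi> \<partial>lborel) = (\<integral>\<^sup>+\<xi>. g \<xi> \<partial>distr (lborel \<Otimes>\<^sub>M lborel) borel ?T)" by simp
  also have "\<dots> = (\<integral>\<^sup>+q. g (?T q) \<partial>(lborel \<Otimes>\<^sub>M lborel))" by (subst nn_integral_distr) auto
  also have "\<dots> = (\<integral>\<^sup>+x. \<integral>\<^sup>+y. g (x *\<^sub>R axis 1 1 + y *\<^sub>R axis 2 1) \<partial>lborel \<partial>lborel)"
    by (subst lborel.nn_integral_fst[symmetric]) auto
  finally show ?thesis .
qed

lemma measurable_vec2_nth [measurable]:
  fixes g :: "_ \<Rightarrow> real^2"
  assumes "g \<in> borel_measurable N"
  shows "(\<lambda>x. g x $ i) \<in> borel_measurable N"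
  by (rule measurable_compose[OF assms]) (intro borel_measurable_continuous_onI continuous_intros)

lemma norm_vec2_squared: "(norm (z :: real^2))\<^sup>2 = (z $ 1)\<^sup>2 + (z $ 2)\<^sup>2"
  by (simp add: norm_vec_def L2_set_def sum_2 sum_nonneg)

definition gauss2 :: "real^2 \<Rightarrow> real" where
  "gauss2 \<xi> = exp (- ((\<xi> $ 1)\<^sup>2 + (\<xi> $ 2)\<^sup>2) / 2) / (2 * pi)"

lemma nn_integral_gauss_vec2:
  assumes [measurable]: "(\<lambda>\<xi> :: real^2. g (\<xi> $ 1) (\<xi> $ 2)) \<in> borel_measurable borel"
    "(\<lambda>(x, y). g x y) \<in> borel_measurable (borel \<Otimes>\<^sub>M borel)"
  shows "(\<integral>\<^sup>+x. \<integral>\<^sup>+y. g x y \<partial>gauss \<partial>gauss) = (\<integral>\<^sup>+\<xi>. g (\<xi> $ 1) (\<xi> $ 2) * ennreal (gauss2 \<xi>) \<partial>lborel)"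
proof -
  have m: "gauss2 \<in> borel_measurable borel" unfolding gauss2_def[abs_def] by measurable
  show ?thesis
    by (subst nn_integral_gauss_gauss, measurable, subst nn_integral_lborel_vec2)
      (use m in \<open>simp_all add: gauss2_def axis_def mult.commute\<close>)
qed

lemma integrable_gauss2: "integrable lborel gauss2"
proof (rule integrableI_nonneg)
  show m: "gauss2 \<in> borel_measurable lborel" unfolding gauss2_def[abs_def] by measurable
  have "(\<integral>\<^sup>+\<xi>. ennreal (gauss2 \<xi>) \<partial>lborel) = (\<integral>\<^sup>+x. \<integral>\<^sup>+y. 1 \<partial>gauss \<partial>gauss)"
    using nn_integral_gauss_vec2[of "\<lambda>_ _. 1"] by simp
  also have "\<dots> = 1" by (simp only: nn_integral_gauss_const)
  finally show "(\<integral>\<^sup>+\<xi>. ennreal (gauss2 \<xi>) \<partial>lborel) < \<infinity>" by simp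
qed (simp add: gauss2_def)

lemma measurable_power_mult [measurable]:
  assumes "g \<in> borel_measurable N"
  shows "(\<lambda>x. linear_form (g x) ^ k * c) \<in> measurable N poly_sigma"
proof (rule measurable_poly_sigmaI)
  fix \<alpha>
  have "continuous_on UNIV (\<lambda>t. Poly_Mapping.lookup (linear_form t ^ k * c) \<alpha>)"
    by (intro continuous_at_imp_continuous_on ballI has_derivative_continuous[OF has_derivative_lookup_power_mult])
  then have "(\<lambda>t. Poly_Mapping.lookup (linear_form t ^ k * c) \<alpha>) \<in> borel_measurable borel"
    by (rule borel_measurable_continuous_onI)
  then show "(\<lambda>x. Poly_Mapping.lookup (linear_form (g x) ^ k * c) \<alpha>) \<in> borel_measurable N"
    using assms by (rule measurable_compose[rotated])
qed

text \<open>The chart is the plane through \<open>n\<close> parallel to \<open>e\<close> and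
  \<open>f\<close>. The frame is arbitrary because the degenerate directions of one chart are
  examined in others; the degree is \<open>m + 2\<close>, so that second derivatives carry the
  honest exponent \<open>m\<close>.\<close>

locale frame =
  fixes n e f :: "real^3" and m :: nat
  assumes unit: "n \<bullet> n = 1" "e \<bullet> e = 1" "f \<bullet> f = 1"
    and perp: "n \<bullet> e = 0" "n \<bullet> f = 0" "e \<bullet> f = 0"
begin

lemma perp': "e \<bullet> n = 0" "f \<bullet> n = 0" "f \<bullet> e = 0"
  using perp by (simp_all add: inner_commute)

abbreviation p where "p \<equiv> Suc (Suc m)"
abbreviation ip where "ip \<equiv> bombieri p"

definition dir :: "real^2 \<Rightarrow> real^3" where
  "dir z = n + (z $ 1) *\<^sub>R e + (z $ 2) *\<^sub>R f"

definition r2 :: "real^2 \<Rightarrow> real" where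
  "r2 z = 1 + (z $ 1)\<^sup>2 + (z $ 2)\<^sup>2"

text \<open>
  \<open>F\<close> and \<open>H\<close> are the value, gradient and Hessian of \<open>v\<close> at \<open>dir z\<close> in the directions \<open>e\<close>, \<open>f\<close> up to the factors
  \<open>p\<close> and \<open>p (p - 1)\<close>.  The direction \<open>dir z\<close> is critical iff \<open>G = 0\<close> and \<open>F0 \<noteq> 0\<close>; \<open>M\<close> is the Jacobian of \<open>G\<close> in \<open>z\<close>, and
  \<open>A\<close> is the matrix of \<open>v \<mapsto> G v z\<close> on the span of \<open>q1\<close>, \<open>q2\<close>.  Where \<open>A\<close> is invertible, \<open>slice v z\<close> is the
  solution of \<open>G = 0\<close> that differs from \<open>v\<close> by an element of this span.
\<close>

definition F0 where "F0 v z = ip v (linear_form (dir z) ^ p * 1)"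
definition F1 where "F1 v z = ip v (linear_form (dir z) ^ Suc m * linear_form e)"
definition F2 where "F2 v z = ip v (linear_form (dir z) ^ Suc m * linear_form f)"
definition H11 where "H11 v z = ip v (linear_form (dir z) ^ m * (linear_form e * linear_form e))"
definition H12 where "H12 v z = ip v (linear_form (dir z) ^ m * (linear_form e * linear_form f))"
definition H22 where "H22 v z = ip v (linear_form (dir z) ^ m * (linear_form f * linear_form f))"

definition G1 where "G1 v z = r2 z * F1 v z - z $ 1 * F0 v z"
definition G2 where "G2 v z = r2 z * F2 v z - z $ 2 * F0 v z"

definition M11 where "M11 v z = 2 * z $ 1 * F1 v z + r2 z * (real (Suc m) * H11 v z) - F0 v z - z $ 1 * (real p * F1 v z)"
definition M12 where "M12 v z = 2 * z $ 2 * F1 v z + r2 z * (real (Suc m) * H12 v z) - z $ 1 * (real p * F2 v z)"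
definition M21 where "M21 v z = 2 * z $ 1 * F2 v z + r2 z * (real (Suc m) * H12 v z) - z $ 2 * (real p * F1 v z)"
definition M22 where "M22 v z = 2 * z $ 2 * F2 v z + r2 z * (real (Suc m) * H22 v z) - F0 v z - z $ 2 * (real p * F2 v z)"

definition detM where "detM v z = M11 v z * M22 v z - M12 v z * M21 v z"

definition q1 where "q1 = sqrt (real p) *\<^sub>R (linear_form n ^ Suc m * linear_form e)"
definition q2 where "q2 = sqrt (real p) *\<^sub>R (linear_form n ^ Suc m * linear_form f)"

definition A11 where "A11 z = r2 z / sqrt (real p) - sqrt (real p) * (z $ 1)\<^sup>2"
definition A12 :: "real^2 \<Rightarrow> real" where "A12 z = - (sqrt (real p) * (z $ 1 * z $ 2))"
definition A22 where "A22 z = r2 z / sqrt (real p) - sqrt (real p) * (z $ 2)\<^sup>2"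
definition detA where "detA z = A11 z * A22 z - A12 z * A12 z"

definition h1 where "h1 w z = (G2 w z * A12 z - G1 w z * A22 z) / detA z"
definition h2 where "h2 w z = (G1 w z * A12 z - G2 w z * A11 z) / detA z"
definition slice where "slice w z = w + h1 w z *\<^sub>R q1 + h2 w z *\<^sub>R q2"

lemma dir_inner: "dir z \<bullet> n = 1" "dir z \<bullet> e = z $ 1" "dir z \<bullet> f = z $ 2"
    "n \<bullet> dir z = 1" "e \<bullet> dir z = z $ 1" "f \<bullet> dir z = z $ 2" "dir z \<bullet> dir z = r2 z"
  by (simp_all add: dir_def inner_add_left inner_add_right unit perp perp' r2_def power2_eq_square)

lemma r2_pos: "r2 z > 0"
  unfolding r2_def by (simp add: add_pos_nonneg)

lemma dir_neq_0: "dir z \<noteq> 0"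
  using r2_pos[of z] dir_inner(7)[of z] by auto

lemma p_pos: "real p > 0" "sqrt (real p) * sqrt (real p) = real p" "sqrt (real p) > 0" "sqrt (real p) \<noteq> 0"
  by simp_all

text \<open>The second factor vanishes on the circle of radius 1 / sqrt (p - 1) about the origin:
  the degenerate circle of the chart.\<close>

lemma detA_eq: "detA z = r2 z / real p * (1 - real (Suc m) * ((z $ 1)\<^sup>2 + (z $ 2)\<^sup>2))"
proof -
  define s where "s = sqrt (real p)"
  have s: "s > 0" "real p = s * s" by (simp_all add: s_def)
  have sm: "real (Suc m) = s * s - 1" using s(2) by simp
  show ?thesis
    unfolding detA_def A11_def A12_def A22_def s_def[symmetric] s(2) sm
    using s(1) by (simp add: field_simps r2_def power2_eq_square)
qed

lemma F_linear:
  "F0 (v + w) z = F0 v z + F0 w z" "F0 (c *\<^sub>R v) z = c * F0 v z"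
  "F1 (v + w) z = F1 v z + F1 w z" "F1 (c *\<^sub>R v) z = c * F1 v z"
  "F2 (v + w) z = F2 v z + F2 w z" "F2 (c *\<^sub>R v) z = c * F2 v z"
  "H11 (v + w) z = H11 v z + H11 w z" "H11 (c *\<^sub>R v) z = c * H11 v z"
  "H12 (v + w) z = H12 v z + H12 w z" "H12 (c *\<^sub>R v) z = c * H12 v z"
  "H22 (v + w) z = H22 v z + H22 w z" "H22 (c *\<^sub>R v) z = c * H22 v z"
  by (simp_all add: F0_def F1_def F2_def H11_def H12_def H22_def bombieri_add_left bombieri_scaleR_left)

lemma G_linear:
  "G1 (v + w) z = G1 v z + G1 w z" "G1 (c *\<^sub>R v) z = c * G1 v z"
  "G2 (v + w) z = G2 v z + G2 w z" "G2 (c *\<^sub>R v) z = c * G2 v z"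
  by (simp_all add: G1_def G2_def F_linear algebra_simps)

lemma M_linear:
  "M11 (v + w) z = M11 v z + M11 w z" "M11 (c *\<^sub>R v) z = c * M11 v z"
  "M12 (v + w) z = M12 v z + M12 w z" "M12 (c *\<^sub>R v) z = c * M12 v z"
  "M21 (v + w) z = M21 v z + M21 w z" "M21 (c *\<^sub>R v) z = c * M21 v z"
  "M22 (v + w) z = M22 v z + M22 w z" "M22 (c *\<^sub>R v) z = c * M22 v z"
  by (simp_all add: M11_def M12_def M21_def M22_def F_linear algebra_simps)

lemma F_q:
  "F0 q1 z = sqrt (real p) * z $ 1" "F0 q2 z = sqrt (real p) * z $ 2"
  "F1 q1 z = 1 / sqrt (real p)" "F2 q1 z = 0" "F1 q2 z = 0" "F2 q2 z = 1 / sqrt (real p)"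
proof -
  show "F0 q1 z = sqrt (real p) * z $ 1" "F0 q2 z = sqrt (real p) * z $ 2"
    unfolding F0_def q1_def q2_def bombieri_scaleR_left mult_1_right bombieri_power_mult_power
    by (simp_all add: dir_inner)
  \<comment> \<open>As \<open>n\<close> is perpendicular to \<open>b\<close>, the first Leibniz term
    drops out, and \<open>dir z\<close> has \<open>n\<close>-component 1, so the result does not
    depend on \<open>z\<close>.\<close>
  have *: "bombieri p (linear_form n ^ Suc m * linear_form a) (linear_form (dir z) ^ Suc m * linear_form b) = (a \<bullet> b) / real p"
    if "n \<bullet> b = 0" for a b
    using bombieri_power_mult_power_mult[of m n a "dir z" b] that by (simp add: dir_inner field_simps)
  have sp: "sqrt (real p) * (c / real p) = c / sqrt (real p)" for c
  proof -
    define s where "s = sqrt (real p)"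
    have s: "s > 0" "real p = s * s" by (simp_all add: s_def)
    show ?thesis unfolding s_def[symmetric] s(2) using s(1) by (simp add: field_simps)
  qed
  show "F1 q1 z = 1 / sqrt (real p)" "F2 q1 z = 0" "F1 q2 z = 0" "F2 q2 z = 1 / sqrt (real p)"
    unfolding F1_def F2_def q1_def q2_def bombieri_scaleR_left
    by (simp_all only: * perp sp) (simp_all add: unit perp perp')
qed

lemma G_q: "G1 q1 z = A11 z" "G1 q2 z = A12 z" "G2 q1 z = A12 z" "G2 q2 z = A22 z"
  unfolding G1_def G2_def F_q A11_def A12_def A22_def by (simp_all add: power2_eq_square)

lemma G_slice:
  assumes "detA z \<noteq> 0"
  shows "G1 (slice w z) z = 0" "G2 (slice w z) z = 0"
  using assms unfolding slice_def G_linear G_q h1_def h2_def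
  by (simp_all add: field_simps detA_def)

text \<open>Cramer's rule for the system with matrix \<open>A\<close>; it also identifies elements
  as slices later, without computing \<open>h1\<close> and \<open>h2\<close>.\<close>

lemma slice_unique:
  assumes D: "detA z \<noteq> 0" and G: "G1 (w + x *\<^sub>R q1 + y *\<^sub>R q2) z = 0" "G2 (w + x *\<^sub>R q1 + y *\<^sub>R q2) z = 0"
  shows "x = h1 w z" "y = h2 w z"
proof -
  have 1: "G1 w z = - (x * A11 z + y * A12 z)" and 2: "G2 w z = - (x * A12 z + y * A22 z)"
    using G by (simp_all add: G_linear G_q)
  have "G2 w z * A12 z - G1 w z * A22 z = x * detA z" "G1 w z * A12 z - G2 w z * A11 z = y * detA z"
    unfolding 1 2 detA_def by (simp_all add: algebra_simps)
  then show "x = h1 w z" "y = h2 w z" unfolding h1_def h2_def using D by simp_all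
qed

text \<open>For the Hessian entries differentiability is enough, since it is used only for their
  continuity.\<close>

lemma has_derivative_F:
  shows "((\<lambda>z. F0 v z) has_derivative (\<lambda>k. real p * (k $ 1 * F1 v z + k $ 2 * F2 v z))) (at z)"
    and "((\<lambda>z. F1 v z) has_derivative (\<lambda>k. real (Suc m) * (k $ 1 * H11 v z + k $ 2 * H12 v z))) (at z)"
    and "((\<lambda>z. F2 v z) has_derivative (\<lambda>k. real (Suc m) * (k $ 1 * H12 v z + k $ 2 * H22 v z))) (at z)"
    and "\<exists>D. ((\<lambda>z. H11 v z) has_derivative D) (at z)"
    and "\<exists>D. ((\<lambda>z. H12 v z) has_derivative D) (at z)"
    and "\<exists>D. ((\<lambda>z. H22 v z) has_derivative D) (at z)"
proof -
  have dd: "(dir has_derivative (\<lambda>k. (k $ 1) *\<^sub>R e + (k $ 2) *\<^sub>R f)) (at z)" for z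
    unfolding dir_def[abs_def]
    by (auto intro!: derivative_eq_intros bounded_linear.has_derivative[OF bounded_linear_vec_nth])
  note D = has_derivative_compose[OF dd has_derivative_bombieri_power_mult]
  note lin = linear_form_add linear_form_scaleR distrib_left distrib_right poly_scaleR_mult_left poly_scaleR_mult_right
    bombieri_add_right bombieri_scaleR_right
  show "((\<lambda>z. F0 v z) has_derivative (\<lambda>k. real p * (k $ 1 * F1 v z + k $ 2 * F2 v z))) (at z)"
    unfolding F0_def F1_def F2_def
    by (rule has_derivative_eq_rhs[OF D]) (simp add: fun_eq_iff lin del: power_Suc of_nat_Suc)
  show "((\<lambda>z. F1 v z) has_derivative (\<lambda>k. real (Suc m) * (k $ 1 * H11 v z + k $ 2 * H12 v z))) (at z)"
    unfolding F1_def H11_def H12_def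
    by (rule has_derivative_eq_rhs[OF D]) (simp add: fun_eq_iff lin mult.assoc mult.commute[of "linear_form f" "linear_form e"] del: power_Suc of_nat_Suc)
  show "((\<lambda>z. F2 v z) has_derivative (\<lambda>k. real (Suc m) * (k $ 1 * H12 v z + k $ 2 * H22 v z))) (at z)"
    unfolding F2_def H22_def H12_def
    by (rule has_derivative_eq_rhs[OF D]) (simp add: fun_eq_iff lin mult.assoc del: power_Suc of_nat_Suc)
  show "\<exists>D. ((\<lambda>z. H11 v z) has_derivative D) (at z)" "\<exists>D. ((\<lambda>z. H12 v z) has_derivative D) (at z)"
    "\<exists>D. ((\<lambda>z. H22 v z) has_derivative D) (at z)"
    unfolding H11_def H12_def H22_def using D by blast+
qed

lemma continuous_F:
  "continuous_on S (F0 v)" "continuous_on S (F1 v)" "continuous_on S (F2 v)"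
  "continuous_on S (H11 v)" "continuous_on S (H12 v)" "continuous_on S (H22 v)"
  using has_derivative_F[where v=v] by (blast intro: continuous_at_imp_continuous_on has_derivative_continuous)+

lemma continuous_r2: "continuous_on S r2"
  unfolding r2_def[abs_def] by (intro continuous_intros)

lemma continuous_G: "continuous_on S (G1 v)" "continuous_on S (G2 v)"
  unfolding G1_def[abs_def] G2_def[abs_def]
  by (intro continuous_intros continuous_F continuous_r2)+

lemma continuous_M: "continuous_on S (M11 v)" "continuous_on S (M12 v)" "continuous_on S (M21 v)" "continuous_on S (M22 v)"
  unfolding M11_def[abs_def] M12_def[abs_def] M21_def[abs_def] M22_def[abs_def]
  by (intro continuous_intros continuous_F continuous_r2)+

lemma continuous_A: "continuous_on S A11" "continuous_on S A12" "continuous_on S A22" "continuous_on S detA"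
proof -
  show *: "continuous_on S A11" "continuous_on S A12" "continuous_on S A22"
    unfolding A11_def[abs_def] A12_def[abs_def] A22_def[abs_def]
    by (intro continuous_intros continuous_r2; simp)+
  show "continuous_on S detA" unfolding detA_def[abs_def] by (intro continuous_intros *)
qed

lemma continuous_h:
  assumes "\<And>z. z \<in> S \<Longrightarrow> detA z \<noteq> 0"
  shows "continuous_on S (h1 w)" "continuous_on S (h2 w)"
  unfolding h1_def[abs_def] h2_def[abs_def] using assms
  by (intro continuous_intros continuous_G continuous_A; simp)+

lemma has_derivative_nth: "((\<lambda>z. z $ i) has_derivative (\<lambda>k. k $ i)) (at z)"
  by (rule bounded_linear.has_derivative[OF bounded_linear_vec_nth has_derivative_ident])

lemma has_derivative_r2: "(r2 has_derivative (\<lambda>k. 2 * z $ 1 * k $ 1 + 2 * z $ 2 * k $ 2)) (at z)"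
  unfolding r2_def[abs_def] power2_eq_square
  by (auto intro!: derivative_eq_intros has_derivative_nth simp: fun_eq_iff)

lemma has_derivative_G:
  "((\<lambda>z. G1 v z) has_derivative (\<lambda>k. M11 v z * k $ 1 + M12 v z * k $ 2)) (at z)"
  "((\<lambda>z. G2 v z) has_derivative (\<lambda>k. M21 v z * k $ 1 + M22 v z * k $ 2)) (at z)"
  unfolding G1_def G2_def
  by (rule has_derivative_eq_rhs[OF has_derivative_diff[OF has_derivative_mult[OF has_derivative_r2 has_derivative_F(2)]
      has_derivative_mult[OF has_derivative_nth has_derivative_F(1)]]],
      simp add: fun_eq_iff M11_def M12_def algebra_simps,
     rule has_derivative_eq_rhs[OF has_derivative_diff[OF has_derivative_mult[OF has_derivative_r2 has_derivative_F(3)]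
      has_derivative_mult[OF has_derivative_nth has_derivative_F(1)]]],
      simp add: fun_eq_iff M21_def M22_def algebra_simps)

lemma has_derivative_A:
  "(A11 has_derivative (\<lambda>k. M11 q1 z * k $ 1 + M12 q1 z * k $ 2)) (at z)"
  "(A12 has_derivative (\<lambda>k. M11 q2 z * k $ 1 + M12 q2 z * k $ 2)) (at z)"
  "(A12 has_derivative (\<lambda>k. M21 q1 z * k $ 1 + M22 q1 z * k $ 2)) (at z)"
  "(A22 has_derivative (\<lambda>k. M21 q2 z * k $ 1 + M22 q2 z * k $ 2)) (at z)"
  using has_derivative_G(1)[of q1 z] has_derivative_G(1)[of q2 z] has_derivative_G(2)[of q1 z] has_derivative_G(2)[of q2 z]
  unfolding G_q by simp_all

text \<open>The entries of - A^(-1) M at the slice, written out by Cramer's rule.\<close>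

definition J11 where "J11 w z = (M21 (slice w z) z * A12 z - M11 (slice w z) z * A22 z) / detA z"
definition J12 where "J12 w z = (M22 (slice w z) z * A12 z - M12 (slice w z) z * A22 z) / detA z"
definition J21 where "J21 w z = (M11 (slice w z) z * A12 z - M21 (slice w z) z * A11 z) / detA z"
definition J22 where "J22 w z = (M12 (slice w z) z * A12 z - M22 (slice w z) z * A11 z) / detA z"

text \<open>The quotient rule gives differentiability but an unwieldy derivative. Its value is found
  by implicit differentiation: \<open>G\<close> vanishes identically along the slice near
  \<open>z\<close>, and its total derivative is M at the slice plus A times the derivative of
  \<open>h\<close>.\<close>

lemma has_derivative_h:
  assumes D: "detA z \<noteq> 0"
  shows "(h1 w has_derivative (\<lambda>k. J11 w z * k $ 1 + J12 w z * k $ 2)) (at z)"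
    and "(h2 w has_derivative (\<lambda>k. J21 w z * k $ 1 + J22 w z * k $ 2)) (at z)"
proof -
  have dA: "\<exists>d. (detA has_derivative d) (at z)"
    unfolding detA_def[abs_def]
    by (rule exI, rule has_derivative_diff[OF has_derivative_mult[OF has_derivative_A(1) has_derivative_A(4)] has_derivative_mult[OF has_derivative_A(2) has_derivative_A(2)]])
  then obtain dA where dA: "(detA has_derivative dA) (at z)" by blast
  obtain d1 where d1: "(h1 w has_derivative d1) (at z)"
    unfolding h1_def[abs_def]
    using has_derivative_divide[OF has_derivative_diff[OF has_derivative_mult[OF has_derivative_G(2) has_derivative_A(2)] has_derivative_mult[OF has_derivative_G(1) has_derivative_A(4)]] dA D]
    by blast
  obtain d2 where d2: "(h2 w has_derivative d2) (at z)"
    unfolding h2_def[abs_def]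
    using has_derivative_divide[OF has_derivative_diff[OF has_derivative_mult[OF has_derivative_G(1) has_derivative_A(2)] has_derivative_mult[OF has_derivative_G(2) has_derivative_A(1)]] dA D]
    by blast
  have "open {z. detA z \<noteq> 0}" using continuous_A(4)[of UNIV] by (intro open_Collect_neq) (auto simp: continuous_on_const)
  then have ev: "\<forall>\<^sub>F z in nhds z. detA z \<noteq> 0" using D eventually_nhds_in_open by fastforce
  have z1: "\<forall>\<^sub>F z in nhds z. G1 w z + h1 w z * A11 z + h2 w z * A12 z = 0"
    using ev by eventually_elim (use G_slice(1) in \<open>simp add: slice_def G_linear G_q\<close>)
  have z2: "\<forall>\<^sub>F z in nhds z. G2 w z + h1 w z * A12 z + h2 w z * A22 z = 0"
    using ev by eventually_elim (use G_slice(2) in \<open>simp add: slice_def G_linear G_q\<close>)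
  have e1: "(M11 w z * k $ 1 + M12 w z * k $ 2) + (h1 w z * (M11 q1 z * k $ 1 + M12 q1 z * k $ 2) + d1 k * A11 z)
      + (h2 w z * (M11 q2 z * k $ 1 + M12 q2 z * k $ 2) + d2 k * A12 z) = 0" for k
  proof -
    have "((\<lambda>z. G1 w z + h1 w z * A11 z + h2 w z * A12 z) has_derivative (\<lambda>k. (M11 w z * k $ 1 + M12 w z * k $ 2) + (h1 w z * (M11 q1 z * k $ 1 + M12 q1 z * k $ 2) + d1 k * A11 z)
      + (h2 w z * (M11 q2 z * k $ 1 + M12 q2 z * k $ 2) + d2 k * A12 z))) (at z)"
      by (intro has_derivative_add has_derivative_mult has_derivative_G d1 d2 has_derivative_A)
    moreover have "((\<lambda>z. G1 w z + h1 w z * A11 z + h2 w z * A12 z) has_derivative (\<lambda>k. 0)) (at z)"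
      using z1 by (intro has_derivative_transform_eventually[OF has_derivative_const[of 0 "at z"]])
        (auto simp: eventually_nhds eventually_at_filter elim: eventually_mono dest: eventually_nhds_x_imp_x)
    ultimately show ?thesis using has_derivative_unique by (metis (no_types, lifting))
  qed
  have e2: "(M21 w z * k $ 1 + M22 w z * k $ 2) + (h1 w z * (M21 q1 z * k $ 1 + M22 q1 z * k $ 2) + d1 k * A12 z)
      + (h2 w z * (M21 q2 z * k $ 1 + M22 q2 z * k $ 2) + d2 k * A22 z) = 0" for k
  proof -
    have "((\<lambda>z. G2 w z + h1 w z * A12 z + h2 w z * A22 z) has_derivative (\<lambda>k. (M21 w z * k $ 1 + M22 w z * k $ 2) + (h1 w z * (M21 q1 z * k $ 1 + M22 q1 z * k $ 2) + d1 k * A12 z)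
      + (h2 w z * (M21 q2 z * k $ 1 + M22 q2 z * k $ 2) + d2 k * A22 z))) (at z)"
      by (intro has_derivative_add has_derivative_mult has_derivative_G d1 d2 has_derivative_A)
    moreover have "((\<lambda>z. G2 w z + h1 w z * A12 z + h2 w z * A22 z) has_derivative (\<lambda>k. 0)) (at z)"
      using z2 by (intro has_derivative_transform_eventually[OF has_derivative_const[of 0 "at z"]])
        (auto simp: eventually_nhds eventually_at_filter elim: eventually_mono dest: eventually_nhds_x_imp_x)
    ultimately show ?thesis using has_derivative_unique by (metis (no_types, lifting))
  qed
  have Ms: "M11 (slice w z) z = M11 w z + h1 w z * M11 q1 z + h2 w z * M11 q2 z"
    "M12 (slice w z) z = M12 w z + h1 w z * M12 q1 z + h2 w z * M12 q2 z"
    "M21 (slice w z) z = M21 w z + h1 w z * M21 q1 z + h2 w z * M21 q2 z"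
    "M22 (slice w z) z = M22 w z + h1 w z * M22 q1 z + h2 w z * M22 q2 z"
    by (simp_all add: slice_def M_linear)
  have r1: "d1 k * A11 z + d2 k * A12 z = - (M11 (slice w z) z * k $ 1 + M12 (slice w z) z * k $ 2)" for k
    using e1[of k] unfolding Ms by (simp add: algebra_simps)
  have r2: "d1 k * A12 z + d2 k * A22 z = - (M21 (slice w z) z * k $ 1 + M22 (slice w z) z * k $ 2)" for k
    using e2[of k] unfolding Ms by (simp add: algebra_simps)
  have "d1 k = J11 w z * k $ 1 + J12 w z * k $ 2" for k
  proof -
    have "d1 k * detA z = (d1 k * A11 z + d2 k * A12 z) * A22 z - (d1 k * A12 z + d2 k * A22 z) * A12 z"
      by (simp add: detA_def algebra_simps)
    also have "\<dots> = (J11 w z * k $ 1 + J12 w z * k $ 2) * detA z"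
      unfolding r1 r2 J11_def J12_def using D by (simp add: field_simps)
    finally show ?thesis using D by simp
  qed
  then show "(h1 w has_derivative (\<lambda>k. J11 w z * k $ 1 + J12 w z * k $ 2)) (at z)" using d1 by (metis (no_types, lifting) ext)
  have "d2 k = J21 w z * k $ 1 + J22 w z * k $ 2" for k
  proof -
    have "d2 k * detA z = (d1 k * A12 z + d2 k * A22 z) * A11 z - (d1 k * A11 z + d2 k * A12 z) * A12 z"
      by (simp add: detA_def algebra_simps)
    also have "\<dots> = (J21 w z * k $ 1 + J22 w z * k $ 2) * detA z"
      unfolding r1 r2 J21_def J22_def using D by (simp add: field_simps)
    finally show ?thesis using D by simp
  qed
  then show "(h2 w has_derivative (\<lambda>k. J21 w z * k $ 1 + J22 w z * k $ 2)) (at z)" using d2 by (metis (no_types, lifting) ext)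
qed

text \<open>In dimension two the sign in - A^(-1) M does not change the determinant.\<close>

lemma det_J: "detA z \<noteq> 0 \<Longrightarrow> J11 w z * J22 w z - J12 w z * J21 w z = detM (slice w z) z / detA z"
proof -
  assume D: "detA z \<noteq> 0"
  have "(x21 * b - x11 * d) * (x12 * b - x22 * a) - (x22 * b - x12 * d) * (x11 * b - x21 * a) =
      (x11 * x22 - x12 * x21) * (a * d - b * b)" for x11 x12 x21 x22 a b d :: real
    by (simp add: algebra_simps)
  then show ?thesis unfolding J11_def J12_def J21_def J22_def detM_def using D
    by (simp add: times_divide_times_eq diff_divide_distrib[symmetric] detA_def[symmetric])
qed

text \<open>The extra equation \<zeta> = 0 allows two uses of one formula: with \<zeta> constantly 0
  all solutions are counted, with the degeneracy function only those to be excluded.\<close>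

definition nsol :: "(real^2 \<Rightarrow> real) \<Rightarrow> real_poly3 \<Rightarrow> ennreal" where
  "nsol \<zeta> v = emeasure (count_space UNIV) {z. detA z \<noteq> 0 \<and> \<zeta> z = 0 \<and> G1 v z = 0 \<and> G2 v z = 0 \<and> F0 v z \<noteq> 0}"

lemma measurable_dir [measurable]: "dir \<in> borel_measurable borel"
  unfolding dir_def[abs_def] by measurable

lemma measurable_F:
  assumes [measurable]: "X \<in> measurable N poly_sigma" "g \<in> borel_measurable N"
  shows "(\<lambda>x. F0 (X x) (g x)) \<in> borel_measurable N" "(\<lambda>x. F1 (X x) (g x)) \<in> borel_measurable N"
    "(\<lambda>x. F2 (X x) (g x)) \<in> borel_measurable N" "(\<lambda>x. H11 (X x) (g x)) \<in> borel_measurable N"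
    "(\<lambda>x. H12 (X x) (g x)) \<in> borel_measurable N" "(\<lambda>x. H22 (X x) (g x)) \<in> borel_measurable N"
  unfolding F0_def F1_def F2_def H11_def H12_def H22_def by measurable

lemma measurable_r2 [measurable]: "r2 \<in> borel_measurable borel"
  by (intro borel_measurable_continuous_onI continuous_r2)

lemma measurable_A [measurable]: "A11 \<in> borel_measurable borel" "A12 \<in> borel_measurable borel"
   "A22 \<in> borel_measurable borel" "detA \<in> borel_measurable borel"
  by (rule borel_measurable_continuous_onI, rule continuous_A)+

lemma measurable_G:
  assumes [measurable]: "X \<in> measurable N poly_sigma" "g \<in> borel_measurable N"
  shows "(\<lambda>x. G1 (X x) (g x)) \<in> borel_measurable N" "(\<lambda>x. G2 (X x) (g x)) \<in> borel_measurable N"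
proof -
  note [measurable] = measurable_F[OF assms]
  show "(\<lambda>x. G1 (X x) (g x)) \<in> borel_measurable N" "(\<lambda>x. G2 (X x) (g x)) \<in> borel_measurable N"
    unfolding G1_def G2_def by measurable
qed

lemma measurable_slice:
  assumes [measurable]: "X \<in> measurable N poly_sigma" "g \<in> borel_measurable N"
  shows "(\<lambda>x. h1 (X x) (g x)) \<in> borel_measurable N" "(\<lambda>x. h2 (X x) (g x)) \<in> borel_measurable N"
    "(\<lambda>x. slice (X x) (g x)) \<in> measurable N poly_sigma"
proof -
  note [measurable] = measurable_G[OF assms]
  show [measurable]: "(\<lambda>x. h1 (X x) (g x)) \<in> borel_measurable N" "(\<lambda>x. h2 (X x) (g x)) \<in> borel_measurable N"
    unfolding h1_def h2_def by measurable
  show "(\<lambda>x. slice (X x) (g x)) \<in> measurable N poly_sigma" unfolding slice_def by measurable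
qed

lemma measurable_detM:
  assumes [measurable]: "X \<in> measurable N poly_sigma" "g \<in> borel_measurable N"
  shows "(\<lambda>x. detM (X x) (g x)) \<in> borel_measurable N"
proof -
  note [measurable] = measurable_F[OF assms]
  show ?thesis unfolding detM_def M11_def M12_def M21_def M22_def by measurable
qed

lemma measurable_nsol [measurable]:
  assumes \<zeta>: "continuous_on UNIV \<zeta>"
  shows "nsol \<zeta> \<in> borel_measurable poly_sigma"
proof -
  \<comment> \<open>The last two terms encode \<open>F0 v z \<noteq> 0\<close> and
    \<open>detA z \<noteq> 0\<close> by a lower bound 1 / (k + 1) on both moduli.\<close>
  define \<Phi> where "\<Phi> k v z = \<bar>\<zeta> z\<bar> + \<bar>G1 v z\<bar> + \<bar>G2 v z\<bar> + max 0 (1 / real (Suc k) - \<bar>F0 v z\<bar>) + max 0 (1 / real (Suc k) - \<bar>detA z\<bar>)" for k :: nat and v z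
  have "(\<lambda>v. emeasure (count_space UNIV) {z. \<exists>k. \<Phi> k v z = 0}) \<in> borel_measurable poly_sigma"
  proof (rule borel_measurable_card_zeros)
    show "continuous_on UNIV (\<Phi> k v)" for k v unfolding \<Phi>_def[abs_def]
      by (intro continuous_intros \<zeta> continuous_G continuous_F continuous_A)
    show "\<Phi> k v z \<ge> 0" for k v z unfolding \<Phi>_def by simp
    show "(\<lambda>v. \<Phi> k v z) \<in> borel_measurable poly_sigma" for k z
      unfolding \<Phi>_def using measurable_G[of "\<lambda>v. v" poly_sigma "\<lambda>_. z"] measurable_F(1)[of "\<lambda>v. v" poly_sigma "\<lambda>_. z"] by measurable
  qed
  moreover have "(\<exists>k. \<Phi> k v z = 0) \<longleftrightarrow> detA z \<noteq> 0 \<and> \<zeta> z = 0 \<and> G1 v z = 0 \<and> G2 v z = 0 \<and> F0 v z \<noteq> 0" for v z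
  proof
    assume "\<exists>k. \<Phi> k v z = 0"
    then obtain k where k: "\<Phi> k v z = 0" ..
    have pos: "1 / real (Suc k) > 0" by simp
    have "\<bar>\<zeta> z\<bar> = 0" "\<bar>G1 v z\<bar> = 0" "\<bar>G2 v z\<bar> = 0" "max 0 (1 / real (Suc k) - \<bar>F0 v z\<bar>) = 0" "max 0 (1 / real (Suc k) - \<bar>detA z\<bar>) = 0"
      using k unfolding \<Phi>_def by linarith+
    then show "detA z \<noteq> 0 \<and> \<zeta> z = 0 \<and> G1 v z = 0 \<and> G2 v z = 0 \<and> F0 v z \<noteq> 0"
      using pos by (auto simp: max_def split: if_splits)
  next
    assume *: "detA z \<noteq> 0 \<and> \<zeta> z = 0 \<and> G1 v z = 0 \<and> G2 v z = 0 \<and> F0 v z \<noteq> 0"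
    then have "min \<bar>F0 v z\<bar> \<bar>detA z\<bar> > 0" by simp
    then obtain k where "1 / real (Suc k) < min \<bar>F0 v z\<bar> \<bar>detA z\<bar>" using nat_approx_posE by blast
    then have "\<Phi> k v z = 0" using * unfolding \<Phi>_def by simp
    then show "\<exists>k. \<Phi> k v z = 0" ..
  qed
  ultimately show ?thesis unfolding nsol_def[abs_def] by simp
qed

definition kr_integrand :: "(real^2 \<Rightarrow> real) \<Rightarrow> real_poly3 \<Rightarrow> real^2 \<Rightarrow> ennreal" where
  "kr_integrand \<zeta> v z = (if detA z \<noteq> 0 \<and> \<zeta> z = 0 \<and> F0 (slice v z) z \<noteq> 0
     then ennreal (\<bar>detM (slice v z) z / detA z\<bar> * gauss2 (h1 v z *\<^sub>R axis 1 1 + h2 v z *\<^sub>R axis 2 1)) else 0)"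

text \<open>With \<open>w\<close> fixed, the point z solves the system for
  \<open>s *\<^sub>R q1 + t *\<^sub>R q2 + w\<close> iff \<open>(h1 w z, h2 w z) = (s, t)\<close>.
  The count is therefore the multiplicity of \<open>h\<close> at a Gaussian point of the
  plane.\<close>

lemma kac_rice_fixed:
  assumes \<zeta>: "continuous_on UNIV \<zeta>"
  shows "(\<integral>\<^sup>+s. \<integral>\<^sup>+t. nsol \<zeta> (s *\<^sub>R q1 + t *\<^sub>R q2 + w) \<partial>gauss \<partial>gauss) = (\<integral>\<^sup>+z. kr_integrand \<zeta> w z \<partial>lborel)"
proof -
  note [measurable] = measurable_nsol[OF \<zeta>]
  define U where "U = {z. detA z \<noteq> 0}"
  define h :: "real^2 \<Rightarrow> real^2" where "h z = h1 w z *\<^sub>R axis 1 1 + h2 w z *\<^sub>R axis 2 1" for z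
  define J :: "real^2 \<Rightarrow> real^2^2" where
    "J z = (\<chi> i j. if i = 1 then (if j = 1 then J11 w z else J12 w z) else (if j = 1 then J21 w z else J22 w z))" for z
  define D where "D = {z. detA z \<noteq> 0 \<and> \<zeta> z = 0 \<and> F0 (slice w z) z \<noteq> 0}"
  have hc: "h z $ 1 = h1 w z" "h z $ 2 = h2 w z" for z by (simp_all add: h_def axis_def)
  have \<zeta>m[measurable]: "\<zeta> \<in> borel_measurable borel" using \<zeta> by (rule borel_measurable_continuous_onI)
  have [measurable]: "(\<lambda>z. F0 (slice w z) z) \<in> borel_measurable borel"
    by (intro measurable_F measurable_slice) auto
  \<comment> \<open>On the fibre the polynomial is the slice itself, so its nonvanishing at z
    becomes a condition on z alone and can go into the domain \<open>D\<close>.\<close>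
  have set_eq: "{z. detA z \<noteq> 0 \<and> \<zeta> z = 0 \<and> G1 (s *\<^sub>R q1 + t *\<^sub>R q2 + w) z = 0 \<and> G2 (s *\<^sub>R q1 + t *\<^sub>R q2 + w) z = 0 \<and> F0 (s *\<^sub>R q1 + t *\<^sub>R q2 + w) z \<noteq> 0}
     = {z\<in>D. h z = \<xi>}" if "\<xi> $ 1 = s" "\<xi> $ 2 = t" for s t and \<xi> :: "real^2"
  proof -
    have comm: "s *\<^sub>R q1 + t *\<^sub>R q2 + w = w + s *\<^sub>R q1 + t *\<^sub>R q2" by (simp add: ac_simps)
    have "h z = \<xi> \<longleftrightarrow> h1 w z = s \<and> h2 w z = t" for z using that by (auto simp: vec_eq_iff forall_2 hc)
    moreover have "G1 (w + s *\<^sub>R q1 + t *\<^sub>R q2) z = 0 \<and> G2 (w + s *\<^sub>R q1 + t *\<^sub>R q2) z = 0 \<longleftrightarrow> h1 w z = s \<and> h2 w z = t" if "detA z \<noteq> 0" for z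
      using slice_unique[OF that, of w s t] G_slice[OF that, of w] unfolding slice_def by metis
    ultimately show ?thesis unfolding comm D_def slice_def by auto
  qed
  have "(\<integral>\<^sup>+s. \<integral>\<^sup>+t. nsol \<zeta> (s *\<^sub>R q1 + t *\<^sub>R q2 + w) \<partial>gauss \<partial>gauss) =
      (\<integral>\<^sup>+\<xi>. nsol \<zeta> ((\<xi> $ 1) *\<^sub>R q1 + (\<xi> $ 2) *\<^sub>R q2 + w) * ennreal (gauss2 \<xi>) \<partial>lborel)"
    by (rule nn_integral_gauss_vec2) measurable
  also have "\<dots> = (\<integral>\<^sup>+\<xi>. emeasure (count_space UNIV) {z\<in>D. h z = \<xi>} * ennreal (gauss2 \<xi>) \<partial>lebesgue)"
    unfolding nsol_def set_eq[OF refl refl] by (simp add: nn_integral_completion)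
  also have "\<dots> = (\<integral>\<^sup>+z. indicator D z * ennreal (\<bar>det (matrix ((*v) (J z)))\<bar> * gauss2 (h z)) \<partial>lebesgue)"
  proof (rule area_formula)
    show "open U" unfolding U_def using continuous_A(4)[of UNIV] by (intro open_Collect_neq) (auto simp: continuous_on_const)
    show "D \<subseteq> U" by (auto simp: D_def U_def)
    show "D \<in> sets borel" unfolding D_def by measurable
    show "(h has_derivative (*v) (J z)) (at z)" if "z \<in> U" for z
    proof -
      have "(h has_derivative (\<lambda>k. (J11 w z * k $ 1 + J12 w z * k $ 2) *\<^sub>R axis 1 1 + (J21 w z * k $ 1 + J22 w z * k $ 2) *\<^sub>R axis 2 1)) (at z)"
        unfolding h_def[abs_def] using that
        by (intro has_derivative_add has_derivative_scaleR_left has_derivative_h) (auto simp: U_def)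
      moreover have "(\<lambda>k. (J11 w z * k $ 1 + J12 w z * k $ 2) *\<^sub>R axis 1 1 + (J21 w z * k $ 1 + J22 w z * k $ 2) *\<^sub>R axis 2 1) = (*v) (J z)"
        by (simp add: fun_eq_iff vec_eq_iff forall_2 J_def matrix_vector_mult_def sum_2 axis_def)
      ultimately show ?thesis by simp
    qed
    have slice_M: "M11 (slice w z) z = M11 w z + h1 w z * M11 q1 z + h2 w z * M11 q2 z"
      "M12 (slice w z) z = M12 w z + h1 w z * M12 q1 z + h2 w z * M12 q2 z"
      "M21 (slice w z) z = M21 w z + h1 w z * M21 q1 z + h2 w z * M21 q2 z"
      "M22 (slice w z) z = M22 w z + h1 w z * M22 q1 z + h2 w z * M22 q2 z" for z
      by (simp_all add: slice_def M_linear)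
    have cJ: "continuous_on U (J11 w)" "continuous_on U (J12 w)" "continuous_on U (J21 w)" "continuous_on U (J22 w)"
      unfolding J11_def[abs_def] J12_def[abs_def] J21_def[abs_def] J22_def[abs_def] slice_M
      by (intro continuous_intros continuous_M continuous_A continuous_h; simp add: U_def)+
    have "continuous_on U J" unfolding J_def[abs_def]
    proof (intro continuous_on_vec_lambda)
      fix i j :: 2
      show "continuous_on U (\<lambda>z. if i = 1 then (if j = 1 then J11 w z else J12 w z) else (if j = 1 then J21 w z else J22 w z))"
        using cJ by (cases "i = 1"; cases "j = 1") simp_all
    qed
    then show "continuous_on U (\<lambda>z. matrix ((*v) (J z)))" by (simp add: matrix_of_matrix_vector_mul)
    show "integrable lborel gauss2" by (rule integrable_gauss2)
    show "gauss2 x \<ge> 0" for x by (simp add: gauss2_def)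
  qed
  also have "\<dots> = (\<integral>\<^sup>+z. kr_integrand \<zeta> w z \<partial>lborel)"
    unfolding nn_integral_completion
  proof (rule nn_integral_cong)
    fix z
    have "det (J z) = J11 w z * J22 w z - J12 w z * J21 w z" by (simp add: det_2 J_def)
    then show "indicator D z * ennreal (\<bar>det (matrix ((*v) (J z)))\<bar> * gauss2 (h z)) = kr_integrand \<zeta> w z"
      unfolding kr_integrand_def h_def[symmetric]
      by (auto simp: D_def det_J matrix_of_matrix_vector_mul)
  qed
  finally show ?thesis .
qed

end

section \<open>The density at a fixed point of the chart, in an adapted frame\<close>

lemma (in frame) bombieri_first_order:
  "ip (sqrt (real p) *\<^sub>R (linear_form w ^ Suc m * linear_form a)) (sqrt (real p) *\<^sub>R (linear_form w' ^ Suc m * linear_form b)) =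
    real (Suc m) * (a \<bullet> w') * ((w \<bullet> w') ^ m * (w \<bullet> b)) + (a \<bullet> b) * (w \<bullet> w') ^ Suc m"
proof -
  have "ip (sqrt (real p) *\<^sub>R (linear_form w ^ Suc m * linear_form a)) (sqrt (real p) *\<^sub>R (linear_form w' ^ Suc m * linear_form b)) =
    sqrt (real p) * sqrt (real p) * ip (linear_form w ^ Suc m * linear_form a) (linear_form w' ^ Suc m * linear_form b)"
    by (simp only: bombieri_scaleR_left bombieri_scaleR_right mult.assoc)
  also have "\<dots> = real p * ip (linear_form w ^ Suc m * linear_form a) (linear_form w' ^ Suc m * linear_form b)"
    by (simp only: p_pos(2))
  finally show ?thesis by (simp only: bombieri_power_mult_power_mult)
qed

lemma linear_form_power_mult_sym_power:
  "linear_form w ^ Suc k * linear_form a \<in> sym_power (Suc (Suc k))"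
  "linear_form w ^ k * (linear_form a * linear_form b) \<in> sym_power (Suc (Suc k))"
proof -
  show "linear_form w ^ Suc k * linear_form a \<in> sym_power (Suc (Suc k))"
    using sym_power_mult[OF linear_form_power_sym_power[of w "Suc k"] linear_form_sym_power[of a]] by simp
  show "linear_form w ^ k * (linear_form a * linear_form b) \<in> sym_power (Suc (Suc k))"
    using sym_power_mult[OF linear_form_power_sym_power[of w k] sym_power_mult[OF linear_form_sym_power[of a] linear_form_sym_power[of b]]]
    by (simp add: numeral_2_eq_2)
qed

lemma linear_form_diff: "linear_form (a - b) = linear_form a - linear_form b"
  using linear_form_add[of a "- b"] linear_form_scaleR[of "-1" b] by simp

text \<open>At a point with polar coordinates \<open>\<rho>\<close>, \<open>(c, s)\<close>, the frame \<open>uh\<close>, \<open>e'\<close>, \<open>f'\<close> consists of the normalized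
  direction, the radial and the angular tangent vector.\<close>

locale frame_at = frame +
  fixes z :: "real^2" and c s \<rho> :: real
  assumes z_polar: "z $ 1 = \<rho> * c" "z $ 2 = \<rho> * s" and cs: "c\<^sup>2 + s\<^sup>2 = 1"
begin

definition R where "R = sqrt (1 + \<rho>\<^sup>2)"
definition e'' where "e'' = c *\<^sub>R e + s *\<^sub>R f"
definition f' where "f' = c *\<^sub>R f - s *\<^sub>R e"
definition uh where "uh = (1 / R) *\<^sub>R (n + \<rho> *\<^sub>R e'')"
definition e' where "e' = (1 / R) *\<^sub>R (e'' - \<rho> *\<^sub>R n)"

lemma R: "R > 0" "R * R = 1 + \<rho>\<^sup>2" "R \<noteq> 0" "R\<^sup>2 = 1 + \<rho>\<^sup>2"
proof -
  show "R > 0" by (simp add: R_def add_pos_nonneg)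
  then show "R \<noteq> 0" by simp
  show "R\<^sup>2 = 1 + \<rho>\<^sup>2" by (simp add: R_def)
  then show "R * R = 1 + \<rho>\<^sup>2" by (simp add: power2_eq_square)
qed

lemma cs_mult: "c * c + s * s = 1" "s * s + c * c = 1" "c * c = 1 - s * s"
  using cs by (auto simp: power2_eq_square)

lemma r2_z: "r2 z = R * R"
proof -
  have "r2 z = 1 + \<rho>\<^sup>2 * (c\<^sup>2 + s\<^sup>2)" by (simp add: r2_def z_polar power_mult_distrib algebra_simps)
  then show ?thesis by (simp add: cs R)
qed

lemma dir_z: "dir z = R *\<^sub>R uh"
  using R(3) by (simp add: dir_def uh_def e''_def z_polar algebra_simps)

lemma base_inner: "e'' \<bullet> e'' = 1" "e'' \<bullet> n = 0" "n \<bullet> e'' = 0" "f' \<bullet> f' = 1" "f' \<bullet> n = 0" "n \<bullet> f' = 0" "e'' \<bullet> f' = 0" "f' \<bullet> e'' = 0"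
  by (simp_all add: e''_def f'_def inner_add_left inner_add_right inner_diff_left inner_diff_right unit perp perp' cs_mult)

lemma frame_inner:
  "uh \<bullet> uh = 1" "e' \<bullet> e' = 1" "uh \<bullet> e' = 0" "e' \<bullet> uh = 0" "uh \<bullet> f' = 0" "f' \<bullet> uh = 0" "e' \<bullet> f' = 0" "f' \<bullet> e' = 0"
  "n \<bullet> uh = 1 / R" "n \<bullet> e' = - \<rho> / R" "e'' \<bullet> uh = \<rho> / R" "e'' \<bullet> e' = 1 / R"
proof -
  have R': "1 + \<rho> * \<rho> = R * R" using R(2) by (simp add: power2_eq_square)
  have RR: "1 / R * (1 / R * (1 + \<rho> * \<rho>)) = 1" unfolding R' using R(3) by simp
  have "(n + \<rho> *\<^sub>R e'') \<bullet> (n + \<rho> *\<^sub>R e'') = 1 + \<rho> * \<rho>" "(e'' - \<rho> *\<^sub>R n) \<bullet> (e'' - \<rho> *\<^sub>R n) = 1 + \<rho> * \<rho>"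
    by (simp_all add: inner_add_left inner_add_right inner_diff_left inner_diff_right base_inner unit)
  then show "uh \<bullet> uh = 1" "e' \<bullet> e' = 1"
    unfolding uh_def e'_def inner_scaleR_left inner_scaleR_right by (simp_all only: RR)
qed (simp_all add: uh_def e'_def inner_add_left inner_add_right inner_diff_left inner_diff_right base_inner unit)

abbreviation lu where "lu \<equiv> linear_form uh"
abbreviation le where "le \<equiv> linear_form e'"
abbreviation lf where "lf \<equiv> linear_form f'"

text \<open>\<open>x1\<close>, \<open>x2\<close> represent the gradient at the point itself,
  \<open>g1\<close>, \<open>g2\<close> are \<open>q1\<close>, \<open>q2\<close> rotated to the
  radial and angular directions. In these polar directions the matrix of inner products between the
  two pairs is diagonal, with entries \<open>a1\<close> and \<open>a2\<close>.\<close>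

definition x1 where "x1 = sqrt (real p) *\<^sub>R (lu ^ Suc m * le)"
definition x2 where "x2 = sqrt (real p) *\<^sub>R (lu ^ Suc m * lf)"
definition g1 where "g1 = sqrt (real p) *\<^sub>R (linear_form n ^ Suc m * linear_form e'')"
definition g2 where "g2 = sqrt (real p) *\<^sub>R (linear_form n ^ Suc m * linear_form f')"
definition a1 where "a1 = (1 / R) ^ Suc (Suc m) * (1 - real (Suc m) * \<rho>\<^sup>2)"
definition a2 where "a2 = (1 / R) ^ Suc m"

lemma g_q: "g1 = c *\<^sub>R q1 + s *\<^sub>R q2" "g2 = c *\<^sub>R q2 - s *\<^sub>R q1"
  unfolding g1_def g2_def q1_def q2_def e''_def f'_def
  by (simp_all add: linear_form_add linear_form_diff linear_form_scaleR distrib_left right_diff_distrib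
    poly_scaleR_mult_left poly_scaleR_mult_right scaleR_add_right scaleR_diff_right mult.commute del: power_Suc of_nat_Suc)

lemma x_g_sym_power: "x1 \<in> sym_power p" "x2 \<in> sym_power p" "g1 \<in> sym_power p" "g2 \<in> sym_power p"
  unfolding x1_def x2_def g1_def g2_def
  by (intro sym_power_scaleR linear_form_power_mult_sym_power)+

lemma x_g_inner:
  "ip x1 x1 = 1" "ip x2 x2 = 1" "ip x1 x2 = 0" "ip x2 x1 = 0" "ip g1 g1 = 1" "ip g2 g2 = 1" "ip g1 g2 = 0" "ip g2 g1 = 0"
  "ip g1 x2 = 0" "ip x2 g1 = 0" "ip g2 x1 = 0" "ip x1 g2 = 0" "ip g1 x1 = a1" "ip x1 g1 = a1" "ip g2 x2 = a2" "ip x2 g2 = a2"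
proof -
  show "ip x1 x1 = 1" "ip x2 x2 = 1" "ip x1 x2 = 0" "ip x2 x1 = 0" "ip g1 g1 = 1" "ip g2 g2 = 1" "ip g1 g2 = 0" "ip g2 g1 = 0"
    unfolding x1_def x2_def g1_def g2_def bombieri_first_order by (simp_all add: frame_inner base_inner unit)
  show *: "ip g1 x2 = 0" "ip g2 x1 = 0" "ip g2 x2 = a2"
    unfolding x1_def x2_def g1_def g2_def bombieri_first_order by (simp_all add: frame_inner base_inner unit a2_def)
  show a1: "ip g1 x1 = a1"
  proof -
    have "real (Suc m) * (\<rho> * i) * (i ^ m * (- \<rho> * i)) + i * i ^ Suc m = i ^ Suc (Suc m) * (1 - real (Suc m) * \<rho>\<^sup>2)" for i :: real
      by (simp add: power2_eq_square algebra_simps)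
    from this[of "1 / R"] show ?thesis
      unfolding x1_def g1_def bombieri_first_order frame_inner a1_def
      by (simp only: times_divide_eq_right mult_1_right)
  qed
  show "ip x2 g1 = 0" "ip x1 g2 = 0" "ip x1 g1 = a1" "ip x2 g2 = a2"
    using * a1 by (simp_all add: bombieri_commute)
qed

lemma e_f_expand:
  "e = (\<rho> * c / R) *\<^sub>R uh + (c / R) *\<^sub>R e' - s *\<^sub>R f'"
  "f = (\<rho> * s / R) *\<^sub>R uh + (s / R) *\<^sub>R e' + c *\<^sub>R f'"
proof -
  have "(\<rho> / R) *\<^sub>R uh + (1 / R) *\<^sub>R e' = ((1 + \<rho>\<^sup>2) / (R * R)) *\<^sub>R e''"
    using R(3) by (simp add: uh_def e'_def algebra_simps power2_eq_square add_divide_distrib)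
  also have "\<dots> = e''" using R(3) by (simp add: R(2)[symmetric])
  finally have ee: "e'' = (\<rho> / R) *\<^sub>R uh + (1 / R) *\<^sub>R e'" ..
  have "e = c *\<^sub>R e'' - s *\<^sub>R f'" "f = s *\<^sub>R e'' + c *\<^sub>R f'"
  proof -
    have "c *\<^sub>R e'' - s *\<^sub>R f' = (c * c + s * s) *\<^sub>R e" "s *\<^sub>R e'' + c *\<^sub>R f' = (c * c + s * s) *\<^sub>R f"
      unfolding e''_def f'_def by (simp_all add: algebra_simps)
    then show "e = c *\<^sub>R e'' - s *\<^sub>R f'" "f = s *\<^sub>R e'' + c *\<^sub>R f'" by (simp_all add: cs_mult)
  qed
  then show "e = (\<rho> * c / R) *\<^sub>R uh + (c / R) *\<^sub>R e' - s *\<^sub>R f'"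
    "f = (\<rho> * s / R) *\<^sub>R uh + (s / R) *\<^sub>R e' + c *\<^sub>R f'"
    unfolding ee by (simp_all add: algebra_simps)
qed

lemma lin_e_f:
  "linear_form e = (\<rho> * c / R) *\<^sub>R lu + (c / R) *\<^sub>R le + (- s) *\<^sub>R lf"
  "linear_form f = (\<rho> * s / R) *\<^sub>R lu + (s / R) *\<^sub>R le + c *\<^sub>R lf"
proof -
  have "e = (\<rho> * c / R) *\<^sub>R uh + (c / R) *\<^sub>R e' + (- s) *\<^sub>R f'" using e_f_expand(1) by simp
  then show "linear_form e = (\<rho> * c / R) *\<^sub>R lu + (c / R) *\<^sub>R le + (- s) *\<^sub>R lf"
    by (metis linear_form_add linear_form_scaleR)
  show "linear_form f = (\<rho> * s / R) *\<^sub>R lu + (s / R) *\<^sub>R le + c *\<^sub>R lf"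
    using e_f_expand(2) by (metis linear_form_add linear_form_scaleR)
qed

lemma lin_dir_power: "linear_form (dir z) ^ k = R ^ k *\<^sub>R lu ^ k"
  by (simp only: dir_z linear_form_scaleR poly_scaleR_power)

abbreviation Y0 where "Y0 v \<equiv> ip v (lu ^ p)"

lemma F0_z: "F0 v z = R ^ p * Y0 v"
  unfolding F0_def mult_1_right lin_dir_power bombieri_scaleR_right ..

lemma F12_z:
  "F1 v z = R ^ Suc m * (\<rho> * c / R * Y0 v + (c / R) * ip v (lu ^ Suc m * le) - s * ip v (lu ^ Suc m * lf))"
  "F2 v z = R ^ Suc m * (\<rho> * s / R * Y0 v + (s / R) * ip v (lu ^ Suc m * le) + c * ip v (lu ^ Suc m * lf))"
proof -
  have luu: "lu ^ Suc m * lu = lu ^ p" by (simp add: mult.commute mult.left_commute)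
  show "F1 v z = R ^ Suc m * (\<rho> * c / R * Y0 v + (c / R) * ip v (lu ^ Suc m * le) - s * ip v (lu ^ Suc m * lf))"
    "F2 v z = R ^ Suc m * (\<rho> * s / R * Y0 v + (s / R) * ip v (lu ^ Suc m * le) + c * ip v (lu ^ Suc m * lf))"
    unfolding F1_def F2_def lin_dir_power lin_e_f
    by (simp_all only: distrib_left poly_scaleR_mult_left poly_scaleR_mult_right bombieri_add_right bombieri_scaleR_right luu)
       (simp_all add: algebra_simps)
qed

lemma ip_x: "ip x1 v = sqrt (real p) * ip v (lu ^ Suc m * le)" "ip x2 v = sqrt (real p) * ip v (lu ^ Suc m * lf)"
  unfolding x1_def x2_def bombieri_scaleR_left by (simp_all only: bombieri_commute[of p v])

text \<open>Without tangential gradient components, \<open>F1\<close> and \<open>F2\<close> at z are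
  proportional to the coordinates of z, with the factor that makes \<open>G\<close> vanish.\<close>

lemma G_z:
  assumes "ip x1 v = 0" "ip x2 v = 0"
  shows "G1 v z = 0" "G2 v z = 0"
proof -
  have 0: "ip v (lu ^ Suc m * le) = 0" "ip v (lu ^ Suc m * lf) = 0" using assms ip_x p_pos(4) by auto
  have 1: "R * R * (R ^ Suc m * (\<rho> * t / R * Y)) = \<rho> * t * (R ^ p * Y)" for t Y
    using R(3) by (simp add: field_simps)
  show "G1 v z = 0" "G2 v z = 0"
    unfolding G1_def G2_def F12_z F0_z r2_z z_polar 0 by (simp_all only: mult_zero_right add_0_right diff_zero 1 diff_self)
qed

definition h11 where "h11 v = ip v (lu ^ m * (le * le))"
definition h12 where "h12 v = ip v (lu ^ m * (le * lf))"
definition h22 where "h22 v = ip v (lu ^ m * (lf * lf))"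

lemma second_order_expand:
  assumes 0: "ip x1 v = 0" "ip x2 v = 0"
  shows "ip v (lu ^ m * ((\<alpha> *\<^sub>R lu + \<beta> *\<^sub>R le + \<gamma> *\<^sub>R lf) * (\<alpha>' *\<^sub>R lu + \<beta>' *\<^sub>R le + \<gamma>' *\<^sub>R lf))) =
    \<alpha> * \<alpha>' * Y0 v + \<beta> * \<beta>' * h11 v + (\<beta> * \<gamma>' + \<gamma> * \<beta>') * h12 v + \<gamma> * \<gamma>' * h22 v"
proof -
  have z: "ip v (lu ^ Suc m * le) = 0" "ip v (lu ^ Suc m * lf) = 0" using 0 ip_x p_pos(4) by auto
  have r: "lu ^ m * (lu * lu) = lu ^ p" "lu ^ m * (lu * le) = lu ^ Suc m * le" "lu ^ m * (lu * lf) = lu ^ Suc m * lf"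
     "lu ^ m * (le * lu) = lu ^ Suc m * le" "lu ^ m * (lf * lu) = lu ^ Suc m * lf" "lu ^ m * (lf * le) = lu ^ m * (le * lf)"
    by (simp_all add: ac_simps)
  show ?thesis
    by (simp only: distrib_left distrib_right poly_scaleR_mult_left poly_scaleR_mult_right bombieri_add_right bombieri_scaleR_right r z
        h11_def[symmetric] h12_def[symmetric] h22_def[symmetric])
      (simp add: algebra_simps)
qed

text \<open>At a solution the Jacobian is R^p Q B Q^T, where B is (p - 1) times the tangential
  Hessian minus the value times the identity, and Q, with columns (c / R, s / R) and (- s, c),
  expresses the chart directions in the tangent frame. Since det Q = 1 / R, the power of R is 2 p -
  2.\<close>

lemma detM_z:
  assumes 0: "ip x1 v = 0" "ip x2 v = 0"
  shows "detM v z = R ^ (2 * m + 2) *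
    ((real (Suc m) * h11 v - Y0 v) * (real (Suc m) * h22 v - Y0 v) - (real (Suc m) * h12 v)\<^sup>2)"
proof -
  define i where "i = 1 / R"
  have iR: "i * R = 1" "R * i = 1" using R(3) by (simp_all add: i_def)
  have div: "x / R = x * i" for x by (simp add: i_def)
  define y where "y = Y0 v"
  define k where "k = real (Suc m)"
  have km: "real m = k - 1" "real p = k + 1" by (simp_all add: k_def)
  define N where "N = R ^ p"
  have NR: "R * R * R ^ m = N" "R * R * (R ^ m * t) = N * t" for t by (simp_all add: N_def)
  have z0: "ip v (lu ^ Suc m * le) = 0" "ip v (lu ^ Suc m * lf) = 0" using 0 ip_x p_pos(4) by auto
  have F0v: "F0 v z = N * y" by (simp only: F0_z N_def y_def)
  have RSm: "R ^ Suc m = N * i" using iR by (simp add: N_def)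
  have F1v: "F1 v z = N * i * i * (\<rho> * c) * y" and F2v: "F2 v z = N * i * i * (\<rho> * s) * y"
    unfolding F12_z z0 RSm div y_def by (simp_all add: ac_simps)
  have H: "R * R * (k * H11 v z) = N * (k * ((\<rho> * c * i)\<^sup>2 * y + (c * i)\<^sup>2 * h11 v - 2 * (c * i) * s * h12 v + s\<^sup>2 * h22 v))"
    "R * R * (k * H12 v z) = N * (k * ((\<rho> * c * i) * (\<rho> * s * i) * y + (c * i) * (s * i) * h11 v + (c * i * c - s * (s * i)) * h12 v - s * c * h22 v))"
    "R * R * (k * H22 v z) = N * (k * ((\<rho> * s * i)\<^sup>2 * y + (s * i)\<^sup>2 * h11 v + 2 * (s * i) * c * h12 v + c\<^sup>2 * h22 v))"
    unfolding H11_def H12_def H22_def lin_dir_power lin_e_f poly_scaleR_mult_left bombieri_scaleR_right second_order_expand[OF 0] div y_def[symmetric] NR(1)[symmetric]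
    by (simp_all add: power2_eq_square algebra_simps)
  have i2: "i * i * (1 + \<rho> * \<rho>) = 1" using R(2) iR(1) by (metis mult.assoc mult.left_commute mult_1_right power2_eq_square)
  have cc: "c * c = 1 - s * s" by (rule cs_mult)
  define B11 where "B11 = k * h11 v - y"
  define B12 where "B12 = k * h12 v"
  define B22 where "B22 = k * h22 v - y"
  have M11v: "M11 v z = N * ((c * i)\<^sup>2 * B11 - 2 * (c * i) * s * B12 + s\<^sup>2 * B22)"
  proof -
    have e1: "M11 v z = N * (k * ((c * i)\<^sup>2 * h11 v - 2 * (c * i) * s * h12 v + s\<^sup>2 * h22 v) - y * (1 - (\<rho> * c * i)\<^sup>2))"
      unfolding M11_def r2_z k_def[symmetric] H F0v F1v F2v z_polar km by (simp add: power2_eq_square algebra_simps)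
    \<comment> \<open>This identity, a consequence of R^2 = 1 + \<rho>^2, collects all terms with
      the value into the diagonal shift of B.\<close>
    have e2: "1 - (\<rho> * c * i)\<^sup>2 = (c * i)\<^sup>2 + s\<^sup>2"
    proof -
      have "(c * i)\<^sup>2 + (\<rho> * c * i)\<^sup>2 = (c * c) * (i * i * (1 + \<rho> * \<rho>))" by (simp add: power2_eq_square algebra_simps)
      then show ?thesis by (simp add: i2 cc power2_eq_square)
    qed
    show ?thesis unfolding e1 e2 B11_def B12_def B22_def by (simp add: algebra_simps)
  qed
  have M22v: "M22 v z = N * ((s * i)\<^sup>2 * B11 + 2 * (s * i) * c * B12 + c\<^sup>2 * B22)"
  proof -
    have e1: "M22 v z = N * (k * ((s * i)\<^sup>2 * h11 v + 2 * (s * i) * c * h12 v + c\<^sup>2 * h22 v) - y * (1 - (\<rho> * s * i)\<^sup>2))"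
      unfolding M22_def r2_z k_def[symmetric] H F0v F1v F2v z_polar km by (simp add: power2_eq_square algebra_simps)
    have e2: "1 - (\<rho> * s * i)\<^sup>2 = (s * i)\<^sup>2 + c\<^sup>2"
    proof -
      have "(s * i)\<^sup>2 + (\<rho> * s * i)\<^sup>2 = (s * s) * (i * i * (1 + \<rho> * \<rho>))" by (simp add: power2_eq_square algebra_simps)
      then show ?thesis by (simp add: i2 cc power2_eq_square)
    qed
    show ?thesis unfolding e1 e2 B11_def B12_def B22_def by (simp add: algebra_simps)
  qed
  have off: "(\<rho> * c * i) * (\<rho> * s * i) = s * c - (c * i) * (s * i)"
  proof -
    have "(c * i) * (s * i) + (\<rho> * c * i) * (\<rho> * s * i) = (s * c) * (i * i * (1 + \<rho> * \<rho>))" by (simp add: algebra_simps)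
    then show ?thesis by (simp add: i2)
  qed
  have M12v: "M12 v z = N * ((c * i) * (s * i) * B11 + (c * i * c - s * (s * i)) * B12 - s * c * B22)"
  proof -
    have "M12 v z = N * (k * ((c * i) * (s * i) * h11 v + (c * i * c - s * (s * i)) * h12 v - s * c * h22 v) + y * ((\<rho> * c * i) * (\<rho> * s * i)))"
      unfolding M12_def r2_z k_def[symmetric] H F0v F1v F2v z_polar km by (simp add: algebra_simps)
    then show ?thesis unfolding off B11_def B12_def B22_def by (simp add: algebra_simps)
  qed
  have M21v: "M21 v z = M12 v z"
    unfolding M12_def M21_def r2_z k_def[symmetric] H F0v F1v F2v z_polar km by (simp add: algebra_simps)
  have "detM v z = N\<^sup>2 * ((c * i) * c + s * (s * i))\<^sup>2 * (B11 * B22 - B12\<^sup>2)"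
    unfolding detM_def M21v M11v M12v M22v by (simp add: power2_eq_square algebra_simps)
  also have "(c * i) * c + s * (s * i) = i" using cs_mult(1) by (simp add: algebra_simps) (metis distrib_left mult.commute mult_1_right mult.assoc)
  also have "N\<^sup>2 * i\<^sup>2 = R ^ (2 * m + 2)"
  proof -
    have "N * i = R ^ Suc m" by (simp only: RSm)
    then have "N\<^sup>2 * i\<^sup>2 = (R ^ Suc m)\<^sup>2" by (metis power_mult_distrib)
    then show ?thesis by (simp only: power_mult[symmetric]) (simp add: mult.commute)
  qed
  finally show ?thesis unfolding B11_def B12_def B22_def k_def y_def .
qed

text \<open>As the overlaps are diagonal, clearing the gradient along \<open>g1\<close> and then
  along \<open>g2\<close> leaves an element with both gradient components 0; it differs from
  \<open>v\<close> by the span of \<open>q1\<close>, \<open>q2\<close>, so uniqueness makes it the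
  slice.\<close>

lemma slice_z:
  assumes D: "detA z \<noteq> 0" and a: "a1 \<noteq> 0" "a2 \<noteq> 0"
  shows "slice v z = (v - (ip x1 v / a1) *\<^sub>R g1) - (ip x2 v / a2) *\<^sub>R g2"
proof -
  let ?V = "(v - (ip x1 v / a1) *\<^sub>R g1) - (ip x2 v / a2) *\<^sub>R g2"
  have 0: "ip x1 ?V = 0" "ip x2 ?V = 0" using a by (simp_all add: bombieri_linear x_g_inner)
  let ?x = "- (ip x1 v / a1) * c + (ip x2 v / a2) * s" and ?y = "- (ip x1 v / a1) * s - (ip x2 v / a2) * c"
  have V: "?V = v + ?x *\<^sub>R q1 + ?y *\<^sub>R q2" unfolding g_q by (simp add: algebra_simps)
  have "?x = h1 v z" "?y = h2 v z" using slice_unique[OF D, of v ?x ?y] G_z[OF 0] unfolding V by auto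
  then show ?thesis unfolding slice_def V by simp
qed

lemma a_neq_0: "detA z \<noteq> 0 \<Longrightarrow> a1 \<noteq> 0" "a2 \<noteq> 0" "detA z = R * R / real p * (1 - real (Suc m) * \<rho>\<^sup>2)"
proof -
  have "(z $ 1)\<^sup>2 + (z $ 2)\<^sup>2 = \<rho>\<^sup>2 * (c\<^sup>2 + s\<^sup>2)" by (simp add: z_polar power_mult_distrib distrib_left)
  then show D: "detA z = R * R / real p * (1 - real (Suc m) * \<rho>\<^sup>2)" unfolding detA_eq r2_z by (simp add: cs)
  show "detA z \<noteq> 0 \<Longrightarrow> a1 \<noteq> 0" using R(3) unfolding D a1_def by auto
  show "a2 \<noteq> 0" using R(3) by (simp add: a2_def)
qed

lemma gauss2_rotate: "gauss2 ((ip q1 v) *\<^sub>R axis 1 1 + (ip q2 v) *\<^sub>R axis 2 1) = std_normal_density (ip g1 v) * std_normal_density (ip g2 v)"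
proof -
  have "(ip g1 v)\<^sup>2 + (ip g2 v)\<^sup>2 = (c * c + s * s) * ((ip q1 v)\<^sup>2 + (ip q2 v)\<^sup>2)"
    unfolding g_q by (simp add: bombieri_linear power2_eq_square algebra_simps)
  then show ?thesis unfolding std_normal_density_mult gauss2_def by (simp add: cs_mult axis_def)
qed

lemma jets_power: "ip (lu ^ p) (lu ^ p) = 1"
  unfolding bombieri_powers by (simp add: frame_inner)

lemma jets_power_second:
  "ip (lu ^ p) (lu ^ m * (le * le)) = 0" "ip (lu ^ p) (lu ^ m * (lf * lf)) = 0" "ip (lu ^ p) (lu ^ m * (le * lf)) = 0"
  unfolding bombieri_commute[of p "lu ^ p"] mult.assoc[symmetric] bombieri_second_power
  by (simp_all add: frame_inner)

lemma jets_second: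
  "real p * real (Suc m) * ip (lu ^ m * (le * le)) (lu ^ m * (le * le)) = 2"
  "real p * real (Suc m) * ip (lu ^ m * (lf * lf)) (lu ^ m * (lf * lf)) = 2"
  "real p * real (Suc m) * ip (lu ^ m * (le * lf)) (lu ^ m * (le * lf)) = 1"
  "ip (lu ^ m * (le * le)) (lu ^ m * (lf * lf)) = 0"
  "ip (lu ^ m * (le * le)) (lu ^ m * (le * lf)) = 0"
  "ip (lu ^ m * (lf * lf)) (lu ^ m * (le * lf)) = 0"
proof -
  have pm: "real p * real (Suc m) \<noteq> 0" by simp
  note S = bombieri_second_second[OF frame_inner(1), of _ _ _ _ m]
  show "real p * real (Suc m) * ip (lu ^ m * (le * le)) (lu ^ m * (le * le)) = 2"
    "real p * real (Suc m) * ip (lu ^ m * (lf * lf)) (lu ^ m * (lf * lf)) = 2"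
    "real p * real (Suc m) * ip (lu ^ m * (le * lf)) (lu ^ m * (le * lf)) = 1"
    using S[of e' e' e' e'] S[of f' f' f' f'] S[of e' f' e' f'] by (simp_all add: frame_inner base_inner mult.assoc del: of_nat_Suc)
  have "real p * real (Suc m) * ip (lu ^ m * (le * le)) (lu ^ m * (lf * lf)) = 0"
    "real p * real (Suc m) * ip (lu ^ m * (le * le)) (lu ^ m * (le * lf)) = 0"
    "real p * real (Suc m) * ip (lu ^ m * (lf * lf)) (lu ^ m * (le * lf)) = 0"
    using S[of e' e' f' f'] S[of e' e' e' f'] S[of f' f' e' f'] by (simp_all add: frame_inner base_inner mult.assoc del: of_nat_Suc)
  then show "ip (lu ^ m * (le * le)) (lu ^ m * (lf * lf)) = 0"
    "ip (lu ^ m * (le * le)) (lu ^ m * (le * lf)) = 0"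
    "ip (lu ^ m * (lf * lf)) (lu ^ m * (le * lf)) = 0"
    using pm by (metis mult_eq_0_iff)+
qed

text \<open>Value and Hessian are orthogonal to the gradient, so projecting the gradient away does
  not change them or their joint law.\<close>

lemma jets_x:
  "ip x1 (lu ^ p) = 0" "ip x2 (lu ^ p) = 0"
  "ip x1 (lu ^ m * (le * le)) = 0" "ip x1 (lu ^ m * (lf * lf)) = 0" "ip x1 (lu ^ m * (le * lf)) = 0"
  "ip x2 (lu ^ m * (le * le)) = 0" "ip x2 (lu ^ m * (lf * lf)) = 0" "ip x2 (lu ^ m * (le * lf)) = 0"
proof -
  show "ip x1 (lu ^ p) = 0" "ip x2 (lu ^ p) = 0"
    unfolding x1_def x2_def bombieri_scaleR_left bombieri_power_mult_power by (simp_all add: frame_inner)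
  have *: "ip (lu ^ Suc m * linear_form y) (lu ^ m * (linear_form a' * linear_form b')) = 0" if "a' \<bullet> uh = 0" "b' \<bullet> uh = 0" for y a' b'
    using bombieri_second_first[OF that, of m uh y] by (simp only: bombieri_commute mult.assoc)
  show "ip x1 (lu ^ m * (le * le)) = 0" "ip x1 (lu ^ m * (lf * lf)) = 0" "ip x1 (lu ^ m * (le * lf)) = 0"
    "ip x2 (lu ^ m * (le * le)) = 0" "ip x2 (lu ^ m * (lf * lf)) = 0" "ip x2 (lu ^ m * (le * lf)) = 0"
    unfolding x1_def x2_def bombieri_scaleR_left by (simp_all add: * frame_inner del: power_Suc)
qed

lemma projections_cancel:
  assumes x1: "ip y1 y1 = 1" and x2: "ip y2 y2 = 1" and perp: "ip y1 y2 = 0" "ip y2 y1 = 0"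
    and w: "w = (v - ip y2 v *\<^sub>R y2) - ip y1 (v - ip y2 v *\<^sub>R y2) *\<^sub>R y1"
  shows "ip y1 w = 0" "ip y2 w = 0" "ip y1 j = 0 \<Longrightarrow> ip y2 j = 0 \<Longrightarrow> ip w j = ip v j"
  unfolding w by (simp_all add: bombieri_linear assms(1-4))

lemma expectation_abs_hessian_det_nonzero:
  fixes k \<kappa> :: real
  assumes k: "k > 0" and \<kappa>: "\<kappa>\<^sup>2 = 2 * k"
  shows "(\<integral>\<^sup>+x. \<integral>\<^sup>+y\<^sub>1. \<integral>\<^sup>+y\<^sub>2. \<integral>\<^sup>+c. (if x \<noteq> 0 then ennreal \<bar>(\<kappa> * y\<^sub>1 - x) * (\<kappa> * y\<^sub>2 - x) - k * c\<^sup>2\<bar> else 0) \<partial>gauss \<partial>gauss \<partial>gauss \<partial>gauss) =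
    ennreal (1 - k + 4 * k * sqrt (k / (1 + 2 * k)))"
proof -
  have "AE x in gauss. x \<noteq> 0"
    using AE_lborel_singleton[of "0::real"] by (subst AE_density) auto
  then have "(\<integral>\<^sup>+x. \<integral>\<^sup>+y\<^sub>1. \<integral>\<^sup>+y\<^sub>2. \<integral>\<^sup>+c. (if x \<noteq> 0 then ennreal \<bar>(\<kappa> * y\<^sub>1 - x) * (\<kappa> * y\<^sub>2 - x) - k * c\<^sup>2\<bar> else 0) \<partial>gauss \<partial>gauss \<partial>gauss \<partial>gauss)
    = (\<integral>\<^sup>+x. \<integral>\<^sup>+y\<^sub>1. \<integral>\<^sup>+y\<^sub>2. \<integral>\<^sup>+c. ennreal \<bar>(\<kappa> * y\<^sub>1 - x) * (\<kappa> * y\<^sub>2 - x) - k * c\<^sup>2\<bar> \<partial>gauss \<partial>gauss \<partial>gauss \<partial>gauss)"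
    by (intro nn_integral_cong_AE) (auto elim!: eventually_mono)
  then show ?thesis by (simp only: expectation_abs_hessian_det[OF assms])
qed

text \<open>The value and the normalized Hessian entries are pairings with four orthonormal vectors,
  hence independent standard normals.\<close>

lemma hessian_expectation:
  assumes G: "gaussian_law p G" and k: "k = real (Suc m) / real p"
  shows "(\<integral>\<^sup>+v. (if Y0 v \<noteq> 0 then ennreal \<bar>(real (Suc m) * h11 v - Y0 v) * (real (Suc m) * h22 v - Y0 v) - (real (Suc m) * h12 v)\<^sup>2\<bar> else 0) \<partial>G)
    = ennreal (1 - k + 4 * k * sqrt (k / (1 + 2 * k)))"
proof -
  define P where "P = real p * real (Suc m)"
  have P: "P > 0" by (simp add: P_def)
  \<comment> \<open>The squared norms of the second-order elements are 2 / P on the diagonal and 1 /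
    P off it; \<sigma> and \<tau> are the inverse norms. The factor p - 1 of the Hessian then gives
    \<kappa>^2 = 2 (p - 1) / p.\<close>
  define \<sigma> where "\<sigma> = sqrt (P / 2)"
  define \<tau> where "\<tau> = sqrt P"
  have st: "\<sigma> > 0" "\<sigma> * \<sigma> = P / 2" "\<tau> > 0" "\<tau> * \<tau> = P" using P by (simp_all add: \<sigma>_def \<tau>_def)
  define \<kappa> where "\<kappa> = real (Suc m) / \<sigma>"
  define F where "F x y\<^sub>1 y\<^sub>2 c = (if x \<noteq> 0 then ennreal \<bar>(\<kappa> * y\<^sub>1 - x) * (\<kappa> * y\<^sub>2 - x) - k * c\<^sup>2\<bar> else 0)" for x y\<^sub>1 y\<^sub>2 c
  let ?c2 = "\<sigma> *\<^sub>R (lu ^ m * (le * le))" and ?c3 = "\<sigma> *\<^sub>R (lu ^ m * (lf * lf))" and ?c4 = "\<tau> *\<^sub>R (lu ^ m * (le * lf))"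
  have \<kappa>2: "\<kappa>\<^sup>2 = 2 * k"
  proof -
    have "\<kappa>\<^sup>2 = real (Suc m) * real (Suc m) / (\<sigma> * \<sigma>)" by (simp add: \<kappa>_def power2_eq_square)
    also have "\<dots> = 2 * k"
    proof -
      have "a * a / (b * a / 2) = 2 * (a / b)" if "a > 0" "b > 0" for a b :: real
        using that by (simp add: field_simps)
      then show ?thesis unfolding st P_def k by (simp del: of_nat_Suc)
    qed
    finally show ?thesis .
  qed
  have eq: "(if Y0 v \<noteq> 0 then ennreal \<bar>(real (Suc m) * h11 v - Y0 v) * (real (Suc m) * h22 v - Y0 v) - (real (Suc m) * h12 v)\<^sup>2\<bar> else 0) =
    F (ip (lu ^ p) v) (ip ?c2 v) (ip ?c3 v) (ip ?c4 v)" for v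
  proof -
    have "real (Suc m) * h11 v = \<kappa> * ip ?c2 v" "real (Suc m) * h22 v = \<kappa> * ip ?c3 v"
      unfolding h11_def h22_def \<kappa>_def bombieri_scaleR_left bombieri_commute[of p v] using st(1) by simp_all
    moreover have "(real (Suc m) * h12 v)\<^sup>2 = k * (ip ?c4 v)\<^sup>2"
    proof -
      have "k * (ip ?c4 v)\<^sup>2 = k * (\<tau> * \<tau>) * (h12 v)\<^sup>2"
        unfolding h12_def bombieri_scaleR_left bombieri_commute[of p v] by (simp add: power2_eq_square)
      also have "k * (\<tau> * \<tau>) = real (Suc m) * real (Suc m)" unfolding st k P_def by simp
      finally show ?thesis by (simp add: power2_eq_square del: of_nat_Suc)
    qed
    moreover have "Y0 v = ip (lu ^ p) v" by (rule bombieri_commute)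
    ultimately show ?thesis unfolding F_def by (simp only:)
  qed
  have sq: "\<sigma> * (\<sigma> * (2 / P)) = 1" "\<tau> * (\<tau> * (1 / P)) = 1"
    unfolding mult.assoc[symmetric] st using P by simp_all
  have js: "ip (lu ^ m * (le * le)) (lu ^ m * (le * le)) = 2 / P" "ip (lu ^ m * (lf * lf)) (lu ^ m * (lf * lf)) = 2 / P"
    "ip (lu ^ m * (le * lf)) (lu ^ m * (le * lf)) = 1 / P"
    using jets_second(1-3) P unfolding P_def[symmetric] by (simp_all add: field_simps)
  have "(\<integral>\<^sup>+v. F (ip (lu ^ p) v) (ip ?c2 v) (ip ?c3 v) (ip ?c4 v) \<partial>G) = (\<integral>\<^sup>+x. \<integral>\<^sup>+y. \<integral>\<^sup>+w. \<integral>\<^sup>+c. F x y w c \<partial>gauss \<partial>gauss \<partial>gauss \<partial>gauss)"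
  proof (rule gaussian_law_four[OF G])
    show "lu ^ p \<in> sym_power p" by (rule linear_form_power_sym_power)
    show "?c2 \<in> sym_power p" "?c3 \<in> sym_power p" "?c4 \<in> sym_power p"
      by (intro sym_power_scaleR linear_form_power_mult_sym_power)+
    show "ip (lu ^ p) (lu ^ p) = 1" by (rule jets_power)
    show "ip ?c2 ?c2 = 1" "ip ?c3 ?c3 = 1" "ip ?c4 ?c4 = 1"
      unfolding bombieri_scaleR_left bombieri_scaleR_right js by (rule sq)+
    show "ip (lu ^ p) ?c2 = 0" "ip (lu ^ p) ?c3 = 0" "ip (lu ^ p) ?c4 = 0" "ip ?c2 ?c3 = 0" "ip ?c2 ?c4 = 0" "ip ?c3 ?c4 = 0"
      unfolding bombieri_scaleR_left bombieri_scaleR_right by (simp_all only: jets_power_second jets_second mult_zero_right)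
    show "(\<lambda>(x, y, z, w). F x y z w) \<in> borel_measurable (borel \<Otimes>\<^sub>M borel \<Otimes>\<^sub>M borel \<Otimes>\<^sub>M borel)"
      unfolding F_def by measurable
  qed
  also have "\<dots> = ennreal (1 - k + 4 * k * sqrt (k / (1 + 2 * k)))"
    unfolding F_def by (rule expectation_abs_hessian_det_nonzero[OF _ \<kappa>2]) (simp add: k)
  finally show ?thesis unfolding eq .
qed

end

text \<open>Agrees with \<open>kr_integrand\<close> when \<open>v\<close> is orthogonal to \<open>q1\<close>, \<open>q2\<close>, but does not depend on the components
  of \<open>v\<close> along them, so that its expectation can be taken over all of \<open>v\<close>.\<close>

definition (in frame) kr_density :: "(real^2 \<Rightarrow> real) \<Rightarrow> real_poly3 \<Rightarrow> real^2 \<Rightarrow> ennreal" where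
  "kr_density \<zeta> v z = (if detA z \<noteq> 0 \<and> \<zeta> z = 0 \<and> F0 (slice v z) z \<noteq> 0
     then ennreal (\<bar>detM (slice v z) z / detA z\<bar> * gauss2 (ip q1 (slice v z) *\<^sub>R axis 1 1 + ip q2 (slice v z) *\<^sub>R axis 2 1)) else 0)"

text \<open>The slice is a composition of two oblique projections, and the Gaussian weight factors
  accordingly. \<open>gaussian_law_oblique\<close> is applied to the pair (\<open>g1\<close>,
  \<open>x1\<close>) and then to (\<open>g2\<close>, \<open>x2\<close>), which replaces both by
  orthogonal projections at the price of |a1| |a2| / (2 pi).\<close>

lemma (in frame_at) kr_density_expectation:
  assumes G: "gaussian_law p G" and D: "detA z \<noteq> 0" and \<zeta>: "\<zeta> z = 0" and k: "k = real (Suc m) / real p"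
  shows "(\<integral>\<^sup>+v. kr_density \<zeta> v z \<partial>G) = ennreal (real p / (2 * pi) / R ^ 3) * ennreal (1 - k + 4 * k * sqrt (k / (1 + 2 * k)))"
proof -
  define \<Theta> where "\<Theta> y = (if F0 y z \<noteq> 0 then ennreal \<bar>detM y z / detA z\<bar> else 0)" for y
  have \<Theta>m[measurable]: "\<Theta> \<in> borel_measurable poly_sigma"
    unfolding \<Theta>_def[abs_def]
    using measurable_F(1)[of "\<lambda>v. v" poly_sigma "\<lambda>_. z"] measurable_detM[of "\<lambda>v. v" poly_sigma "\<lambda>_. z"] by measurable
  define T where "T y = y - (ip x2 y / a2) *\<^sub>R g2" for y
  define S where "S y = y - ip x1 y *\<^sub>R x1" for y
  have Tm[measurable]: "T \<in> measurable poly_sigma poly_sigma" unfolding T_def[abs_def] by measurable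
  have Sm[measurable]: "S \<in> measurable poly_sigma poly_sigma" unfolding S_def[abs_def] by measurable
  have a: "a1 \<noteq> 0" "a2 \<noteq> 0" using a_neq_0 D by auto
  let ?\<phi> = "\<lambda>t. ennreal (std_normal_density t)"
  let ?y = "\<lambda>v. v - (ip x1 v / a1) *\<^sub>R g1"
  have sl: "slice v z = T (?y v)" for v
    unfolding slice_z[OF D a] T_def by (simp add: bombieri_linear x_g_inner)
  have g1T: "ip g1 (T y) = ip g1 y" for y by (simp add: T_def bombieri_linear x_g_inner)
  have k1: "kr_density \<zeta> v z = ?\<phi> (ip g1 (?y v)) * (?\<phi> (ip g2 (T (?y v))) * \<Theta> (T (?y v)))" for v
    unfolding kr_density_def sl gauss2_rotate g1T \<Theta>_def using D \<zeta>
    by (simp add: ennreal_mult[symmetric] ac_simps)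
  have "(\<integral>\<^sup>+v. kr_density \<zeta> v z \<partial>G) = ennreal (\<bar>a1\<bar> * std_normal_density 0) * (\<integral>\<^sup>+v. ?\<phi> (ip g2 (T (v - ip x1 v *\<^sub>R x1))) * \<Theta> (T (v - ip x1 v *\<^sub>R x1)) \<partial>G)"
    unfolding k1
    by (rule gaussian_law_oblique[OF G _ _ _ _ _ a(1), where \<Psi>="\<lambda>y. ?\<phi> (ip g2 (T y)) * \<Theta> (T y)"])
      (simp_all add: x_g_sym_power x_g_inner)
  \<comment> \<open>The mixed inner products vanish, so the two projections commute, and the weight
    along \<open>g2\<close> does not notice the projection along \<open>x1\<close>; this brings the
    integrand into the shape for the second application.\<close>
  also have "(\<lambda>v. ?\<phi> (ip g2 (T (v - ip x1 v *\<^sub>R x1))) * \<Theta> (T (v - ip x1 v *\<^sub>R x1))) =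
     (\<lambda>v. ?\<phi> (ip g2 (T v)) * \<Theta> (S (T v)))"
  proof
    fix v
    have "T (v - ip x1 v *\<^sub>R x1) = S (T v)"
      unfolding T_def S_def by (simp add: bombieri_linear x_g_inner algebra_simps)
    moreover have "ip g2 (S (T v)) = ip g2 (T v)" by (simp add: S_def bombieri_linear x_g_inner)
    ultimately show "?\<phi> (ip g2 (T (v - ip x1 v *\<^sub>R x1))) * \<Theta> (T (v - ip x1 v *\<^sub>R x1)) = ?\<phi> (ip g2 (T v)) * \<Theta> (S (T v))"
      by simp
  qed
  also have "(\<integral>\<^sup>+v. ?\<phi> (ip g2 (T v)) * \<Theta> (S (T v)) \<partial>G) = ennreal (\<bar>a2\<bar> * std_normal_density 0) * (\<integral>\<^sup>+v. \<Theta> (S (v - ip x2 v *\<^sub>R x2)) \<partial>G)"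
    unfolding T_def
    by (rule gaussian_law_oblique[OF G _ _ _ _ _ a(2), where \<Psi>="\<lambda>y. \<Theta> (S y)"])
      (simp_all add: x_g_sym_power x_g_inner)
  also have "(\<lambda>v. \<Theta> (S (v - ip x2 v *\<^sub>R x2))) = (\<lambda>v. ennreal \<bar>R ^ (2 * m + 2) / detA z\<bar> *
     (if Y0 v \<noteq> 0 then ennreal \<bar>(real (Suc m) * h11 v - Y0 v) * (real (Suc m) * h22 v - Y0 v) - (real (Suc m) * h12 v)\<^sup>2\<bar> else 0))"
  proof
    fix v
    let ?w = "S (v - ip x2 v *\<^sub>R x2)"
    have w: "?w = (v - ip x2 v *\<^sub>R x2) - ip x1 (v - ip x2 v *\<^sub>R x2) *\<^sub>R x1" by (simp only: S_def)
    note pc = projections_cancel[OF x_g_inner(1,2,3,4) w]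
    have Y: "Y0 ?w = Y0 v" by (intro pc(3) jets_x)
    have h: "h11 ?w = h11 v" "h12 ?w = h12 v" "h22 ?w = h22 v"
      unfolding h11_def h12_def h22_def by (intro pc(3) jets_x)+
    have "F0 ?w z \<noteq> 0 \<longleftrightarrow> Y0 v \<noteq> 0" unfolding F0_z Y using R(3) by simp
    then show "\<Theta> ?w = ennreal \<bar>R ^ (2 * m + 2) / detA z\<bar> *
     (if Y0 v \<noteq> 0 then ennreal \<bar>(real (Suc m) * h11 v - Y0 v) * (real (Suc m) * h22 v - Y0 v) - (real (Suc m) * h12 v)\<^sup>2\<bar> else 0)"
      unfolding \<Theta>_def detM_z[OF pc(1,2)] h Y
      by (simp add: ennreal_mult[symmetric] abs_mult[symmetric] del: power_Suc of_nat_Suc)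
  qed
  also have "(\<integral>\<^sup>+v. ennreal \<bar>R ^ (2 * m + 2) / detA z\<bar> *
     (if Y0 v \<noteq> 0 then ennreal \<bar>(real (Suc m) * h11 v - Y0 v) * (real (Suc m) * h22 v - Y0 v) - (real (Suc m) * h12 v)\<^sup>2\<bar> else 0) \<partial>G) =
     ennreal \<bar>R ^ (2 * m + 2) / detA z\<bar> * ennreal (1 - k + 4 * k * sqrt (k / (1 + 2 * k)))"
  proof -
    have [measurable]: "Y0 \<in> borel_measurable G" "h11 \<in> borel_measurable G" "h12 \<in> borel_measurable G" "h22 \<in> borel_measurable G"
      unfolding h11_def[abs_def] h12_def[abs_def] h22_def[abs_def] measurable_cong_sets[OF sets_gaussian_law[OF G] refl] by measurable
    show ?thesis by (subst nn_integral_cmult, measurable, simp only: hessian_expectation[OF G k])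
  qed
  also have "ennreal (\<bar>a1\<bar> * std_normal_density 0) * (ennreal (\<bar>a2\<bar> * std_normal_density 0) *
      (ennreal \<bar>R ^ (2 * m + 2) / detA z\<bar> * ennreal (1 - k + 4 * k * sqrt (k / (1 + 2 * k))))) =
    ennreal ((\<bar>a1\<bar> * std_normal_density 0) * ((\<bar>a2\<bar> * std_normal_density 0) * \<bar>R ^ (2 * m + 2) / detA z\<bar>)) * ennreal (1 - k + 4 * k * sqrt (k / (1 + 2 * k)))"
  proof -
    have "ennreal x * (ennreal y * (ennreal w * E)) = ennreal (x * (y * w)) * E" if "x \<ge> 0" "y \<ge> 0" "w \<ge> 0" for x y w E
      using that by (simp add: ennreal_mult mult.assoc)
    then show ?thesis by simp
  qed
  also have "(\<bar>a1\<bar> * std_normal_density 0) * ((\<bar>a2\<bar> * std_normal_density 0) * \<bar>R ^ (2 * m + 2) / detA z\<bar>) = real p / (2 * pi) / R ^ 3"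
  proof -
    \<comment> \<open>The factor \<delta> that vanishes on the degenerate circle occurs in
      \<open>a1\<close> and in \<open>detA\<close> and cancels; the powers of R combine to - (2 m +
      3) + (2 m + 2) - 2 = - 3.\<close>
    define \<delta> where "\<delta> = 1 - real (Suc m) * \<rho>\<^sup>2"
    have dA: "detA z = R * R / real p * \<delta>" using a_neq_0(3) by (simp only: \<delta>_def)
    have \<delta>0: "\<bar>\<delta>\<bar> > 0" using D dA by auto
    have A1: "\<bar>a1\<bar> = (1 / R) ^ Suc (Suc m) * \<bar>\<delta>\<bar>" using R(1) unfolding a1_def \<delta>_def[symmetric] by (simp only: abs_mult) simp
    have A2: "\<bar>a2\<bar> = (1 / R) ^ Suc m" using R(1) unfolding a2_def by simp
    have A3: "\<bar>R ^ (2 * m + 2) / detA z\<bar> = R ^ Suc m * R ^ Suc m / (R * R / real p * \<bar>\<delta>\<bar>)"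
      using R(1) unfolding dA by (simp add: abs_mult power_add[symmetric] mult_2 del: of_nat_Suc)
    have phi: "std_normal_density 0 * std_normal_density 0 = 1 / (2 * pi)"
      using std_normal_density_mult[of 0 0] by simp
    have inv: "(1 / R) ^ Suc m * R ^ Suc m = 1" using R(3) by (simp only: power_mult_distrib[symmetric]) simp
    have "(\<bar>a1\<bar> * std_normal_density 0) * ((\<bar>a2\<bar> * std_normal_density 0) * \<bar>R ^ (2 * m + 2) / detA z\<bar>) =
      (std_normal_density 0 * std_normal_density 0) * ((1 / R) ^ Suc m * R ^ Suc m) * ((1 / R) ^ Suc m * R ^ Suc m) * ((1 / R) * \<bar>\<delta>\<bar> / (R * R / real p * \<bar>\<delta>\<bar>))"
      unfolding A1 A2 A3 power_Suc[of "1 / R" "Suc m"] by (simp only: times_divide_eq_right times_divide_eq_left ac_simps)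
    also have "\<dots> = real p / (2 * pi) / R ^ 3"
      unfolding inv phi using \<delta>0 R(3) by (simp add: field_simps power3_eq_cube)
    finally show ?thesis .
  qed
  finally show ?thesis .
qed

lemma (in frame) kr_density_expectation:
  assumes G: "gaussian_law p G" and k: "k = real (Suc m) / real p"
  shows "(\<integral>\<^sup>+v. kr_density \<zeta> v z \<partial>G) = (if detA z \<noteq> 0 \<and> \<zeta> z = 0
    then ennreal (real p / (2 * pi)) * ennreal (1 / sqrt (1 + (norm z)\<^sup>2) ^ 3) * ennreal (1 - k + 4 * k * sqrt (k / (1 + 2 * k))) else 0)"
proof (cases "detA z \<noteq> 0 \<and> \<zeta> z = 0")
  case True
  define \<rho> where "\<rho> = norm z"
  \<comment> \<open>At the origin of the chart any unit vector (c, s) will do.\<close>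
  obtain c s where cs: "z $ 1 = \<rho> * c" "z $ 2 = \<rho> * s" "c\<^sup>2 + s\<^sup>2 = 1"
  proof (cases "z = 0")
    case True
    then show ?thesis by (intro that[of 1 0]) (auto simp: \<rho>_def)
  next
    case False
    then have "\<rho> > 0" by (simp add: \<rho>_def)
    moreover have "(z $ 1)\<^sup>2 + (z $ 2)\<^sup>2 = \<rho>\<^sup>2" by (simp add: \<rho>_def norm_vec2_squared)
    ultimately show ?thesis
      by (intro that[of "z $ 1 / \<rho>" "z $ 2 / \<rho>"]) (auto simp: power_divide add_divide_distrib[symmetric])
  qed
  interpret frame_at n e f m z c s \<rho> by unfold_locales (use cs in auto)
  have "R = sqrt (1 + (norm z)\<^sup>2)" using R_def by (simp only: \<rho>_def)
  then have "ennreal (real p / (2 * pi) / R ^ 3) = ennreal (real p / (2 * pi)) * ennreal (1 / sqrt (1 + (norm z)\<^sup>2) ^ 3)"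
    by (subst ennreal_mult[symmetric]) auto
  then show ?thesis using frame_at.kr_density_expectation[OF frame_at_axioms G _ _ k, of \<zeta>] True by simp
next
  case False
  then have "kr_density \<zeta> v z = 0" for v unfolding kr_density_def by (intro if_not_P) blast
  then show ?thesis using False by (simp only:) auto
qed

section \<open>Averaging over all coordinates and integrating over the chart\<close>

context frame
begin

lemma q_sym_power: "q1 \<in> sym_power p" "q2 \<in> sym_power p"
  unfolding q1_def q2_def by (intro sym_power_scaleR linear_form_power_mult_sym_power)+

lemma q_inner: "ip q1 q1 = 1" "ip q2 q2 = 1" "ip q1 q2 = 0" "ip q2 q1 = 0"
  unfolding q1_def q2_def bombieri_first_order by (simp_all add: unit perp perp')

lemma slice_add:
  assumes D: "detA z \<noteq> 0"
  shows "slice (s *\<^sub>R q1 + t *\<^sub>R q2 + w) z = slice w z"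
proof -
  let ?v = "s *\<^sub>R q1 + t *\<^sub>R q2 + w"
  have eq: "?v + (h1 w z - s) *\<^sub>R q1 + (h2 w z - t) *\<^sub>R q2 = slice w z"
    by (simp add: slice_def algebra_simps)
  have "h1 w z - s = h1 ?v z" "h2 w z - t = h2 ?v z"
    using slice_unique[OF D, of ?v "h1 w z - s" "h2 w z - t"] G_slice[OF D, of w] unfolding eq by auto
  then show ?thesis using eq unfolding slice_def by simp
qed

text \<open>If \<open>w\<close> has no components along \<open>q1\<close>, \<open>q2\<close>, those
  of its slice are \<open>h1\<close> and \<open>h2\<close>. The right-hand side may be taken at any
  \<open>s\<close>, \<open>t\<close>, since the slice forgets them.\<close>

lemma kr_integrand_eq_kr_density:
  assumes "ip q1 w = 0" "ip q2 w = 0"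
  shows "kr_integrand \<zeta> w z = kr_density \<zeta> (s *\<^sub>R q1 + t *\<^sub>R q2 + w) z"
proof (cases "detA z = 0")
  case True
  then show ?thesis by (simp add: kr_integrand_def kr_density_def)
next
  case False
  have "ip q1 (slice w z) = h1 w z" "ip q2 (slice w z) = h2 w z"
    unfolding slice_def by (simp_all add: bombieri_linear assms q_inner)
  then show ?thesis unfolding kr_integrand_def kr_density_def slice_add[OF False] by simp
qed

lemma measurable_gauss2 [measurable]: "gauss2 \<in> borel_measurable borel"
  unfolding gauss2_def[abs_def] by measurable

lemma measurable_kr:
  assumes \<zeta>: "continuous_on UNIV \<zeta>" and X[measurable]: "X \<in> measurable N poly_sigma" "g \<in> borel_measurable N"
  shows "(\<lambda>x. kr_integrand \<zeta> (X x) (g x)) \<in> borel_measurable N"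
    and "(\<lambda>x. kr_density \<zeta> (X x) (g x)) \<in> borel_measurable N"
proof -
  have [measurable]: "\<zeta> \<in> borel_measurable borel" using \<zeta> by (rule borel_measurable_continuous_onI)
  note [measurable] = measurable_slice[OF X] measurable_F(1)[OF measurable_slice(3)[OF X] X(2)] measurable_detM[OF measurable_slice(3)[OF X] X(2)]
  show "(\<lambda>x. kr_integrand \<zeta> (X x) (g x)) \<in> borel_measurable N"
    unfolding kr_integrand_def by measurable
  show "(\<lambda>x. kr_density \<zeta> (X x) (g x)) \<in> borel_measurable N"
    unfolding kr_density_def by measurable
qed

text \<open>The two coordinates along \<open>q1\<close>, \<open>q2\<close> are integrated first,
  with the rest \<open>W x\<close> fixed; then the expectation over the rest is exchanged with the
  integral over the chart.\<close>

lemma kac_rice: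
  assumes G: "gaussian_law p G" and \<zeta>: "continuous_on UNIV \<zeta>" and k: "k = real (Suc m) / real p"
  shows "(\<integral>\<^sup>+v. nsol \<zeta> v \<partial>G) = (\<integral>\<^sup>+z. (if detA z \<noteq> 0 \<and> \<zeta> z = 0
    then ennreal (real p / (2 * pi)) * ennreal (1 / sqrt (1 + (norm z)\<^sup>2) ^ 3) * ennreal (1 - k + 4 * k * sqrt (k / (1 + 2 * k))) else 0) \<partial>lborel)"
proof -
  note nm[measurable] = measurable_nsol[OF \<zeta>]
  define cc where "cc l = (if l = 0 then q1 else q2)" for l :: nat
  have less2: "l < 2 \<longleftrightarrow> l = 0 \<or> l = (1::nat)" for l by auto
  have "\<exists>(I :: real_poly3 set) b g. onb p I b \<and> G = gauss_rep I b \<and> inj_on g {..<2::nat} \<and> g ` {..<2} \<subseteq> I \<and> (\<forall>l<2. b (g l) = cc l)"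
    by (rule gaussian_law_extend[OF G]) (use q_inner q_sym_power in \<open>auto simp: less2 cc_def\<close>)
  then obtain I :: "real_poly3 set" and b g where *: "onb p I b" "G = gauss_rep I b" "inj_on g {..<2}" "g ` {..<2::nat} \<subseteq> I" "\<forall>l<2. b (g l) = cc l"
    by metis
  define i j where "i = g 0" and "j = g 1"
  have ij: "i \<in> I" "j \<in> I" "i \<noteq> j" "b i = q1" "b j = q2"
    using *(4,5) inj_on_eq_iff[OF *(3), of 0 1] by (auto simp: i_def j_def cc_def)
  define K where "K = I - {i, j}"
  have I: "I = insert j (insert i K)" and K: "finite K" "i \<notin> K" "j \<notin> K"
    using ij *(1) by (auto simp: K_def onb_def)
  define W where "W x = (\<Sum>l\<in>K. x l *\<^sub>R b l)" for x
  have Wm[measurable]: "W \<in> measurable (PiM K (\<lambda>_. gauss)) poly_sigma" unfolding W_def by measurable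
  have KI: "K \<subseteq> I" by (auto simp: K_def)
  have ortho: "ip (b l) (b l') = (if l = l' then 1 else 0)" if "l \<in> I" "l' \<in> I" for l l'
    using *(1) that by (auto simp: onb_def)
  have qK: "ip q1 (b l) = 0" "ip q2 (b l) = 0" if "l \<in> K" for l
    using ortho[of i l] ortho[of j l] that K KI ij by auto
  have qW: "ip q1 (W x) = 0" "ip q2 (W x) = 0" for x
    unfolding W_def bombieri_sum_right by (simp_all add: bombieri_linear qK)
  interpret P: prob_space "PiM K (\<lambda>_. gauss)" by (rule prob_space_PiM) (rule prob_space_gauss)
  interpret PL: pair_sigma_finite "PiM K (\<lambda>_. gauss)" "lborel :: (real^2) measure"
    by (intro pair_sigma_finite.intro P.sigma_finite_measure sigma_finite_lborel)
  have rep: "(\<integral>\<^sup>+v. \<Psi> v \<partial>G) = (\<integral>\<^sup>+x. \<integral>\<^sup>+s. \<integral>\<^sup>+t. \<Psi> (s *\<^sub>R q1 + t *\<^sub>R q2 + W x) \<partial>gauss \<partial>gauss \<partial>PiM K (\<lambda>_. gauss))"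
    if [measurable]: "\<Psi> \<in> borel_measurable poly_sigma" for \<Psi>
    unfolding *(2) I W_def ij(4,5)[symmetric] by (rule nn_integral_gauss_rep_insert2[OF K ij(3)]) measurable
  \<comment> \<open>Reinserting the two coordinates as dummy Gaussian variables turns the
    expectation over the rest into one under the full law, which is invariant under the rotations
    used at z.\<close>
  have inner: "(\<integral>\<^sup>+x. kr_integrand \<zeta> (W x) z \<partial>PiM K (\<lambda>_. gauss)) = (\<integral>\<^sup>+v. kr_density \<zeta> v z \<partial>G)" for z
  proof -
    have "(\<integral>\<^sup>+v. kr_density \<zeta> v z \<partial>G) = (\<integral>\<^sup>+x. \<integral>\<^sup>+s. \<integral>\<^sup>+t. kr_density \<zeta> (s *\<^sub>R q1 + t *\<^sub>R q2 + W x) z \<partial>gauss \<partial>gauss \<partial>PiM K (\<lambda>_. gauss))"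
      by (rule rep) (rule measurable_kr[OF \<zeta>]; simp)
    then show ?thesis by (simp only: kr_integrand_eq_kr_density[OF qW, symmetric] nn_integral_gauss_const)
  qed
  have "(\<integral>\<^sup>+v. nsol \<zeta> v \<partial>G) = (\<integral>\<^sup>+x. \<integral>\<^sup>+z. kr_integrand \<zeta> (W x) z \<partial>lborel \<partial>PiM K (\<lambda>_. gauss))"
    by (simp only: rep[OF nm] kac_rice_fixed[OF \<zeta>])
  also have "\<dots> = (\<integral>\<^sup>+z. \<integral>\<^sup>+x. kr_integrand \<zeta> (W x) z \<partial>PiM K (\<lambda>_. gauss) \<partial>lborel)"
    by (rule PL.Fubini'[symmetric]) (unfold split_def, rule measurable_kr(1)[OF \<zeta>]; measurable)
  finally show ?thesis unfolding inner kr_density_expectation[OF G k] .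
qed

lemma AE_detA_neq_0: "AE z in lborel. detA z \<noteq> 0"
proof -
  have "negligible (sphere (0::real^2) (1 / sqrt (real (Suc m))))" by (rule negligible_sphere)
  then have "AE z in lebesgue. z \<notin> sphere (0::real^2) (1 / sqrt (real (Suc m)))"
    by (intro AE_not_in) (simp add: negligible_iff_null_sets)
  then have "AE z in lborel. z \<notin> sphere (0::real^2) (1 / sqrt (real (Suc m)))" by (simp add: AE_completion_iff)
  then show ?thesis
  proof eventually_elim
    case (elim z)
    show ?case
    proof
      assume "detA z = 0"
      then have "1 = real (Suc m) * (norm z)\<^sup>2" using r2_pos[of z] by (simp add: detA_eq norm_vec2_squared del: of_nat_Suc)
      then have "(norm z)\<^sup>2 = (1 / sqrt (real (Suc m)))\<^sup>2" by (simp add: power_divide field_simps del: of_nat_Suc)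
      then have "norm z = 1 / sqrt (real (Suc m))" by (simp add: power2_eq_iff_nonneg)
      then show False using elim by simp
    qed
  qed
qed

lemma expectation_nsol:
  assumes G: "gaussian_law p G" and k: "k = real (Suc m) / real p"
  shows "(\<integral>\<^sup>+v. nsol (\<lambda>_. 0) v \<partial>G) = ennreal (real p * (1 - k + 4 * k * sqrt (k / (1 + 2 * k))))"
proof -
  have k01: "k > 0" "1 - k \<ge> 0" unfolding k by simp_all
  then have nn: "0 \<le> 1 - k + 4 * k * sqrt (k / (1 + 2 * k))" by (intro add_nonneg_nonneg mult_nonneg_nonneg) auto
  let ?E = "ennreal (1 - k + 4 * k * sqrt (k / (1 + 2 * k)))"
  have "(\<integral>\<^sup>+v. nsol (\<lambda>_. 0) v \<partial>G) = (\<integral>\<^sup>+z. ennreal (real p / (2 * pi)) * ?E * ennreal (1 / sqrt (1 + (norm z)\<^sup>2) ^ 3) \<partial>(lborel :: (real^2) measure))"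
    unfolding kac_rice[OF G continuous_on_const k]
    by (intro nn_integral_cong_AE eventually_mono[OF AE_detA_neq_0]) (simp add: ac_simps)
  also have "\<dots> = ennreal (real p / (2 * pi)) * ?E * (\<integral>\<^sup>+z. ennreal (1 / sqrt (1 + (norm z)\<^sup>2) ^ 3) \<partial>(lborel :: (real^2) measure))"
    by (rule nn_integral_cmult) measurable
  also have "\<dots> = (ennreal (real p / (2 * pi)) * ennreal (2 * pi)) * ?E"
    unfolding nn_integral_gnomonic by (simp only: ac_simps)
  also have "ennreal (real p / (2 * pi)) * ennreal (2 * pi) = ennreal (real p)"
    by (subst ennreal_mult[symmetric]) auto
  also have "ennreal (real p) * ?E = ennreal (real p * (1 - k + 4 * k * sqrt (k / (1 + 2 * k))))"
    using nn by (intro ennreal_mult[symmetric]) auto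
  finally show ?thesis .
qed

text \<open>The cone meets the affine plane in the image of the curve under central projection, a
  differentiable image of a set of dimension one.\<close>

lemma negligible_cone_over_curve:
  fixes y :: "real \<Rightarrow> real^3"
  assumes y: "y differentiable_on UNIV"
  shows "negligible {z. \<exists>r \<theta>. dir z = r *\<^sub>R y \<theta>}"
proof -
  let ?S = "{\<theta>. y \<theta> \<bullet> n \<noteq> 0}"
  let ?g = "\<lambda>\<theta>. ((y \<theta> \<bullet> e) / (y \<theta> \<bullet> n)) *\<^sub>R axis 1 1 + ((y \<theta> \<bullet> f) / (y \<theta> \<bullet> n)) *\<^sub>R axis 2 1 :: real^2"
  have yd: "y differentiable (at \<theta> within ?S)" for \<theta>
    using y by (meson UNIV_I differentiable_on_def differentiable_within_subset subset_UNIV)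
  have inn: "(\<lambda>\<theta>. y \<theta> \<bullet> a) differentiable (at \<theta> within ?S)" for a \<theta>
    using yd[of \<theta>] unfolding differentiable_def by (blast intro: has_derivative_inner_left)
  have "?g differentiable_on ?S"
    unfolding differentiable_on_def
    by (intro ballI differentiable_add differentiable_scaleR differentiable_divide inn differentiable_const) auto
  then have "negligible (?g ` ?S)" by (intro negligible_differentiable_image_lowdim) auto
  moreover have "{z. \<exists>r \<theta>. dir z = r *\<^sub>R y \<theta>} \<subseteq> ?g ` ?S"
  proof
    fix z assume "z \<in> {z. \<exists>r \<theta>. dir z = r *\<^sub>R y \<theta>}"
    then obtain r \<theta> where d: "dir z = r *\<^sub>R y \<theta>" by auto
    have 1: "r * (y \<theta> \<bullet> n) = 1" "r * (y \<theta> \<bullet> e) = z $ 1" "r * (y \<theta> \<bullet> f) = z $ 2"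
      using dir_inner(1,2,3)[of z] unfolding d by auto
    have nz: "y \<theta> \<bullet> n \<noteq> 0" using 1(1) by auto
    then have "r = 1 / (y \<theta> \<bullet> n)" using 1(1) by (simp add: field_simps)
    then have "z = ?g \<theta>" using 1(2,3) by (simp add: vec_eq_iff forall_2 axis_def)
    then show "z \<in> ?g ` ?S" using nz by blast
  qed
  ultimately show ?thesis by (rule negligible_subset)
qed

lemma expand: "(a \<bullet> n) *\<^sub>R n + (a \<bullet> e) *\<^sub>R e + (a \<bullet> f) *\<^sub>R f = a"
proof -
  let ?B = "{n, e, f}"
  have ne: "n \<noteq> e" "n \<noteq> f" "e \<noteq> f" using unit perp by auto
  have orth: "pairwise orthogonal ?B" using perp perp' by (auto simp: pairwise_def orthogonal_def)
  have "0 \<notin> ?B" using unit by auto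
  then have "independent ?B" using orth pairwise_orthogonal_independent by blast
  moreover have "card ?B = DIM(real^3)" using ne by simp
  ultimately have "span ?B = UNIV" by (metis dim_eq_full dim_eq_card_independent)
  let ?r = "a - ((a \<bullet> n) *\<^sub>R n + (a \<bullet> e) *\<^sub>R e + (a \<bullet> f) *\<^sub>R f)"
  have "orthogonal ?r b" if "b \<in> ?B" for b
    using that by (auto simp: orthogonal_def inner_diff_left inner_add_left unit perp perp')
  then have "orthogonal ?r ?r" using \<open>span ?B = UNIV\<close> orthogonal_to_span[of ?r ?B ?r] by (auto simp: orthogonal_def)
  then show ?thesis by (simp add: orthogonal_self)
qed

text \<open>The condition is linear in the test vector and trivial for \<open>dir z\<close> itself;
  together with \<open>e\<close> and \<open>f\<close> this vector spans the space, so only the two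
  equations \<open>G1\<close>, \<open>G2\<close> remain.\<close>

lemma critical_direction_dir_iff:
  "critical_direction (Suc m) v (dir z) \<longleftrightarrow> G1 v z = 0 \<and> G2 v z = 0 \<and> F0 v z \<noteq> 0"
proof -
  let ?L = "\<lambda>a. r2 z * ip v (linear_form (dir z) ^ Suc m * linear_form a) - (dir z \<bullet> a) * F0 v z"
  have F0: "F0 v z = ip v (linear_form (dir z) ^ p)" by (simp only: F0_def mult_1_right)
  have lin: "?L (a + b) = ?L a + ?L b" "?L (c *\<^sub>R a) = c * ?L a" for a b c
    by (simp_all add: linear_form_add linear_form_scaleR distrib_left poly_scaleR_mult_right poly_scaleR_mult_left bombieri_linear inner_add_right algebra_simps
      del: power_Suc)
  have "linear_form (dir z) ^ Suc m * linear_form (dir z) = linear_form (dir z) ^ p" by (simp add: ac_simps)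
  then have Ld: "?L (dir z) = 0" unfolding F0 by (simp only: dir_inner diff_self)
  have Le: "?L e = G1 v z" "?L f = G2 v z" by (simp_all only: G1_def G2_def F1_def F2_def dir_inner)
  have "critical_direction (Suc m) v (dir z) \<longleftrightarrow> F0 v z \<noteq> 0 \<and> (\<forall>a. ?L a = 0)"
    unfolding critical_direction_def F0 dir_inner using dir_neq_0[of z] by auto
  also have "(\<forall>a. ?L a = 0) \<longleftrightarrow> G1 v z = 0 \<and> G2 v z = 0"
  proof
    assume "\<forall>a. ?L a = 0"
    then show "G1 v z = 0 \<and> G2 v z = 0" using Le by metis
  next
    assume 0: "G1 v z = 0 \<and> G2 v z = 0"
    show "\<forall>a. ?L a = 0"
    proof
      fix a
      have "?L ((a \<bullet> n) *\<^sub>R dir z + (a \<bullet> e - (a \<bullet> n) * z $ 1) *\<^sub>R e + (a \<bullet> f - (a \<bullet> n) * z $ 2) *\<^sub>R f) = 0"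
        unfolding lin Ld Le using 0 by simp
      moreover have "(a \<bullet> n) *\<^sub>R dir z + (a \<bullet> e - (a \<bullet> n) * z $ 1) *\<^sub>R e + (a \<bullet> f - (a \<bullet> n) * z $ 2) *\<^sub>R f = a"
        using expand[of a] by (simp add: dir_def algebra_simps)
      ultimately show "?L a = 0" by simp
    qed
  qed
  finally show ?thesis by blast
qed

lemma exists_dir:
  assumes "u \<bullet> n \<noteq> 0"
  shows "\<exists>z. u = (u \<bullet> n) *\<^sub>R dir z \<and> (u \<bullet> u) = (u \<bullet> n)\<^sup>2 * (1 + ((z $ 1)\<^sup>2 + (z $ 2)\<^sup>2))"
proof -
  define z :: "real^2" where "z = ((u \<bullet> e) / (u \<bullet> n)) *\<^sub>R axis 1 1 + ((u \<bullet> f) / (u \<bullet> n)) *\<^sub>R axis 2 1"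
  have zc: "z $ 1 = (u \<bullet> e) / (u \<bullet> n)" "z $ 2 = (u \<bullet> f) / (u \<bullet> n)" by (simp_all add: z_def axis_def)
  have u: "u = (u \<bullet> n) *\<^sub>R dir z"
    using expand[of u] assms by (simp add: dir_def zc scaleR_add_right)
  then have "u \<bullet> u = ((u \<bullet> n) *\<^sub>R dir z) \<bullet> ((u \<bullet> n) *\<^sub>R dir z)" by simp
  also have "\<dots> = (u \<bullet> n)\<^sup>2 * r2 z" by (simp add: dir_inner power2_eq_square)
  finally show ?thesis using u unfolding r2_def by (metis add.assoc)
qed

end

section \<open>The expected number of critical points\<close>

text \<open>Vanishes on the line at infinity and on the circle where \<open>detA = 0\<close> in the chart of the standard frame.\<close>

definition degeneracy :: "nat \<Rightarrow> real^3 \<Rightarrow> real" where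
  "degeneracy m u = u $ 1 * (real (Suc (Suc m)) * (u $ 1)\<^sup>2 - real (Suc m) * (u \<bullet> u))"

lemma degeneracy_scaleR: "degeneracy m (c *\<^sub>R u) = c ^ 3 * degeneracy m u"
  by (simp add: degeneracy_def power3_eq_cube power2_eq_square algebra_simps)

lemma polar_coordinates_2:
  fixes a b \<rho> :: real
  assumes "a\<^sup>2 + b\<^sup>2 = \<rho>\<^sup>2" "\<rho> > 0"
  shows "\<exists>\<theta>. a = \<rho> * cos \<theta> \<and> b = \<rho> * sin \<theta>"
proof -
  have "(a / \<rho>)\<^sup>2 + (b / \<rho>)\<^sup>2 = 1" using assms by (simp add: power_divide add_divide_distrib[symmetric])
  then obtain \<theta> where "a / \<rho> = cos \<theta>" "b / \<rho> = sin \<theta>" using sincos_total_2pi by metis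
  then show ?thesis using assms(2) by (intro exI[of _ \<theta>]) (simp add: field_simps)
qed

lemma inner_real3: "(x :: real^3) \<bullet> y = x $ 1 * y $ 1 + x $ 2 * y $ 2 + x $ 3 * y $ 3"
  by (simp add: inner_vec_def sum_3)

text \<open>The bad directions form a plane and a quadratic cone, the cones over the circles
  \<open>y1\<close> and \<open>y2\<close>; seen in any frame, they cut out null sets of the
  chart.\<close>

lemma (in frame) AE_degeneracy_neq_0: "AE z in lborel. degeneracy m (dir z) \<noteq> 0"
proof -
  define \<rho> where "\<rho> = 1 / sqrt (real (Suc m))"
  have \<rho>: "\<rho> > 0" "\<rho>\<^sup>2 = 1 / real (Suc m)" by (simp_all add: \<rho>_def power_divide)
  define y1 where "y1 \<theta> = cos \<theta> *\<^sub>R axis 2 1 + sin \<theta> *\<^sub>R (axis 3 1 :: real^3)" for \<theta> :: real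
  define y2 where "y2 \<theta> = axis 1 1 + (\<rho> * cos \<theta>) *\<^sub>R axis 2 1 + (\<rho> * sin \<theta>) *\<^sub>R (axis 3 1 :: real^3)" for \<theta> :: real
  have "y1 differentiable_on UNIV" "y2 differentiable_on UNIV"
    unfolding y1_def[abs_def] y2_def[abs_def] differentiable_on_def differentiable_def
    by (auto intro!: exI derivative_eq_intros)
  then have "negligible ({z. \<exists>r \<theta>. dir z = r *\<^sub>R y1 \<theta>} \<union> {z. \<exists>r \<theta>. dir z = r *\<^sub>R y2 \<theta>})"
    by (intro negligible_Un negligible_cone_over_curve)
  then have "AE z in lebesgue. z \<notin> {z. \<exists>r \<theta>. dir z = r *\<^sub>R y1 \<theta>} \<union> {z. \<exists>r \<theta>. dir z = r *\<^sub>R y2 \<theta>}"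
    by (intro AE_not_in) (simp add: negligible_iff_null_sets)
  then have "AE z in lborel. z \<notin> {z. \<exists>r \<theta>. dir z = r *\<^sub>R y1 \<theta>} \<union> {z. \<exists>r \<theta>. dir z = r *\<^sub>R y2 \<theta>}"
    by (simp only: AE_completion_iff)
  then show ?thesis
  proof eventually_elim
    case (elim z)
    show ?case
    proof
      assume bad: "degeneracy m (dir z) = 0"
      define u where "u = dir z"
      have "\<exists>r \<theta>. u = r *\<^sub>R y1 \<theta> \<or> u = r *\<^sub>R y2 \<theta>"
      proof (cases "u $ 1 = 0")
        case True
        have "u \<noteq> 0" using dir_neq_0 by (simp add: u_def)
        then have "u $ 2 \<noteq> 0 \<or> u $ 3 \<noteq> 0" using True by (auto simp: vec_eq_iff forall_3)
        then have r: "sqrt ((u $ 2)\<^sup>2 + (u $ 3)\<^sup>2) > 0" by (simp add: sum_power2_gt_zero_iff)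
        obtain \<theta> where "u $ 2 = sqrt ((u $ 2)\<^sup>2 + (u $ 3)\<^sup>2) * cos \<theta>" "u $ 3 = sqrt ((u $ 2)\<^sup>2 + (u $ 3)\<^sup>2) * sin \<theta>"
          using polar_coordinates_2[OF _ r, of "u $ 2" "u $ 3"] by auto
        then have "u = sqrt ((u $ 2)\<^sup>2 + (u $ 3)\<^sup>2) *\<^sub>R y1 \<theta>"
          using True by (simp add: vec_eq_iff forall_3 y1_def axis_def)
        then show ?thesis by blast
      next
        case False
        then have "real (Suc (Suc m)) * (u $ 1)\<^sup>2 = real (Suc m) * (u \<bullet> u)"
          using bad unfolding degeneracy_def u_def[symmetric] by simp
        then have eq: "(u $ 1)\<^sup>2 = real (Suc m) * ((u $ 2)\<^sup>2 + (u $ 3)\<^sup>2)"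
          by (simp add: inner_real3 power2_eq_square algebra_simps)
        have gen: "X / U = 1 / S" if "U = S * X" "U \<noteq> 0" for X U S :: real
          using that by simp
        have "(u $ 2 / u $ 1)\<^sup>2 + (u $ 3 / u $ 1)\<^sup>2 = ((u $ 2)\<^sup>2 + (u $ 3)\<^sup>2) / (u $ 1)\<^sup>2"
          by (simp add: power_divide add_divide_distrib)
        also have "\<dots> = \<rho>\<^sup>2" unfolding \<rho>(2) by (rule gen[OF eq]) (use False in simp)
        finally obtain \<theta> where "u $ 2 / u $ 1 = \<rho> * cos \<theta>" "u $ 3 / u $ 1 = \<rho> * sin \<theta>"
          using polar_coordinates_2 \<rho>(1) by blast
        then have "u = u $ 1 *\<^sub>R y2 \<theta>"
          using False by (simp add: vec_eq_iff forall_3 y2_def axis_def field_simps)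
        then show ?thesis by blast
      qed
      then show False using elim unfolding u_def by blast
    qed
  qed
qed

lemma (in frame) continuous_degeneracy: "continuous_on UNIV (\<lambda>z. degeneracy m (dir z))"
  unfolding degeneracy_def dir_def by (intro continuous_intros)

text \<open>The Kac-Rice formula with the degeneracy function as extra equation integrates over a
  null set, so the expected number of such solutions is 0.\<close>

lemma (in frame) AE_no_degenerate_solutions:
  assumes G: "gaussian_law p G"
  shows "AE v in G. nsol (\<lambda>z. degeneracy m (dir z)) v = 0"
proof -
  have "(\<integral>\<^sup>+v. nsol (\<lambda>z. degeneracy m (dir z)) v \<partial>G) = (\<integral>\<^sup>+z. 0 \<partial>(lborel :: (real^2) measure))"
    unfolding kac_rice[OF G continuous_degeneracy refl]
    by (intro nn_integral_cong_AE eventually_mono[OF AE_degeneracy_neq_0]) auto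
  moreover have "nsol (\<lambda>z. degeneracy m (dir z)) \<in> borel_measurable G"
    using measurable_nsol[OF continuous_degeneracy] measurable_cong_sets[OF sets_gaussian_law[OF G] refl] by blast
  ultimately show ?thesis by (simp add: nn_integral_0_iff_AE)
qed

lemma exists_frame:
  fixes d :: "real^3"
  assumes "d \<noteq> 0"
  shows "\<exists>e f. frame ((1 / norm d) *\<^sub>R d) e f"
proof -
  let ?n = "(1 / norm d) *\<^sub>R d"
  have n: "norm ?n = 1" using assms by simp
  obtain y where y: "y \<noteq> 0" "orthogonal ?n y" using orthogonal_to_vector_exists[of ?n] by (auto simp: orthogonal_commute)
  let ?e = "(1 / norm y) *\<^sub>R y"
  have e: "norm ?e = 1" "?n \<bullet> ?e = 0" using y by (auto simp: orthogonal_def)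
  let ?f = "cross3 ?n ?e"
  have "(norm ?f)\<^sup>2 = 1" using norm_cross[of ?n ?e] unfolding n e by simp
  then have f: "?f \<bullet> ?f = 1" by (simp only: power2_norm_eq_inner)
  have "frame ?n ?e ?f"
  proof
    show "?n \<bullet> ?n = 1" "?e \<bullet> ?e = 1" using n e(1) by (simp_all only: dot_square_norm power_one)
  qed (use e f in \<open>simp_all only: dot_cross_self\<close>)
  then show ?thesis by blast
qed

text \<open>A degenerate direction of the standard chart is a regular point of the chart of some
  frame with normal from a countable dense set, where almost surely no critical direction is
  degenerate. Countably many exceptional sets are discarded.\<close>

lemma AE_critical_not_degenerate:
  assumes G: "gaussian_law (Suc (Suc m)) G"
  shows "AE v in G. \<forall>u. critical_direction (Suc m) v u \<longrightarrow> degeneracy m u \<noteq> 0"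
proof -
  obtain D :: "(real^3) set" where D: "countable D" "\<And>X. open X \<Longrightarrow> X \<noteq> {} \<Longrightarrow> \<exists>d\<in>D. d \<in> X"
    using countable_dense_setE by metis
  obtain e f where fr: "\<And>d. d \<noteq> 0 \<Longrightarrow> frame ((1 / norm d) *\<^sub>R d) (e d) (f d)" using exists_frame by metis
  have "AE v in G. \<forall>d\<in>D - {0}. frame.nsol ((1 / norm d) *\<^sub>R d) (e d) (f d) m (\<lambda>z. degeneracy m (frame.dir ((1 / norm d) *\<^sub>R d) (e d) (f d) z)) v = 0"
    using D(1) frame.AE_no_degenerate_solutions[OF fr G] by (subst AE_ball_countable) auto
  then show ?thesis
  proof (eventually_elim, intro allI impI notI)
    fix v u
    assume zero: "\<forall>d\<in>D - {0}. frame.nsol ((1 / norm d) *\<^sub>R d) (e d) (f d) m (\<lambda>z. degeneracy m (frame.dir ((1 / norm d) *\<^sub>R d) (e d) (f d) z)) v = 0"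
      and crit: "critical_direction (Suc m) v u" and bad: "degeneracy m u = 0"
    have unz: "u \<noteq> 0" using crit by (simp add: critical_direction_def)
    \<comment> \<open>Normals d for which \<open>u\<close> lies neither at infinity nor on the
      degenerate circle of the chart. The set is open and contains \<open>u\<close>, where the
      second condition reads p \<noteq> p - 1, so it meets the dense set.\<close>
    let ?X = "{d :: real^3. u \<bullet> d \<noteq> 0} \<inter> {d. real (Suc (Suc m)) * (u \<bullet> d)\<^sup>2 \<noteq> real (Suc m) * (u \<bullet> u) * (d \<bullet> d)}"
    have "open ?X" by (intro open_Int open_Collect_neq continuous_intros)
    moreover have "u \<in> ?X" using unz by (simp add: power2_eq_square)
    ultimately obtain d where d: "d \<in> D" "d \<in> ?X" using D(2)[of ?X] by blast
    have d0: "d \<noteq> 0" using d(2) by auto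
    let ?n = "(1 / norm d) *\<^sub>R d"
    interpret frame ?n "e d" "f d" m by (rule fr[OF d0])
    have un: "u \<bullet> ?n \<noteq> 0" using d(2) d0 by simp
    obtain z where z: "u = (u \<bullet> ?n) *\<^sub>R dir z" "u \<bullet> u = (u \<bullet> ?n)\<^sup>2 * (1 + ((z $ 1)\<^sup>2 + (z $ 2)\<^sup>2))"
      using exists_dir[OF un] by blast
    have "critical_direction (Suc m) v (dir z)" using crit critical_direction_scaleR(1)[OF un] z(1) by metis
    then have sol: "G1 v z = 0" "G2 v z = 0" "F0 v z \<noteq> 0" by (auto simp: critical_direction_dir_iff)
    have "degeneracy m u = (u \<bullet> ?n) ^ 3 * degeneracy m (dir z)"
      using arg_cong[OF z(1), of "degeneracy m"] by (simp only: degeneracy_scaleR)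
    then have bz: "degeneracy m (dir z) = 0" using bad un by simp
    have "detA z \<noteq> 0"
    proof
      assume "detA z = 0"
      then have 1: "1 = real (Suc m) * ((z $ 1)\<^sup>2 + (z $ 2)\<^sup>2)" using r2_pos[of z] by (simp add: detA_eq del: of_nat_Suc)
      have "real (Suc m) * (u \<bullet> u) = (u \<bullet> ?n)\<^sup>2 * (real (Suc m) + real (Suc m) * ((z $ 1)\<^sup>2 + (z $ 2)\<^sup>2))"
        unfolding z(2) by (simp only: distrib_left ac_simps mult_1_right)
      also have "\<dots> = real (Suc (Suc m)) * (u \<bullet> ?n)\<^sup>2" unfolding 1[symmetric] by simp
      finally have "real (Suc m) * (u \<bullet> u) * (d \<bullet> d) = real (Suc (Suc m)) * (u \<bullet> d)\<^sup>2"
        using d0 by (simp add: power2_norm_eq_inner[symmetric] power_divide power2_eq_square field_simps del: of_nat_Suc)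
      then show False using d(2) by simp
    qed
    then have "z \<in> {z. detA z \<noteq> 0 \<and> degeneracy m (dir z) = 0 \<and> G1 v z = 0 \<and> G2 v z = 0 \<and> F0 v z \<noteq> 0}"
      using sol bz by simp
    moreover have "nsol (\<lambda>z. degeneracy m (dir z)) v = 0" using zero d(1) d0 by blast
    ultimately show False unfolding nsol_def by (auto simp: emeasure_count_space_eq_0)
  qed
qed

section \<open>From solutions in the chart to critical points\<close>

lemma emeasure_count_space_image:
  "inj_on g A \<Longrightarrow> emeasure (count_space UNIV) (g ` A) = emeasure (count_space UNIV) A"
  by (simp add: emeasure_count_space card_image finite_image_iff)

text \<open>Away from the degenerate directions each critical line has exactly one representative
  with first coordinate 1, and this representative is not on the circle
  \<open>detA = 0\<close>.\<close>

lemma num_critical_points_eq_nsol: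
  assumes nb: "\<And>u. critical_direction (Suc m) v u \<Longrightarrow> degeneracy m u \<noteq> 0"
  shows "num_critical_points (Suc (Suc m)) (pure_powers (Suc (Suc m))) v =
    frame.nsol (axis 1 1) (axis 2 1) (axis 3 1) m (\<lambda>_. 0) v"
proof -
  interpret frame "axis 1 1" "axis 2 1" "axis 3 1" m
    by unfold_locales (simp_all add: inner_axis_axis)
  let ?Z = "{z. detA z \<noteq> 0 \<and> (\<lambda>_. 0) z = (0::real) \<and> G1 v z = 0 \<and> G2 v z = 0 \<and> F0 v z \<noteq> 0}"
  have Z: "z \<in> ?Z \<longleftrightarrow> critical_direction (Suc m) v (dir z)" for z
  proof -
    have "detA z \<noteq> 0" if c: "critical_direction (Suc m) v (dir z)"
    proof
      assume "detA z = 0"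
      then have 1: "1 = real (Suc m) * ((z $ 1)\<^sup>2 + (z $ 2)\<^sup>2)" using r2_pos[of z] by (simp add: detA_eq del: of_nat_Suc)
      have "dir z $ 1 = 1" using dir_inner(1)[of z] by (simp only: inner_axis inner_real_def mult_1_right)
      then have "degeneracy m (dir z) = real (Suc (Suc m)) - (real (Suc m) + real (Suc m) * ((z $ 1)\<^sup>2 + (z $ 2)\<^sup>2))"
        unfolding degeneracy_def dir_inner r2_def by (simp add: distrib_left del: of_nat_Suc)
      also have "\<dots> = 0" unfolding 1[symmetric] by simp
      finally show False using nb[OF c] by simp
    qed
    then show ?thesis by (auto simp: critical_direction_dir_iff)
  qed
  have "critical_points (Suc (Suc m)) (pure_powers (Suc (Suc m))) v = (\<lambda>z. critical_point_of (Suc m) v (dir z)) ` ?Z"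
  proof (intro equalityI subsetI)
    fix x assume "x \<in> critical_points (Suc (Suc m)) (pure_powers (Suc (Suc m))) v"
    then obtain u where u: "critical_direction (Suc m) v u" "x = critical_point_of (Suc m) v u"
      unfolding critical_points_eq_image by auto
    have u1: "u \<bullet> axis 1 1 \<noteq> 0" using nb[OF u(1)] by (auto simp: degeneracy_def inner_axis)
    obtain z where z: "u = (u \<bullet> axis 1 1) *\<^sub>R dir z" using exists_dir[OF u1] by blast
    have "critical_direction (Suc m) v (dir z)" "x = critical_point_of (Suc m) v (dir z)"
      using u critical_direction_scaleR[OF u1] z by metis+
    then show "x \<in> (\<lambda>z. critical_point_of (Suc m) v (dir z)) ` ?Z" using Z by blast
  next
    fix x assume "x \<in> (\<lambda>z. critical_point_of (Suc m) v (dir z)) ` ?Z"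
    then show "x \<in> critical_points (Suc (Suc m)) (pure_powers (Suc (Suc m))) v"
      unfolding critical_points_eq_image using Z by blast
  qed
  moreover have "inj_on (\<lambda>z. critical_point_of (Suc m) v (dir z)) ?Z"
  proof (rule inj_onI)
    fix z w assume zw: "z \<in> ?Z" "w \<in> ?Z" "critical_point_of (Suc m) v (dir z) = critical_point_of (Suc m) v (dir w)"
    then obtain k where k: "dir w = k *\<^sub>R dir z" using critical_point_of_eq_imp_parallel Z by blast
    have "k = 1" using arg_cong[OF k, of "\<lambda>x. x \<bullet> axis 1 1"] dir_inner(1)[of z] dir_inner(1)[of w] by simp
    then have "dir w = dir z" using k by simp
    then have "z $ 1 = w $ 1" "z $ 2 = w $ 2" using dir_inner(2,3)[of z] dir_inner(2,3)[of w] by simp_all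
    then show "z = w" by (simp add: vec_eq_iff forall_2)
  qed
  ultimately show ?thesis unfolding num_critical_points_def nsol_def by (simp only: emeasure_count_space_image)
qed

text \<open>Each critical point corresponds to an antipodal pair of unit vectors. Unlike the count
  in a chart this holds for every \<open>v\<close>, which is what measurability requires.\<close>

lemma num_critical_points_sphere:
  "2 * num_critical_points (Suc m) (pure_powers (Suc m)) v =
    emeasure (count_space UNIV) {u. u \<bullet> u = 1 \<and> critical_direction m v u}"
proof -
  \<comment> \<open>The lexicographically positive vectors select one of each pair u, - u.\<close>
  define pos where "pos u \<longleftrightarrow> u $ 1 > 0 \<or> (u $ 1 = 0 \<and> (u $ 2 > 0 \<or> (u $ 2 = 0 \<and> u $ 3 > 0)))" for u :: "real^3"
  have pos: "pos (- u) \<longleftrightarrow> \<not> pos u" if "u \<noteq> 0" for u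
    using that unfolding pos_def vec_eq_iff forall_3 by auto
  let ?T = "{u. u \<bullet> u = 1 \<and> critical_direction m v u}"
  let ?P = "{u \<in> ?T. pos u}"
  have cm: "critical_direction m v (- u) \<longleftrightarrow> critical_direction m v u" "critical_point_of m v (- u) = critical_point_of m v u" for u
    using critical_direction_scaleR[of "-1" m v u] by simp_all
  have nz: "u \<noteq> 0" if "u \<in> ?T" for u using that by auto
  have T: "?T = ?P \<union> uminus ` ?P"
  proof (intro equalityI subsetI)
    fix u assume u: "u \<in> ?T"
    show "u \<in> ?P \<union> uminus ` ?P"
    proof (cases "pos u")
      case False
      then have "- u \<in> ?P" using pos[OF nz[OF u]] u cm by simp
      from image_eqI[OF _ this, of u uminus] show ?thesis by (intro UnI2) simp
    qed (use u in simp)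
  qed (use cm in auto)
  have disj: "?P \<inter> uminus ` ?P = {}" using pos nz by auto
  have "emeasure (count_space UNIV) ?T = emeasure (count_space UNIV) ?P + emeasure (count_space UNIV) (uminus ` ?P)"
    by (subst T, rule plus_emeasure[symmetric]) (use disj in auto)
  also have "emeasure (count_space UNIV) (uminus ` ?P) = emeasure (count_space UNIV) ?P"
    by (rule emeasure_count_space_image) auto
  also have "emeasure (count_space UNIV) ?P = num_critical_points (Suc m) (pure_powers (Suc m)) v"
  proof -
    have "critical_points (Suc m) (pure_powers (Suc m)) v = critical_point_of m v ` ?P"
      unfolding critical_points_eq_image
    proof (intro equalityI subsetI)
      fix x assume "x \<in> critical_point_of m v ` {u. critical_direction m v u}"
      then obtain u where u: "critical_direction m v u" "x = critical_point_of m v u" by auto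
      have "u \<noteq> 0" using u by (simp add: critical_direction_def)
      then have k: "1 / norm u \<noteq> 0" by simp
      let ?w = "(1 / norm u) *\<^sub>R u"
      have w: "?w \<in> ?T" "x = critical_point_of m v ?w"
        using u critical_direction_scaleR[OF k, of m v u] \<open>u \<noteq> 0\<close> by (auto simp: dot_square_norm power2_eq_square)
      show "x \<in> critical_point_of m v ` ?P"
      proof (cases "pos ?w")
        case True
        then show ?thesis using w by blast
      next
        case False
        then have "- ?w \<in> ?P" using pos[OF nz[OF w(1)]] w(1) cm by simp
        moreover have "x = critical_point_of m v (- ?w)" using w(2) cm(2)[of ?w] by (simp only:)
        ultimately show ?thesis by (intro image_eqI)
      qed
    qed auto
    moreover have "inj_on (critical_point_of m v) ?P"
    proof (rule inj_onI)
      fix u w assume uw: "u \<in> ?P" "w \<in> ?P" "critical_point_of m v u = critical_point_of m v w"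
      then obtain k where k: "w = k *\<^sub>R u" using critical_point_of_eq_imp_parallel by blast
      have "k * k = 1" using uw(1,2) unfolding k by simp
      then have "k = 1 \<or> k = -1" by (simp add: square_eq_1_iff)
      moreover have "k \<noteq> -1" using uw pos[of u] nz[of u] unfolding k by auto
      ultimately show "u = w" using k by simp
    qed
    ultimately show ?thesis unfolding num_critical_points_def by (simp only: emeasure_count_space_image)
  qed
  finally show ?thesis by (simp add: mult_2)
qed

lemma measurable_num_critical_points:
  "num_critical_points (Suc m) (pure_powers (Suc m)) \<in> borel_measurable poly_sigma"
proof -
  let ?f = "\<lambda>v u. bombieri (Suc m) v (linear_form u ^ Suc m * 1)"
  let ?g = "\<lambda>i v u. bombieri (Suc m) v (linear_form u ^ m * basis_vec i)"
  \<comment> \<open>Unit length, the gradient condition tested on the three basis vectors, and a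
    lower bound 1 / (k + 1) on the value; by linearity the three tests cover all directions.\<close>
  define \<Phi> where "\<Phi> k v u = \<bar>u \<bullet> u - 1\<bar> + (\<Sum>i\<in>UNIV. \<bar>(u \<bullet> u) * ?g i v u - u $ i * ?f v u\<bar>) + max 0 (1 / real (Suc k) - \<bar>?f v u\<bar>)"
    for k :: nat and v and u :: "real^3"
  have cont: "continuous_on UNIV (\<lambda>u. bombieri (Suc m) v (linear_form u ^ k * c))" for v k c
    by (intro continuous_at_imp_continuous_on ballI has_derivative_continuous[OF has_derivative_bombieri_power_mult])
  have "(\<lambda>v. emeasure (count_space UNIV) {u. \<exists>k. \<Phi> k v u = 0}) \<in> borel_measurable poly_sigma"
  proof (rule borel_measurable_card_zeros)
    show "continuous_on UNIV (\<Phi> k v)" for k v unfolding \<Phi>_def[abs_def] by (intro continuous_intros cont)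
    show "\<Phi> k v u \<ge> 0" for k v u unfolding \<Phi>_def by (intro add_nonneg_nonneg sum_nonneg) auto
    show "(\<lambda>v. \<Phi> k v u) \<in> borel_measurable poly_sigma" for k u unfolding \<Phi>_def by measurable
  qed
  moreover have "(\<exists>k. \<Phi> k v u = 0) \<longleftrightarrow> u \<bullet> u = 1 \<and> critical_direction m v u" for v u
  proof -
    have lin: "bombieri (Suc m) v (linear_form u ^ m * linear_form a) = (\<Sum>i\<in>UNIV. a $ i * ?g i v u)" for a
      by (simp add: linear_form_def sum_distrib_left poly_scaleR_mult_right bombieri_sum_right bombieri_scaleR_right)
    have "(\<forall>a. (u \<bullet> u) * bombieri (Suc m) v (linear_form u ^ m * linear_form a) = (u \<bullet> a) * bombieri (Suc m) v (linear_form u ^ Suc m))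
       \<longleftrightarrow> (\<forall>i. (u \<bullet> u) * ?g i v u = u $ i * ?f v u)"
    proof
      assume *: "\<forall>a. (u \<bullet> u) * bombieri (Suc m) v (linear_form u ^ m * linear_form a) = (u \<bullet> a) * bombieri (Suc m) v (linear_form u ^ Suc m)"
      show "\<forall>i. (u \<bullet> u) * ?g i v u = u $ i * ?f v u"
      proof
        fix i
        have "linear_form (axis i 1) = basis_vec i"
          by (simp add: linear_form_def axis_def if_distrib[of "\<lambda>c. c *\<^sub>R _"] cong: if_cong)
        then show "(u \<bullet> u) * ?g i v u = u $ i * ?f v u" using *[rule_format, of "axis i 1"] by (simp add: inner_axis)
      qed
    next
      assume *: "\<forall>i. (u \<bullet> u) * ?g i v u = u $ i * ?f v u"
      show "\<forall>a. (u \<bullet> u) * bombieri (Suc m) v (linear_form u ^ m * linear_form a) = (u \<bullet> a) * bombieri (Suc m) v (linear_form u ^ Suc m)"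
      proof
        fix a
        have "(u \<bullet> u) * bombieri (Suc m) v (linear_form u ^ m * linear_form a) = (\<Sum>i\<in>UNIV. a $ i * ((u \<bullet> u) * ?g i v u))"
          unfolding lin sum_distrib_left by (simp only: ac_simps)
        also have "\<dots> = (u \<bullet> a) * ?f v u" unfolding *[rule_format] by (simp add: inner_vec_def sum_distrib_right ac_simps)
        finally show "(u \<bullet> u) * bombieri (Suc m) v (linear_form u ^ m * linear_form a) = (u \<bullet> a) * bombieri (Suc m) v (linear_form u ^ Suc m)" by simp
      qed
    qed
    then have cd: "u \<bullet> u = 1 \<and> critical_direction m v u \<longleftrightarrow> u \<bullet> u = 1 \<and> ?f v u \<noteq> 0 \<and> (\<forall>i. (u \<bullet> u) * ?g i v u = u $ i * ?f v u)"
      unfolding critical_direction_def by auto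
    show ?thesis unfolding cd
    proof
      assume "\<exists>k. \<Phi> k v u = 0"
      then obtain k where k: "\<Phi> k v u = 0" ..
      have nn: "(\<Sum>i\<in>UNIV. \<bar>(u \<bullet> u) * ?g i v u - u $ i * ?f v u\<bar>) \<ge> 0" by (intro sum_nonneg) auto
      have s: "\<bar>u \<bullet> u - 1\<bar> = 0" "(\<Sum>i\<in>UNIV. \<bar>(u \<bullet> u) * ?g i v u - u $ i * ?f v u\<bar>) = 0" "max 0 (1 / real (Suc k) - \<bar>?f v u\<bar>) = 0"
        using k nn unfolding \<Phi>_def by linarith+
      have "\<forall>i. (u \<bullet> u) * ?g i v u = u $ i * ?f v u"
        using s(2) by (subst (asm) sum_nonneg_eq_0_iff) auto
      moreover have "1 / real (Suc k) > 0" by simp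
      ultimately show "u \<bullet> u = 1 \<and> ?f v u \<noteq> 0 \<and> (\<forall>i. (u \<bullet> u) * ?g i v u = u $ i * ?f v u)"
        using s(1,3) by (auto simp: max_def split: if_splits)
    next
      assume *: "u \<bullet> u = 1 \<and> ?f v u \<noteq> 0 \<and> (\<forall>i. (u \<bullet> u) * ?g i v u = u $ i * ?f v u)"
      then have "\<bar>?f v u\<bar> > 0" by simp
      then obtain k where "1 / real (Suc k) < \<bar>?f v u\<bar>" using nat_approx_posE by blast
      moreover have "(\<Sum>i\<in>UNIV. \<bar>(u \<bullet> u) * ?g i v u - u $ i * ?f v u\<bar>) = 0"
      proof (rule sum.neutral, rule ballI)
        fix i
        have "(u \<bullet> u) * ?g i v u = u $ i * ?f v u" using * by blast
        then show "\<bar>(u \<bullet> u) * ?g i v u - u $ i * ?f v u\<bar> = 0" by (simp only: diff_self abs_zero)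
      qed
      moreover have "\<bar>u \<bullet> u - 1\<bar> = 0" using * by simp
      ultimately have "\<Phi> k v u = 0" unfolding \<Phi>_def by linarith
      then show "\<exists>k. \<Phi> k v u = 0" ..
    qed
  qed
  ultimately have "(\<lambda>v. 2 * num_critical_points (Suc m) (pure_powers (Suc m)) v) \<in> borel_measurable poly_sigma"
    unfolding num_critical_points_sphere by simp
  then have "(\<lambda>v. (2 * num_critical_points (Suc m) (pure_powers (Suc m)) v) / 2) \<in> borel_measurable poly_sigma"
    by measurable
  moreover have "(2 * x) / 2 = x" for x :: ennreal
    by (subst mult.commute, rule mult_divide_eq_ennreal) auto
  ultimately show ?thesis by simp
qed

text \<open>In degree one, pairing with \<open>v\<close> is the inner product with a fixed vector
  \<open>t\<close>, so every critical direction is parallel to \<open>t\<close>, and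
  \<open>t\<close> itself is one as soon as it is nonzero. Almost surely already its first
  coordinate is nonzero.\<close>

lemma AE_num_critical_points_degree_one:
  assumes G: "gaussian_law 1 G"
  shows "AE v in G. num_critical_points 1 (pure_powers 1) v = 1"
proof -
  have basis: "linear_form (axis i 1) = basis_vec i" for i
    by (simp add: linear_form_def axis_def if_distrib[of "\<lambda>c. c *\<^sub>R _"] cong: if_cong)
  let ?c = "basis_vec 1"
  have c: "?c \<in> sym_power 1" "bombieri 1 ?c ?c = 1"
    using linear_form_sym_power[of "axis 1 1"] bombieri_powers[of 1 "axis 1 1" "axis 1 1"]
    by (simp_all add: basis inner_axis_axis)
  have "\<exists>(I :: real_poly3 set) b g. onb 1 I b \<and> G = gauss_rep I b \<and> inj_on g {..<1::nat} \<and> g ` {..<1} \<subseteq> I \<and> (\<forall>l<1. b (g l) = ?c)"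
    by (rule gaussian_law_extend[OF G]) (use c in auto)
  then obtain I :: "real_poly3 set" and b g where *: "onb 1 I b" "G = gauss_rep I b" "g ` {..<1::nat} \<subseteq> I" "\<forall>l<1. b (g l) = ?c"
    by metis
  define i where "i = g 0"
  have i: "i \<in> I" "b i = ?c" using *(3,4) by (auto simp: i_def)
  define K where "K = I - {i}"
  have I: "I = insert i K" and K: "finite K" "i \<notin> K" using i *(1) by (auto simp: K_def onb_def)
  have cK: "bombieri 1 ?c (b l) = 0" if "l \<in> K" for l
    using that *(1) i K I unfolding onb_def by (metis insertCI)
  have cW: "bombieri 1 ?c (s *\<^sub>R ?c + (\<Sum>l\<in>K. x l *\<^sub>R b l)) = s" for s x
    by (simp add: bombieri_linear bombieri_sum_right c cK del: One_nat_def)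
  let ?\<Psi> = "\<lambda>v. indicator {0} (bombieri 1 ?c v) :: ennreal"
  have \<Psi>m: "?\<Psi> \<in> borel_measurable poly_sigma" by measurable
  have "(\<integral>\<^sup>+v. ?\<Psi> v \<partial>G) = (\<integral>\<^sup>+x. \<integral>\<^sup>+s. indicator {0} s \<partial>gauss \<partial>PiM K (\<lambda>_. gauss))"
    unfolding *(2) I by (subst nn_integral_gauss_rep_insert[OF K \<Psi>m]) (simp only: i(2) cW)
  also have "(\<integral>\<^sup>+s. indicator {0} s \<partial>gauss) = (\<integral>\<^sup>+s. ennreal (std_normal_density s) * indicator {0} s \<partial>lborel)"
    by (rule nn_integral_gauss) measurable
  also have "\<dots> = (\<integral>\<^sup>+s. 0 \<partial>(lborel :: real measure))"
    by (intro nn_integral_cong_AE eventually_mono[OF AE_lborel_singleton[of "0::real"]]) auto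
  finally have "(\<integral>\<^sup>+v. ?\<Psi> v \<partial>G) = 0" by simp
  moreover have "?\<Psi> \<in> borel_measurable G" using \<Psi>m measurable_cong_sets[OF sets_gaussian_law[OF G] refl] by blast
  ultimately have "AE v in G. ?\<Psi> v = 0" by (simp add: nn_integral_0_iff_AE)
  then show ?thesis
  proof eventually_elim
    case (elim v)
    define t where "t = (\<chi> i. bombieri 1 v (basis_vec i))"
    have vt: "bombieri 1 v (linear_form a) = t \<bullet> a" for a
      by (simp add: t_def linear_form_def bombieri_sum_right bombieri_scaleR_right inner_vec_def mult.commute)
    have "t $ 1 \<noteq> 0" using elim bombieri_commute[of 1 v "basis_vec 1"] by (auto simp: t_def indicator_def split: if_splits)
    then have t0: "t \<noteq> 0" by auto
    have cd: "critical_direction 0 v u \<longleftrightarrow> u \<noteq> 0 \<and> t \<bullet> u \<noteq> 0 \<and> (\<forall>a. (u \<bullet> u) * (t \<bullet> a) = (u \<bullet> a) * (t \<bullet> u))" for u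
      using vt by (simp add: critical_direction_def)
    have ct: "critical_direction 0 v t" using t0 by (simp add: cd mult.commute)
    have "u = ((t \<bullet> u) / (t \<bullet> t)) *\<^sub>R t \<and> (t \<bullet> u) / (t \<bullet> t) \<noteq> 0" if u: "critical_direction 0 v u" for u
    proof -
      \<comment> \<open>The gradient is the constant vector \<open>t\<close>; being parallel to
        \<open>u\<close> for all test vectors means this vector equation.\<close>
      have "(u \<bullet> u) *\<^sub>R t = (t \<bullet> u) *\<^sub>R u"
      proof (rule vector_eq_rdot[THEN iffD1], rule allI)
        fix a
        show "((u \<bullet> u) *\<^sub>R t) \<bullet> a = ((t \<bullet> u) *\<^sub>R u) \<bullet> a" using u by (simp add: cd mult.commute)
      qed
      then have "((u \<bullet> u) *\<^sub>R t) \<bullet> t = ((t \<bullet> u) *\<^sub>R u) \<bullet> t" "(1 / (t \<bullet> u)) *\<^sub>R ((u \<bullet> u) *\<^sub>R t) = (1 / (t \<bullet> u)) *\<^sub>R ((t \<bullet> u) *\<^sub>R u)" by simp_all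
      moreover have tu: "t \<bullet> u \<noteq> 0" "u \<noteq> 0" using u by (auto simp: cd)
      ultimately have "u = ((u \<bullet> u) / (t \<bullet> u)) *\<^sub>R t" "(u \<bullet> u) * (t \<bullet> t) = (t \<bullet> u) * (t \<bullet> u)" by (simp_all add: inner_commute)
      moreover from this(2) have "(u \<bullet> u) / (t \<bullet> u) = (t \<bullet> u) / (t \<bullet> t)" using tu t0 by (simp add: field_simps)
      ultimately show ?thesis using tu t0 by simp
    qed
    then have same: "critical_point_of 0 v u = critical_point_of 0 v t" if "critical_direction 0 v u" for u
      using that critical_direction_scaleR(2) by metis
    have "critical_point_of 0 v ` {u. critical_direction 0 v u} = (\<lambda>_. critical_point_of 0 v t) ` {u. critical_direction 0 v u}"
      by (rule image_cong[OF refl]) (use same in blast)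
    also have "\<dots> = {critical_point_of 0 v t}" using ct by blast
    finally have "critical_points (Suc 0) (pure_powers (Suc 0)) v = {critical_point_of 0 v t}" by (simp only: critical_points_eq_image)
    then show ?case by (simp add: num_critical_points_def)
  qed
qed

lemma ED_constant:
  fixes x :: real
  assumes x: "x \<ge> 2" and k: "k = (x - 1) / x"
  shows "x * (1 - k + 4 * k * sqrt (k / (1 + 2 * k))) = 1 + 4 * ((x - 1) / (3 * x - 2)) * sqrt ((3 * x - 2) * (x - 1))"
proof -
  have "1 + 2 * k = (3 * x - 2) / x" using x by (simp add: k field_simps)
  then have kk: "k / (1 + 2 * k) = (x - 1) / (3 * x - 2)" using x by (simp add: k)
  define A where "A = sqrt (3 * x - 2)"
  define B where "B = sqrt (x - 1)"
  have A: "A > 0" "A * A = 3 * x - 2" using x by (simp_all add: A_def)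
  have "x * (1 - k + 4 * k * sqrt (k / (1 + 2 * k))) = x * (1 - k) + 4 * (x * k) * (B / A)"
    unfolding kk by (simp add: real_sqrt_divide A_def B_def algebra_simps)
  also have "x * (1 - k) = 1" using x by (simp add: k field_simps)
  also have "x * k = x - 1" using x by (simp add: k)
  \<comment> \<open>Expanding the fraction by \<open>A\<close> merges the two roots into one and
    leaves the rational denominator 3 x - 2.\<close>
  also have "4 * (x - 1) * (B / A) = 4 * ((x - 1) / (A * A)) * (A * B)" using A(1) by (simp add: field_simps)
  also have "A * B = sqrt ((3 * x - 2) * (x - 1))" by (simp add: A_def B_def real_sqrt_mult)
  finally show ?thesis by (simp only: A)
qed

theorem theorem4p5:
  fixes p :: nat and M :: "'w measure" and v :: "'w \<Rightarrow> real_poly3"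
  assumes "p \<ge> 1"
    and "prob_space M"
    and "standard_gaussian p M v"
  shows "(\<lambda>\<omega>. num_critical_points p (pure_powers p) (v \<omega>)) \<in> borel_measurable M \<and>
    (\<integral>\<^sup>+ \<omega>. num_critical_points p (pure_powers p) (v \<omega>) \<partial>M) =
      ennreal (1 + 4 * ((real p - 1) / (3 * real p - 2)) * sqrt ((3 * real p - 2) * (real p - 1)))"
proof
  have vm: "v \<in> measurable M poly_sigma" and G: "gaussian_law p (distr M poly_sigma v)"
    using standard_gaussian_law[OF assms(2,3)] by auto
  let ?G = "distr M poly_sigma v"
  have nm: "num_critical_points p (pure_powers p) \<in> borel_measurable poly_sigma"
    using measurable_num_critical_points[of "p - 1"] assms(1) by simp
  show "(\<lambda>\<omega>. num_critical_points p (pure_powers p) (v \<omega>)) \<in> borel_measurable M"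
    by (rule measurable_compose[OF vm nm])
  have "(\<integral>\<^sup>+ \<omega>. num_critical_points p (pure_powers p) (v \<omega>) \<partial>M) = (\<integral>\<^sup>+ w. num_critical_points p (pure_powers p) w \<partial>?G)"
    by (rule nn_integral_distr[OF vm, symmetric]) (use nm in simp)
  also have "\<dots> = ennreal (1 + 4 * ((real p - 1) / (3 * real p - 2)) * sqrt ((3 * real p - 2) * (real p - 1)))"
  proof (cases "p = 1")
    case True
    interpret prob_space ?G using gaussian_law_prob_space[OF G] .
    have "(\<integral>\<^sup>+ w. num_critical_points p (pure_powers p) w \<partial>?G) = (\<integral>\<^sup>+ w. 1 \<partial>?G)"
      using AE_num_critical_points_degree_one[of ?G] G True by (intro nn_integral_cong_AE) simp
    also have "\<dots> = 1" using emeasure_space_1 by simp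
    finally show ?thesis using True by simp
  next
    case False
    \<comment> \<open>The chart computation needs second derivatives and so covers exactly the
      degrees m + 2.\<close>
    then obtain m where m: "p = Suc (Suc m)" using assms(1) by (metis One_nat_def not_one_le_zero old.nat.exhaust)
    interpret fr: frame "axis 1 1" "axis 2 1" "axis 3 1" m
      by unfold_locales (simp_all add: inner_axis_axis)
    have G': "gaussian_law (Suc (Suc m)) ?G" using G m by simp
    have "(\<integral>\<^sup>+ w. num_critical_points p (pure_powers p) w \<partial>?G) = (\<integral>\<^sup>+ w. fr.nsol (\<lambda>_. 0) w \<partial>?G)"
      using AE_critical_not_degenerate[OF G'] unfolding m
      by (intro nn_integral_cong_AE) (auto elim!: eventually_mono intro!: num_critical_points_eq_nsol)
    also have "\<dots> = ennreal (real p * (1 - (real p - 1) / real p + 4 * ((real p - 1) / real p) * sqrt ((real p - 1) / real p / (1 + 2 * ((real p - 1) / real p)))))"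
      by (subst fr.expectation_nsol[OF G' refl]) (simp add: m)
    also have "\<dots> = ennreal (1 + 4 * ((real p - 1) / (3 * real p - 2)) * sqrt ((3 * real p - 2) * (real p - 1)))"
      by (subst ED_constant[OF _ refl]) (use m in auto)
    finally show ?thesis .
  qed
  finally show "(\<integral>\<^sup>+ \<omega>. num_critical_points p (pure_powers p) (v \<omega>) \<partial>M) =
      ennreal (1 + 4 * ((real p - 1) / (3 * real p - 2)) * sqrt ((3 * real p - 2) * (real p - 1)))" .
qed

end
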